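(* Let $p\in(1,\infty)$, let $(X,d,\mu,\mathcal{E}_p,\mathcal{F}_p,\Gamma_p)$ be a regular local $p$-Dirichlet space and let $n\in\mathbb{N}$. Let $\phi=(\phi_1,\dots,\phi_n):X\to\mathbb{R}^n$ be such that each $\phi_i\in\mathcal{F}_p$ is quasicontinuous, $i=1,\dots,n$, and suppose that $\phi$ is $p$-independent on a Borel set $A\subset X$. Then $$\phi_*(\mathbf{1}_A\cdot\Lambda_\phi)\ll\mathcal{L}_n,$$ where $\Lambda_\phi=\sum_{i=1}^n\Gamma_p\langle\phi_i\rangle$ and $\mathcal{L}_n$ is the Lebesgue measure on $\mathbb{R}^n$.
   Context: Lipschitz notation: $\mathrm{LIP}[g]$ is the smallest Lipschitz constant of $g$, and $\mathrm{Lip}(\mathbb{R})$ is the space of real-valued Lipschitz functions on $\mathbb{R}$. $C_0(X)$ denotes the continuous functions on $X$ with compact support. Inequalities between measures are setwise. A local $p$-Dirichlet space $(X,d,\mu,\mathcal{E}_p,\mathcal{F}_p,\Gamma_p)$ consists of the following. (1) $(X,d,\mu)$ is a locally compact metric space with a Radon measure $\mu$. (2) $\mathcal{F}_p$ is a linear subspace of $L^p(X,\mu)$ and $\mathcal{E}_p:\mathcal{F}_p\to[0,\infty)$ is such that $\mathcal{F}_p$ is a Banach space with norm $\|f\|_{\mathcal{F}_p}=(\|f\|_{L^p}^p+\mathcal{E}_p(f))^{1/p}$. (3) For each $f\in\mathcal{F}_p$ there is a finite nonnegative Borel measure $\Gamma_p\langle f\rangle$ on $X$ with $\Gamma_p\langle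 f\rangle(X)=\mathcal{E}_p(f)$ and $\Gamma_p\langle\lambda f\rangle=|\lambda|^p\Gamma_p\langle f\rangle$ for all $\lambda\in\mathbb{R}$. (4) $\Gamma_p\langle f+g\rangle(A)^{1/p}\le\Gamma_p\langle f\rangle(A)^{1/p}+\Gamma_p\langle g\rangle(A)^{1/p}$ for all $f,g\in\mathcal{F}_p$ and Borel $A\subset X$. (5) For all $f\in\mathcal{F}_p$ and $g\in\mathrm{Lip}(\mathbb{R})$ with $g(0)=0$: $g\circ f\in\mathcal{F}_p$ and $\Gamma_p\langle g\circ f\rangle\le\mathrm{LIP}[g]^p\,\Gamma_p\langle f\rangle$. (6) If $f\in\mathcal{F}_p$, $A\subset X$ is open and $f|_A$ equals a constant $\mu$-a.e., then $\Gamma_p\langle f\rangle(A)=0$. (7) If $f\in L^p(X,\mu)$, $f_i\in\mathcal{F}_p$, $f_i\to f$ in $L^p(X,\mu)$ and $\sup_i\mathcal{E}_p(f_i)<\infty$, then $f\in\mathcal{F}_p$ and $\Gamma_p\langle f\rangle(A)\le\liminf_{i\to\infty}\Gamma_p\langle f_i\rangle(A)$ for every Borel $A\subset X$. The space is regular if $C_0(X)\cap\mathcal{F}_p$ is dense in $\mathcal{F}_p$ (in $\|\cdot\|_{\mathcal{F}_p}$) and dense in $C_0(X)$ in the uniform norm. Capacity: $\mathrm{Cap}(A)=\inf\{\|f\|_{L^p}^p+\mathcal{E}_p(f): f\in\mathcal{F}_p,\ f=1\ \mu\text{-a.e. in a neighborhood of }A\}$, with $\inf\emptyset=\infty$. A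 pointwise defined function $f:X\to\mathbb{R}$ is quasicontinuous if for every $\epsilon>0$ there is an open $O\subset X$ with $\mathrm{Cap}(O)<\epsilon$ and $f|_{X\setminus O}$ continuous. Lattice infimum: for a $\sigma$-finite Borel measure $\Lambda$ and a family $\mathcal{G}$ of measurable functions, $\bigwedge^{\Lambda}_{f\in\mathcal{G}}f$ is the ($\Lambda$-a.e. unique) measurable function $G$ such that $G\le f$ $\Lambda$-a.e. for each $f\in\mathcal{G}$, and any other measurable $\widetilde G$ with this property satisfies $\widetilde G\le G$ $\Lambda$-a.e. $p$-independence: $\phi=(\phi_1,\dots,\phi_n)$ with $\phi_i\in\mathcal{F}_p$ is $p$-independent in a measurable set $A\subset X$ if, with $\Lambda_\phi=\sum_{i=1}^n\Gamma_p\langle\phi_i\rangle$ and $\mathbb{S}^{n-1}$ the Euclidean unit sphere of $\mathbb{R}^n$, $$\bigwedge^{\Lambda_\phi}_{\lambda\in\mathbb{S}^{n-1}}\frac{d\Gamma_p\langle\sum_{i=1}^n\lambda_i\phi_i\rangle}{d\Lambda_\phi}>0\qquad\Lambda_\phi\text{-a.e. in }A.$$ $\phi_*$ denotes pushforward of measures; $\mathbf{1}_A\cdot\Lambda_\phi$ is the restriction of $\Lambda_\phi$ to $A$. *)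

theory Defs
  imports "HOL-Analysis.Analysis"
begin

definition radon_measure :: "'a::metric_space measure \<Rightarrow> bool" where
  "radon_measure M \<longleftrightarrow>
     sets M = sets borel \<and>
     (\<forall>K. compact K \<longrightarrow> emeasure M K < \<infinity>) \<and>
     (\<forall>B\<in>sets borel. emeasure M B = (INF U\<in>{U. open U \<and> B \<subseteq> U}. emeasure M U)) \<and>
     (\<forall>U. open U \<longrightarrow> emeasure M U = (SUP K\<in>{K. compact K \<and> K \<subseteq> U}. emeasure M K))"

(* Functions, not classes.  Measurability is with respect to the completion, so that every pointwise
   representative of an L^p class (for example a quasicontinuous one) is admitted. *)
definition Lp_space :: "real \<Rightarrow> 'a measure \<Rightarrow> ('a \<Rightarrow> real) set" where
  "Lp_space p M = {f \<in> borel_measurable (completion M). integrable (completion M) (\<lambda>x. \<bar>f x\<bar> powr p)}"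

definition Lp_norm :: "real \<Rightarrow> 'a measure \<Rightarrow> ('a \<Rightarrow> real) \<Rightarrow> real" where
  "Lp_norm p M f = (\<integral>x. \<bar>f x\<bar> powr p \<partial>completion M) powr (1 / p)"

definition energy_norm :: "real \<Rightarrow> 'a measure \<Rightarrow> (('a \<Rightarrow> real) \<Rightarrow> real) \<Rightarrow> ('a \<Rightarrow> real) \<Rightarrow> real" where
  "energy_norm p M E f = (Lp_norm p M f powr p + E f) powr (1 / p)"

definition LIP :: "(real \<Rightarrow> real) \<Rightarrow> real" where
  "LIP g = Inf {L. L-lipschitz_on UNIV g}"

(* C_0(X): compact support, not vanishing at infinity. *)
definition C0 :: "('a::topological_space \<Rightarrow> real) set" where
  "C0 = {f. continuous_on UNIV f \<and> compact (closure {x. f x \<noteq> 0})}"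

(* The metric is that of the type 'a.  F is a set of functions saturated under equality mu-a.e., and
   E and \<Gamma> are constant on the classes, so F, E and \<Gamma> represent objects on a subspace of L^p.
   Only the values of E and \<Gamma> on F are relevant. *)
locale local_p_dirichlet_space =
  fixes p :: real
    and \<mu> :: "'a::metric_space measure"
    and E :: "('a \<Rightarrow> real) \<Rightarrow> real"
    and F :: "('a \<Rightarrow> real) set"
    and \<Gamma> :: "('a \<Rightarrow> real) \<Rightarrow> 'a measure"
  assumes locally_compact: "locally compact (UNIV :: 'a set)"
    and radon: "radon_measure \<mu>"
    \<comment> \<open>well-definedness on classes modulo equality a.e.\<close>
    and saturated: "\<lbrakk>f \<in> F; AE x in completion \<mu>. f x = g x\<rbrakk> \<Longrightarrow> g \<in> F"
    and E_cong: "\<lbrakk>f \<in> F; g \<in> F; AE x in completion \<mu>. f x = g x\<rbrakk> \<Longrightarrow> E f = E g"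
    and \<Gamma>_cong: "\<lbrakk>f \<in> F; g \<in> F; AE x in completion \<mu>. f x = g x\<rbrakk> \<Longrightarrow> \<Gamma> f = \<Gamma> g"
    \<comment> \<open>linear subspace of $L^p$\<close>
    and subset_Lp: "F \<subseteq> Lp_space p \<mu>"
    and zero_mem: "(\<lambda>x. 0) \<in> F"
    and add_mem: "\<lbrakk>f \<in> F; g \<in> F\<rbrakk> \<Longrightarrow> (\<lambda>x. f x + g x) \<in> F"
    and scale_mem: "f \<in> F \<Longrightarrow> (\<lambda>x. c * f x) \<in> F"
    and E_nonneg: "f \<in> F \<Longrightarrow> 0 \<le> E f"
    \<comment> \<open>Banach space\<close>
    and norm_triangle: "\<lbrakk>f \<in> F; g \<in> F\<rbrakk> \<Longrightarrow>
          energy_norm p \<mu> E (\<lambda>x. f x + g x) \<le> energy_norm p \<mu> E f + energy_norm p \<mu> E g"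
    and norm_scale: "f \<in> F \<Longrightarrow> energy_norm p \<mu> E (\<lambda>x. c * f x) = \<bar>c\<bar> * energy_norm p \<mu> E f"
    and norm_definite: "\<lbrakk>f \<in> F; energy_norm p \<mu> E f = 0\<rbrakk> \<Longrightarrow> AE x in completion \<mu>. f x = 0"
    and complete: "\<And>u :: nat \<Rightarrow> 'a \<Rightarrow> real.
          \<lbrakk>\<And>i. u i \<in> F;
           \<And>e. 0 < e \<Longrightarrow> \<exists>N. \<forall>i\<ge>N. \<forall>j\<ge>N. energy_norm p \<mu> E (\<lambda>x. u i x - u j x) < e\<rbrakk>
          \<Longrightarrow> \<exists>f\<in>F. (\<lambda>i. energy_norm p \<mu> E (\<lambda>x. u i x - f x)) \<longlonglongrightarrow> 0"
    \<comment> \<open>energy measures\<close>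
    and sets_\<Gamma>: "f \<in> F \<Longrightarrow> sets (\<Gamma> f) = sets borel"
    and finite_\<Gamma>: "f \<in> F \<Longrightarrow> finite_measure (\<Gamma> f)"
    and \<Gamma>_total: "f \<in> F \<Longrightarrow> measure (\<Gamma> f) UNIV = E f"
    and \<Gamma>_scale: "\<lbrakk>f \<in> F; A \<in> sets borel\<rbrakk> \<Longrightarrow>
          measure (\<Gamma> (\<lambda>x. c * f x)) A = \<bar>c\<bar> powr p * measure (\<Gamma> f) A"
    and \<Gamma>_triangle: "\<lbrakk>f \<in> F; g \<in> F; A \<in> sets borel\<rbrakk> \<Longrightarrow>
          measure (\<Gamma> (\<lambda>x. f x + g x)) A powr (1 / p)
            \<le> measure (\<Gamma> f) A powr (1 / p) + measure (\<Gamma> g) A powr (1 / p)"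
    and lipschitz_mem: "\<And>f (g :: real \<Rightarrow> real).
          \<lbrakk>f \<in> F; \<exists>L. L-lipschitz_on UNIV g; g 0 = 0\<rbrakk> \<Longrightarrow> g \<circ> f \<in> F"
    and \<Gamma>_lipschitz: "\<And>f (g :: real \<Rightarrow> real) A.
          \<lbrakk>f \<in> F; \<exists>L. L-lipschitz_on UNIV g; g 0 = 0; A \<in> sets borel\<rbrakk> \<Longrightarrow>
          measure (\<Gamma> (g \<circ> f)) A \<le> LIP g powr p * measure (\<Gamma> f) A"
    and \<Gamma>_local: "\<lbrakk>f \<in> F; open A; AE x in completion \<mu>. x \<in> A \<longrightarrow> f x = c\<rbrakk> \<Longrightarrow> measure (\<Gamma> f) A = 0"
    \<comment> \<open>lower semicontinuity\<close>
    and limit_mem: "\<And>f (u :: nat \<Rightarrow> 'a \<Rightarrow> real) C.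
          \<lbrakk>f \<in> Lp_space p \<mu>; \<And>i. u i \<in> F; (\<lambda>i. Lp_norm p \<mu> (\<lambda>x. u i x - f x)) \<longlonglongrightarrow> 0;
           \<And>i. E (u i) \<le> C\<rbrakk> \<Longrightarrow> f \<in> F"
    and \<Gamma>_lower_semicontinuous: "\<And>f (u :: nat \<Rightarrow> 'a \<Rightarrow> real) C A.
          \<lbrakk>f \<in> Lp_space p \<mu>; \<And>i. u i \<in> F; (\<lambda>i. Lp_norm p \<mu> (\<lambda>x. u i x - f x)) \<longlonglongrightarrow> 0;
           \<And>i. E (u i) \<le> C; A \<in> sets borel\<rbrakk>
          \<Longrightarrow> emeasure (\<Gamma> f) A \<le> liminf (\<lambda>i. emeasure (\<Gamma> (u i)) A)"

locale regular_local_p_dirichlet_space = local_p_dirichlet_space +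
  assumes dense_F: "\<lbrakk>f \<in> F; 0 < e\<rbrakk> \<Longrightarrow> \<exists>g \<in> C0 \<inter> F. energy_norm p \<mu> E (\<lambda>x. f x - g x) < e"
    and dense_C0: "\<lbrakk>f \<in> C0; 0 < e\<rbrakk> \<Longrightarrow> \<exists>g \<in> C0 \<inter> F. \<forall>x. \<bar>f x - g x\<bar> < e"

definition capacity ::
  "real \<Rightarrow> 'a::metric_space measure \<Rightarrow> (('a \<Rightarrow> real) \<Rightarrow> real) \<Rightarrow> ('a \<Rightarrow> real) set \<Rightarrow> 'a set \<Rightarrow> ennreal" where
  "capacity p \<mu> E F A =
     (INF f \<in> {f \<in> F. \<exists>U. open U \<and> A \<subseteq> U \<and> (AE x in completion \<mu>. x \<in> U \<longrightarrow> f x = 1)}.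
        ennreal (Lp_norm p \<mu> f powr p + E f))"

definition quasicontinuous ::
  "real \<Rightarrow> 'a::metric_space measure \<Rightarrow> (('a \<Rightarrow> real) \<Rightarrow> real) \<Rightarrow> ('a \<Rightarrow> real) set \<Rightarrow> ('a \<Rightarrow> real) \<Rightarrow> bool" where
  "quasicontinuous p \<mu> E F f \<longleftrightarrow>
     (\<forall>e>0. \<exists>U. open U \<and> capacity p \<mu> E F U < ennreal e \<and> continuous_on (- U) f)"

definition is_lattice_inf :: "'a measure \<Rightarrow> ('a \<Rightarrow> ennreal) set \<Rightarrow> ('a \<Rightarrow> ennreal) \<Rightarrow> bool" where
  "is_lattice_inf \<Lambda> \<G> G \<longleftrightarrow>
     G \<in> borel_measurable \<Lambda> \<and> (\<forall>f\<in>\<G>. AE x in \<Lambda>. G x \<le> f x) \<and>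
     (\<forall>H\<in>borel_measurable \<Lambda>. (\<forall>f\<in>\<G>. AE x in \<Lambda>. H x \<le> f x) \<longrightarrow> (AE x in \<Lambda>. H x \<le> G x))"

(* A representative; it is unique up to \<Lambda>-null sets.  The codomain is that of RN_deriv. *)
definition lattice_inf :: "'a measure \<Rightarrow> ('a \<Rightarrow> ennreal) set \<Rightarrow> 'a \<Rightarrow> ennreal" where
  "lattice_inf \<Lambda> \<G> = (SOME G. is_lattice_inf \<Lambda> \<G> G)"

definition total_energy_measure ::
  "(('a::metric_space \<Rightarrow> real) \<Rightarrow> 'a measure) \<Rightarrow> ('a \<Rightarrow> real ^ 'n) \<Rightarrow> 'a measure" where
  "total_energy_measure \<Gamma> \<phi> =
     measure_of UNIV (sets borel) (\<lambda>B. \<Sum>i\<in>UNIV. emeasure (\<Gamma> (\<lambda>x. \<phi> x $ i)) B)"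

lemma sets_total_energy_measure [simp]: "sets (total_energy_measure \<Gamma> \<phi>) = sets borel"
  unfolding total_energy_measure_def
  by (metis sets.sets_measure_of_eq space_borel)

lemma emeasure_total_energy_measure:
  fixes \<phi> :: "'a::metric_space \<Rightarrow> real ^ 'n"
  assumes "\<And>i. sets (\<Gamma> (\<lambda>x. \<phi> x $ i)) = sets borel" and "B \<in> sets borel"
  shows "emeasure (total_energy_measure \<Gamma> \<phi>) B = (\<Sum>i\<in>UNIV. emeasure (\<Gamma> (\<lambda>x. \<phi> x $ i)) B)"
proof (rule emeasure_measure_of[OF total_energy_measure_def])
  show "sets borel \<subseteq> Pow (UNIV :: 'a set)" by simp
  show "positive (sets (total_energy_measure \<Gamma> \<phi>)) (\<lambda>B. \<Sum>i\<in>UNIV. emeasure (\<Gamma> (\<lambda>x. \<phi> x $ i)) B)"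
    by (simp add: positive_def)
  show "countably_additive (sets (total_energy_measure \<Gamma> \<phi>))
          (\<lambda>B. \<Sum>i\<in>UNIV. emeasure (\<Gamma> (\<lambda>x. \<phi> x $ i)) B)"
  proof (rule countably_additiveI)
    fix S :: "nat \<Rightarrow> 'a set"
    assume S: "range S \<subseteq> sets (total_energy_measure \<Gamma> \<phi>)" "disjoint_family S"
    have "(\<Sum>k. \<Sum>i\<in>UNIV. emeasure (\<Gamma> (\<lambda>x. \<phi> x $ i)) (S k))
            = (\<Sum>i\<in>UNIV. \<Sum>k. emeasure (\<Gamma> (\<lambda>x. \<phi> x $ i)) (S k))"
      by (rule suminf_sum) simp
    also have "\<dots> = (\<Sum>i\<in>UNIV. emeasure (\<Gamma> (\<lambda>x. \<phi> x $ i)) (\<Union>k. S k))"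
      using S assms(1) by (intro sum.cong suminf_emeasure) auto
    finally show "(\<Sum>k. \<Sum>i\<in>UNIV. emeasure (\<Gamma> (\<lambda>x. \<phi> x $ i)) (S k))
            = (\<Sum>i\<in>UNIV. emeasure (\<Gamma> (\<lambda>x. \<phi> x $ i)) (\<Union>k. S k))" .
  qed
  show "B \<in> sets (total_energy_measure \<Gamma> \<phi>)" using assms by simp
qed

definition p_independent ::
  "(('a::metric_space \<Rightarrow> real) \<Rightarrow> 'a measure) \<Rightarrow> ('a \<Rightarrow> real ^ 'n) \<Rightarrow> 'a set \<Rightarrow> bool" where
  "p_independent \<Gamma> \<phi> A \<longleftrightarrow>
     (AE x in total_energy_measure \<Gamma> \<phi>. x \<in> A \<longrightarrow>
        0 < lattice_inf (total_energy_measure \<Gamma> \<phi>)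
              ((\<lambda>v. RN_deriv (total_energy_measure \<Gamma> \<phi>) (\<Gamma> (\<lambda>y. \<Sum>i\<in>UNIV. v $ i * \<phi> y $ i)))
                 ` sphere (0 :: real ^ 'n) 1) x)"

(* Push-forward of a measure under a map that need only be measurable for the completion: a
   quasicontinuous function is Borel only off sets of arbitrarily small capacity. *)
definition push_forward :: "'a measure \<Rightarrow> ('a \<Rightarrow> 'b::topological_space) \<Rightarrow> 'b measure" where
  "push_forward M f = distr (completion M) borel f"

end

(*
  Suppose that the pushforward nu charges a compact Lebesgue null set K, and restrict it to K.

  For every d > 0 there is a firmly nonexpansive map T of R^n with |T| <= d that, at nu-almost every x, translates
  along a segment: T (x + e) = T x + e and T (x - e) = T x - e for some e other than 0.  It is the proximal map
  x |-> argmin_p (g p + |x - p|^2 / 2) of a convex function g on the ball of radius d, where g minimises the convex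
  functional "integral of g against normalised Lebesgue measure minus integral of its Moreau envelope against nu".
  This is the dual of weak (barycentric) optimal transport from nu to Lebesgue measure: since nu is singular, almost no
  image point T x may be an extreme point of the graph of g, so g is affine on a segment around T x.
  After mollification one obtains smooth 1-Lipschitz fields H on R^n that are uniformly small, while the integral of
  div H against nu is at least nu(K) / 2.

  Suitable fields H_k tending to 0 have derivatives that converge in L^2(nu), by the parallelogram law.  Lower
  semicontinuity of the energy measures, applied to the components of H_k composed with phi minus a linear function,
  together with the bound of the energy of h o phi by the integral of |grad h(phi)|^p, shows that the limit of the
  derivatives is degenerate for the energy densities.  By p-independence it is zero, which contradicts the lower bound
  on the divergence.
*)
theory Submission
  imports Defs "HOL-Complex_Analysis.Great_Picard"
begin

section \<open>Proximal maps\<close>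

text \<open>The axioms give no bilinear energy and only compositions with functions of one variable.
  The handle on degeneracy is therefore lower semicontinuity: if fields tend to 0 with bounded
  derivatives, a linear function of phi is a limit of linear functions minus field components, and
  its energy on a set is at most the limit of their energies, which is small where the derivative of
  the field is close to the linear function. So the fields must vanish uniformly while their
  derivatives do not. Weak convergence of the derivatives would not control integrals of p-th
  powers; strong convergence is obtained by restricting the fields through convex conditions only.
  Firm nonexpansiveness makes the divergence nonnegative, so that Fatou's lemma applies, and makes
  it large as soon as a single direction is translated. Factors of the dimension lost in the chain
  rule do no harm, because they multiply a tolerance that can be chosen arbitrarily small.
  Quasicontinuity enters through locality on level sets: a function of phi has no energy on a Borel
  set where it is constant.\<close>

lemma firmly_nonexpansive_nonexpansive:
  fixes T :: "'b::real_inner \<Rightarrow> 'b"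
  assumes "\<And>x y. (norm (T x - T y))\<^sup>2 \<le> (x - y) \<bullet> (T x - T y)"
  shows "norm (T x - T y) \<le> norm (x - y)"
proof -
  have "norm (T x - T y) * norm (T x - T y) \<le> norm (x - y) * norm (T x - T y)"
    using assms[of x y] norm_cauchy_schwarz[of "x - y" "T x - T y"] by (simp add: power2_eq_square)
  then show ?thesis
    by (cases "norm (T x - T y) = 0") (simp_all add: mult_le_cancel_right)
qed

definition moreau :: "'b::euclidean_space set \<Rightarrow> ('b \<Rightarrow> real) \<Rightarrow> 'b \<Rightarrow> real" where
  "moreau D g x = (INF p\<in>D. g p + (norm (x - p))\<^sup>2 / 2)"

definition prox :: "'b::euclidean_space set \<Rightarrow> ('b \<Rightarrow> real) \<Rightarrow> 'b \<Rightarrow> 'b" where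
  "prox D g x = (SOME p. p \<in> D \<and> (\<forall>q\<in>D. g p + (norm (x - p))\<^sup>2 / 2 \<le> g q + (norm (x - q))\<^sup>2 / 2))"

locale convex_potential =
  fixes D :: "'b::euclidean_space set" and g :: "'b \<Rightarrow> real"
  assumes compact_D: "compact D" and convex_D: "convex D" and D_nonempty: "D \<noteq> {}"
    and convex_g: "convex_on D g" and continuous_g: "continuous_on D g"
begin

lemma prox:
  "prox D g x \<in> D" "q \<in> D \<Longrightarrow> g (prox D g x) + (norm (x - prox D g x))\<^sup>2 / 2 \<le> g q + (norm (x - q))\<^sup>2 / 2"
proof -
  have "continuous_on D (\<lambda>p. g p + (norm (x - p))\<^sup>2 / 2)"
    by (intro continuous_intros continuous_g) auto
  from continuous_attains_inf[OF compact_D D_nonempty this]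
  have "\<exists>p. p \<in> D \<and> (\<forall>q\<in>D. g p + (norm (x - p))\<^sup>2 / 2 \<le> g q + (norm (x - q))\<^sup>2 / 2)" by blast
  from someI_ex[OF this]
  have "prox D g x \<in> D \<and> (\<forall>q\<in>D. g (prox D g x) + (norm (x - prox D g x))\<^sup>2 / 2 \<le> g q + (norm (x - q))\<^sup>2 / 2)"
    unfolding prox_def by blast
  then show "prox D g x \<in> D" "q \<in> D \<Longrightarrow> g (prox D g x) + (norm (x - prox D g x))\<^sup>2 / 2 \<le> g q + (norm (x - q))\<^sup>2 / 2"
    by auto
qed

lemma moreau_eq: "moreau D g x = g (prox D g x) + (norm (x - prox D g x))\<^sup>2 / 2"
  unfolding moreau_def
  by (rule cInf_eq_minimum) (use prox in auto)

lemma moreau_le: "q \<in> D \<Longrightarrow> moreau D g x \<le> g q + (norm (x - q))\<^sup>2 / 2"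
  using prox(2) moreau_eq by simp

lemma norm_diff_sq: "(norm (x - (q::'b)))\<^sup>2 = (norm (x - y))\<^sup>2 - 2 * ((x - y) \<bullet> (q - y)) + (norm (q - y))\<^sup>2"
  unfolding power2_norm_eq_inner by (simp add: algebra_simps inner_commute)

text \<open>First-order optimality: \<open>x - prox D g x\<close> is a subgradient, at the proximal
  point, of \<open>g\<close> extended by infinity outside \<open>D\<close>. Moving by a fraction
  \<open>t\<close> towards a violating \<open>q\<close> would gain to first order in
  \<open>t\<close> against a cost of second order.\<close>

lemma prox_variational:
  assumes "q \<in> D"
  shows "g (prox D g x) + (x - prox D g x) \<bullet> (q - prox D g x) \<le> g q"
proof (rule ccontr)
  let ?y = "prox D g x"
  define e where "e = g ?y + (x - ?y) \<bullet> (q - ?y) - g q"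
  assume "\<not> ?thesis"
  then have e: "e > 0" by (simp add: e_def)
  define N where "N = (norm (q - ?y))\<^sup>2"
  have N: "N \<ge> 0" by (simp add: N_def)
  \<comment> \<open>Small enough that the cost \<open>t\<^sup>2 * N / 2\<close> stays below the gain
    \<open>t * e\<close>; the \<open>+ 1\<close> covers \<open>N = 0\<close>.\<close>
  define t where "t = min 1 (e / (N + 1))"
  have t: "0 < t" "t \<le> 1" using e N by (auto simp: t_def)
  have tN: "t * N < 2 * e"
  proof -
    have "t * N \<le> (e / (N + 1)) * N" using N by (intro mult_right_mono) (auto simp: t_def)
    also have "\<dots> \<le> e" using N e by (simp add: field_simps)
    finally show ?thesis using e by linarith
  qed
  let ?z = "(1 - t) *\<^sub>R ?y + t *\<^sub>R q"
  have zD: "?z \<in> D" using convex_D assms prox(1) t by (intro convexD) auto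
  have gz: "g ?z \<le> (1 - t) * g ?y + t * g q"
    using convex_g assms prox(1) t by (intro convex_onD) auto
  have "?z - ?y = t *\<^sub>R (q - ?y)" by (simp add: algebra_simps)
  then have nz: "(norm (x - ?z))\<^sup>2 = (norm (x - ?y))\<^sup>2 - 2 * t * ((x - ?y) \<bullet> (q - ?y)) + t\<^sup>2 * N"
    using norm_diff_sq[of x ?z ?y] by (simp add: N_def power_mult_distrib)
  have "g ?y + (norm (x - ?y))\<^sup>2 / 2 \<le> g ?z + (norm (x - ?z))\<^sup>2 / 2" by (rule prox(2)[OF zD])
  then have "0 \<le> - t * e + t\<^sup>2 * N / 2" using gz nz unfolding e_def by (simp add: algebra_simps)
  then have "0 \<le> t * (t * N - 2 * e)" by (simp add: algebra_simps power2_eq_square)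
  then show False using t tN by (simp add: zero_le_mult_iff)
qed

text \<open>Adding the subgradient inequality at \<open>y\<close> to the one at the proximal point
  leaves the squared distance of the two points, which must then be 0.\<close>

lemma prox_eqI:
  assumes "y \<in> D" and "\<And>q. q \<in> D \<Longrightarrow> g y + (x - y) \<bullet> (q - y) \<le> g q"
  shows "prox D g x = y"
proof -
  let ?z = "prox D g x"
  have 1: "g y + (x - y) \<bullet> (?z - y) \<le> g ?z" by (rule assms(2)[OF prox(1)])
  have 2: "g ?z + (x - ?z) \<bullet> (y - ?z) \<le> g y" by (rule prox_variational[OF assms(1)])
  have "(norm (?z - y))\<^sup>2 = (x - y) \<bullet> (?z - y) + (x - ?z) \<bullet> (y - ?z)"
    unfolding power2_norm_eq_inner by (simp add: algebra_simps inner_commute)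
  then have "(norm (?z - y))\<^sup>2 \<le> 0" using 1 2 by linarith
  then show ?thesis by simp
qed

lemma prox_eq_minimiser:
  assumes "y \<in> D" and "g y + (norm (x - y))\<^sup>2 / 2 \<le> moreau D g x"
  shows "prox D g x = y"
proof -
  let ?z = "prox D g x"
  have 2: "g ?z + (x - ?z) \<bullet> (y - ?z) \<le> g y" by (rule prox_variational[OF assms(1)])
  have "(norm (y - ?z))\<^sup>2 \<le> 0"
    using 2 assms(2) norm_diff_sq[of x y ?z] unfolding moreau_eq by linarith
  then show ?thesis by simp
qed

text \<open>Monotonicity of the subdifferential: the subgradient inequality at each image is tested
  at the other image, and the two are added.\<close>

lemma prox_firmly_nonexpansive:
  "(norm (prox D g x - prox D g x'))\<^sup>2 \<le> (x - x') \<bullet> (prox D g x - prox D g x')"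
proof -
  let ?y = "prox D g x" and ?z = "prox D g x'"
  have "g ?y + (x - ?y) \<bullet> (?z - ?y) \<le> g ?z" "g ?z + (x' - ?z) \<bullet> (?y - ?z) \<le> g ?y"
    by (auto intro: prox_variational prox)
  moreover have "(norm (?y - ?z))\<^sup>2 - (x - x') \<bullet> (?y - ?z) = (x - ?y) \<bullet> (?z - ?y) + (x' - ?z) \<bullet> (?y - ?z)"
    unfolding power2_norm_eq_inner by (simp add: algebra_simps inner_commute)
  ultimately show ?thesis by linarith
qed

lemma prox_nonexpansive: "norm (prox D g x - prox D g x') \<le> norm (x - x')"
  by (rule firmly_nonexpansive_nonexpansive[OF prox_firmly_nonexpansive])

lemma continuous_prox: "continuous_on S (prox D g)"
proof -
  have "1-lipschitz_on S (prox D g)"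
    by (rule lipschitz_onI) (use prox_nonexpansive in \<open>auto simp: dist_norm\<close>)
  then show ?thesis by (rule lipschitz_on_continuous_on)
qed

lemma continuous_moreau: "continuous_on S (moreau D g)"
  unfolding moreau_eq
  by (intro continuous_intros continuous_prox continuous_on_compose2[OF continuous_g]) (use prox in auto)

text \<open>The affine minorant of \<open>g\<close> with slope \<open>x - prox D g x\<close> touches
  \<open>g\<close> at the midpoint of the segment. As the value there is the mean of the end values,
  it touches at both ends, so the same slope is a subgradient at \<open>a\<close>.\<close>

lemma prox_on_affine_segment:
  assumes "a \<in> D" "b \<in> D" and y: "prox D g x = (1/2) *\<^sub>R (a + b)"
    and "g (prox D g x) = (g a + g b) / 2"
  shows "prox D g (x + (a - prox D g x)) = a"
proof (rule prox_eqI)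
  let ?y = "prox D g x"
  have "?y + ?y = a + b" unfolding y using scaleR_add_left[of "1/2" "1/2" "a + b"] by simp
  moreover have "(a - ?y) + (b - ?y) = (a + b) - (?y + ?y)" by (simp add: algebra_simps)
  ultimately have "(a - ?y) + (b - ?y) = 0" by (simp only: diff_self)
  then have ab: "(a - ?y) = - (b - ?y)" by (simp only: eq_neg_iff_add_eq_0)
  have va: "g ?y + (x - ?y) \<bullet> (a - ?y) \<le> g a" and vb: "g ?y + (x - ?y) \<bullet> (b - ?y) \<le> g b"
    using prox_variational[OF assms(1)] prox_variational[OF assms(2)] by blast+
  have "(x - ?y) \<bullet> (a - ?y) = - ((x - ?y) \<bullet> (b - ?y))" using ab by (metis inner_minus_right)
  then have ga: "g a = g ?y + (x - ?y) \<bullet> (a - ?y)" proof -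
    have "2 * g ?y = g a + g b" using assms(4) by simp
    then show ?thesis using va vb \<open>(x - ?y) \<bullet> (a - ?y) = - ((x - ?y) \<bullet> (b - ?y))\<close> by linarith
  qed
  show "a \<in> D" by fact
  fix q assume "q \<in> D"
  then have "g ?y + (x - ?y) \<bullet> (q - ?y) \<le> g q" by (rule prox_variational)
  moreover have "(x + (a - ?y) - a) \<bullet> (q - a) = (x - ?y) \<bullet> (q - ?y) - (x - ?y) \<bullet> (a - ?y)"
    by (simp add: algebra_simps)
  ultimately show "g a + (x + (a - ?y) - a) \<bullet> (q - a) \<le> g q" using ga by linarith
qed

end

lemma moreau_add_const:
  assumes "convex_potential D g"
  shows "moreau D (\<lambda>p. g p + c) x = moreau D g x + c"
proof -
  interpret convex_potential D g by fact
  show ?thesis unfolding moreau_eq unfolding moreau_def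
    by (rule cInf_eq_minimum) (use prox in \<open>auto simp: algebra_simps\<close>)
qed

lemma moreau_mono_dist:
  assumes "convex_potential D g" "convex_potential D h" and "\<And>p. p \<in> D \<Longrightarrow> g p \<le> h p + c"
  shows "moreau D g x \<le> moreau D h x + c"
proof -
  interpret g: convex_potential D g by fact
  interpret h: convex_potential D h by fact
  have "moreau D g x \<le> g (prox D h x) + (norm (x - prox D h x))\<^sup>2 / 2" by (rule g.moreau_le[OF h.prox(1)])
  also have "\<dots> \<le> moreau D h x + c" using assms(3)[OF h.prox(1)] unfolding h.moreau_eq by simp
  finally show ?thesis .
qed

section \<open>Convexified perturbations of a potential and their Moreau envelopes\<close>

locale perturbation = convex_potential D g for D :: "'b::euclidean_space set" and g +
  fixes L R :: real and \<psi> :: "'b \<Rightarrow> real"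
  assumes lipschitz_g: "L-lipschitz_on D g"
    and cont_psi: "continuous_on D \<psi>" and psi: "\<And>p. p \<in> D \<Longrightarrow> 0 \<le> \<psi> p \<and> \<psi> p \<le> 1"
    and bound_L: "\<And>p. p \<in> D \<Longrightarrow> R + norm p \<le> L"
begin

text \<open>The infimum in \<open>lift\<close> below runs over \<open>H\<close>, which makes it the \<open>L\<close>-Lipschitz convex envelope of
  \<open>g + \<tau> \<psi>\<close> on \<open>D\<close>. Working with the convex hull of the joint graph, which does not depend on \<open>\<tau>\<close>, gives compactness
  as \<open>\<tau>\<close> tends to 0.\<close>

definition H :: "('b \<times> real \<times> real) set" where
  "H = convex hull ((\<lambda>z. (z, g z, \<psi> z)) ` D)"

lemma compact_graph: "compact ((\<lambda>z. (z, g z, \<psi> z)) ` D)"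
  by (intro compact_continuous_image continuous_intros continuous_g cont_psi compact_D)

lemma compact_H: "compact H"
  unfolding H_def by (rule compact_convex_hull[OF compact_graph])

lemma H_nonempty: "H \<noteq> {}"
  unfolding H_def using D_nonempty by simp

lemma graph_H: "z \<in> D \<Longrightarrow> (z, g z, \<psi> z) \<in> H"
  unfolding H_def by (simp add: hull_inc)

text \<open>The joint graph lies in the epigraph of \<open>g\<close> times the unit interval, which
  is convex, hence so does its hull.\<close>

lemma H_bounds:
  assumes "(b, c, s) \<in> H"
  shows "b \<in> D" "g b \<le> c" "0 \<le> s" "s \<le> 1"
proof -
  let ?S = "{(b, c, s). b \<in> D \<and> g b \<le> c \<and> 0 \<le> s \<and> s \<le> (1::real)}"
  have "convex ?S"
  proof (rule convexI)
    fix h h' and u v :: real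
    assume "h \<in> ?S" "h' \<in> ?S" "0 \<le> u" "0 \<le> v" "u + v = 1"
    then obtain b c s b' c' s' where h: "h = (b, c, s)" "h' = (b', c', s')" and A: "b \<in> D" "g b \<le> c" "0 \<le> s" "s \<le> 1" "b' \<in> D" "g b' \<le> c'" "0 \<le> s'" "s' \<le> 1" "0 \<le> u" "0 \<le> v" "u + v = 1"
      by auto
    have 1: "u *\<^sub>R b + v *\<^sub>R b' \<in> D" using A convex_D by (intro convexD) auto
    have "g (u *\<^sub>R b + v *\<^sub>R b') \<le> u * g b + v * g b'"
      using A convex_g by (auto simp: convex_on_def)
    also have "\<dots> \<le> u * c + v * c'" using A by (intro add_mono mult_left_mono) auto
    finally have "g (u *\<^sub>R b + v *\<^sub>R b') \<le> u * c + v * c'" .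
    moreover have "0 \<le> u * s + v * s'" using A by simp
    moreover have "u * s + v * s' \<le> 1" using A by (intro convex_bound_le) auto
    ultimately show "u *\<^sub>R h + v *\<^sub>R h' \<in> ?S" using 1 h by simp
  qed
  then have "H \<subseteq> ?S" unfolding H_def by (intro hull_minimal) (use psi in auto)
  then show "b \<in> D" "g b \<le> c" "0 \<le> s" "s \<le> 1" using assms by auto
qed

text \<open>The points of \<open>H\<close> over \<open>y\<close> at the least possible height
  \<open>g y\<close> form a face of \<open>H\<close>. A face of the hull of a compact set is the
  hull of generators, and only one generator lies over \<open>y\<close>.\<close>

lemma H_extreme:
  assumes ext: "\<And>a b. a \<in> D \<Longrightarrow> b \<in> D \<Longrightarrow> y = (1/2) *\<^sub>R (a + b) \<Longrightarrow> g y = (g a + g b) / 2 \<Longrightarrow> a = b"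
    and "(y, g y, s) \<in> H"
  shows "s = \<psi> y"
proof -
  let ?F = "{h\<in>H. fst h = y \<and> fst (snd h) = g y}"
  have conv: "convex H" by (simp add: H_def)
  have "?F face_of H"
    unfolding face_of_def
  proof (intro conjI ballI impI)
    show "convex ?F"
      using conv by (auto simp: convex_def algebra_simps simp flip: scaleR_add_left distrib_right)
    fix h h' k assume h: "h \<in> H" and h': "h' \<in> H" and k: "k \<in> ?F" and seg: "k \<in> open_segment h h'"
    obtain b c s where hh: "h = (b, c, s)" by (cases h)
    obtain b' c' s' where hh': "h' = (b', c', s')" by (cases h')
    from seg obtain u where u: "0 < u" "u < 1" and k': "k = (1 - u) *\<^sub>R h + u *\<^sub>R h'"
      by (auto simp: in_segment)
    have bd: "b \<in> D" "g b \<le> c" "b' \<in> D" "g b' \<le> c'" using H_bounds h h' hh hh' by blast+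
    have y: "y = (1 - u) *\<^sub>R b + u *\<^sub>R b'" and gy: "g y = (1 - u) * c + u * c'"
      using k k' hh hh' by auto
    have cv: "g ((1 - t) *\<^sub>R b + t *\<^sub>R b') \<le> (1 - t) * g b + t * g b'" if "0 \<le> t" "t \<le> 1" for t
      using convex_g bd that by (intro convex_onD) auto
    \<comment> \<open>\<open>ext\<close> speaks of midpoints, while \<open>y\<close> divides the
      segment from \<open>b\<close> to \<open>b'\<close> at the parameter \<open>u\<close>. The
      parameters \<open>u - r\<close> and \<open>u + r\<close> bound a subsegment with midpoint
      \<open>y\<close>.\<close>
    define r where "r = min u (1 - u)"
    have r: "0 < r" "r \<le> u" "r \<le> 1 - u" using u by (auto simp: r_def)
    let ?p = "\<lambda>t. (1 - t) *\<^sub>R b + t *\<^sub>R b'"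
    have pD: "?p (u - r) \<in> D" "?p (u + r) \<in> D" using convex_D bd r u by (auto intro!: convexD)
    have mid: "y = (1/2) *\<^sub>R (?p (u - r) + ?p (u + r))"
    proof -
      have "?p (u - r) + ?p (u + r) = y + y" unfolding y by (simp add: algebra_simps)
      then show ?thesis by simp
    qed
    have mix: "(1 - u) * g b + u * g b' \<le> g y"
      unfolding gy using bd u by (intro add_mono mult_left_mono) auto
    have "g (?p (u - r)) \<le> (1 - (u - r)) * g b + (u - r) * g b'" using cv r u by simp
    moreover have "g (?p (u + r)) \<le> (1 - (u + r)) * g b + (u + r) * g b'" using cv r u by simp
    ultimately have "g (?p (u - r)) + g (?p (u + r)) \<le> 2 * ((1 - u) * g b + u * g b')"
      by (simp add: algebra_simps)
    then have le: "(g (?p (u - r)) + g (?p (u + r))) / 2 \<le> g y" using mix by simp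
    have ge: "g y \<le> (g (?p (u - r)) + g (?p (u + r))) / 2"
    proof -
      have "y = (1 - 1/2) *\<^sub>R ?p (u - r) + (1/2) *\<^sub>R ?p (u + r)"
        unfolding mid by (simp only: scaleR_add_right) simp
      then have "g y \<le> (1 - 1/2) * g (?p (u - r)) + (1/2) * g (?p (u + r))"
        using convex_onD[OF convex_g _ _ pD, of "1/2"] by (simp only:)
      moreover have "A \<le> (1 - 1/2) * B + (1/2) * C \<Longrightarrow> A \<le> (B + C) / 2" for A B C :: real by simp
      ultimately show ?thesis by blast
    qed
    have "?p (u - r) = ?p (u + r)" by (rule ext[OF pD mid]) (use le ge in linarith)
    moreover have "?p (u + r) - ?p (u - r) = r *\<^sub>R (b' - b) + r *\<^sub>R (b' - b)" by (simp add: algebra_simps)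
    ultimately have "(r + r) *\<^sub>R (b' - b) = 0" by (simp only: scaleR_add_left) simp
    then have bb: "b = b'" using r by simp
    then have yb: "y = b" using y by (simp flip: scaleR_add_left)
    \<comment> \<open>Over the single point \<open>b = b'\<close> both heights are at least
      \<open>g b\<close> and average to it, so both are equal to it.\<close>
    have "(1 - u) * (c - g b) + u * (c' - g b) = 0" using gy yb by (simp add: algebra_simps)
    moreover have "0 \<le> (1 - u) * (c - g b)" "0 \<le> u * (c' - g b)" using bd u bb by auto
    ultimately have "(1 - u) * (c - g b) = 0" "u * (c' - g b) = 0" by linarith+
    then have "c = g b" "c' = g b" using u by auto
    then show "h \<in> ?F" "h' \<in> ?F" using h h' hh hh' bb yb by auto
  qed auto
  then obtain S' where S': "S' \<subseteq> (\<lambda>z. (z, g z, \<psi> z)) ` D" "?F = convex hull S'"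
    unfolding H_def by (rule face_of_convex_hull_subset[OF compact_graph])
  have "S' \<subseteq> ?F" using S'(2) hull_subset by metis
  have "S' \<subseteq> {(y, g y, \<psi> y)}"
  proof
    fix k assume k: "k \<in> S'"
    then obtain z where "k = (z, g z, \<psi> z)" using S'(1) by blast
    moreover have "fst k = y" using k \<open>S' \<subseteq> ?F\<close> by blast
    ultimately show "k \<in> {(y, g y, \<psi> y)}" by simp
  qed
  then have "?F \<subseteq> {(y, g y, \<psi> y)}" unfolding S'(2) by (intro hull_minimal) auto
  moreover have "(y, g y, s) \<in> ?F" using assms(2) by auto
  ultimately show ?thesis by blast
qed

text \<open>On \<open>H\<close> the function \<open>c + (norm (x - b))\<^sup>2 / 2\<close> attains
  the value \<open>moreau D g x\<close> only over the proximal point at height \<open>g\<close>,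
  where extremality forces \<open>s = 1\<close>. On the compact part \<open>s \<le> 1 - e\<close> it
  therefore stays above that value by a positive gap.\<close>

lemma H_near_extreme:
  assumes ext: "\<And>a b. a \<in> D \<Longrightarrow> b \<in> D \<Longrightarrow> prox D g x = (1/2) *\<^sub>R (a + b)
      \<Longrightarrow> g (prox D g x) = (g a + g b) / 2 \<Longrightarrow> a = b"
    and psi1: "\<psi> (prox D g x) = 1" and "0 < e"
  obtains m where "0 < m" "\<And>b c s. (b, c, s) \<in> H \<Longrightarrow> c + (norm (x - b))\<^sup>2 / 2 < moreau D g x + m \<Longrightarrow> 1 - e < s"
proof -
  let ?S = "H \<inter> {h. snd (snd h) \<le> 1 - e}"
  let ?f = "\<lambda>h::'b \<times> real \<times> real. fst (snd h) + (norm (x - fst h))\<^sup>2 / 2 - moreau D g x"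
  have cS: "compact ?S"
    by (intro compact_Int_closed compact_H closed_Collect_le continuous_intros)
  show thesis
  proof (cases "?S = {}")
    case True
    show ?thesis by (rule that[of 1]) (use True in force)+
  next
    case False
    have "continuous_on ?S ?f" by (intro continuous_intros) auto
    from continuous_attains_inf[OF cS False this] obtain h where h: "h \<in> ?S" "\<And>k. k \<in> ?S \<Longrightarrow> ?f h \<le> ?f k" by blast
    obtain b c s where hh: "h = (b, c, s)" by (cases h)
    have bd: "b \<in> D" "g b \<le> c" "s \<le> 1 - e" using H_bounds h hh by auto
    have nn: "0 \<le> ?f h" using moreau_le[OF bd(1), of x] bd(2) hh by simp
    have "?f h \<noteq> 0"
    proof
      assume 0: "?f h = 0"
      then have "g b + (norm (x - b))\<^sup>2 / 2 \<le> moreau D g x" using bd(2) hh by simp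
      then have pb: "prox D g x = b" by (rule prox_eq_minimiser[OF bd(1)])
      then have "c = g b" using 0 hh unfolding moreau_eq by simp
      then have "s = \<psi> b" using H_extreme[of b s] ext pb h hh by auto
      then show False using psi1 pb bd(3) \<open>0 < e\<close> by simp
    qed
    then have pos: "0 < ?f h" using nn by simp
    show ?thesis
    proof (rule that[OF pos])
      fix b c s assume "(b, c, s) \<in> H" "c + (norm (x - b))\<^sup>2 / 2 < moreau D g x + ?f h"
      then show "1 - e < s" using h(2)[of "(b, c, s)"] by (cases "s \<le> 1 - e") auto
    qed
  qed
qed

definition lift :: "real \<Rightarrow> 'b \<Rightarrow> real" where
  "lift \<tau> p = (INF h\<in>H. fst (snd h) + \<tau> * snd (snd h) + L * norm (p - fst h))"

lemma lift_attained:
  obtains b c s where "(b, c, s) \<in> H" "lift \<tau> p = c + \<tau> * s + L * norm (p - b)"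
    "\<And>b' c' s'. (b', c', s') \<in> H \<Longrightarrow> lift \<tau> p \<le> c' + \<tau> * s' + L * norm (p - b')"
proof -
  let ?f = "\<lambda>h::'b \<times> real \<times> real. fst (snd h) + \<tau> * snd (snd h) + L * norm (p - fst h)"
  have "continuous_on H ?f" by (intro continuous_intros)
  from continuous_attains_inf[OF compact_H H_nonempty this]
  obtain h where h: "h \<in> H" "\<And>k. k \<in> H \<Longrightarrow> ?f h \<le> ?f k" by blast
  have e: "lift \<tau> p = ?f h" unfolding lift_def by (rule cInf_eq_minimum) (use h in auto)
  show thesis using that[of "fst h" "fst (snd h)" "snd (snd h)"] h e by force
qed

lemma lift_le: "(b, c, s) \<in> H \<Longrightarrow> lift \<tau> p \<le> c + \<tau> * s + L * norm (p - b)"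
  by (rule lift_attained[of \<tau> p]) blast

lemma L_nonneg: "0 \<le> L"
  using lipschitz_g by (rule lipschitz_on_nonneg)

lemma lift_lipschitz: "L-lipschitz_on S (lift \<tau>)"
proof (rule lipschitz_onI)
  have *: "lift \<tau> p \<le> lift \<tau> q + L * dist p q" for p q
  proof -
    obtain b c s where h: "(b, c, s) \<in> H" "lift \<tau> q = c + \<tau> * s + L * norm (q - b)" by (rule lift_attained)
    have "norm (p - b) \<le> norm (q - b) + dist p q" unfolding dist_norm by norm
    then have "L * norm (p - b) \<le> L * norm (q - b) + L * dist p q"
      using L_nonneg by (simp flip: distrib_left add: mult_left_mono)
    then show ?thesis using lift_le[OF h(1), of \<tau> p] h(2) by linarith
  qed
  show "dist (lift \<tau> p) (lift \<tau> q) \<le> L * dist p q" for p q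
    using *[of p q] *[of q p] by (simp add: dist_real_def dist_commute abs_le_iff)
  show "0 \<le> L" by (rule L_nonneg)
qed

text \<open>Partial minimisation, over the convex set \<open>H\<close>, of a function jointly convex
  in \<open>p\<close> and the point of \<open>H\<close>.\<close>

lemma lift_convex: "convex_on D (lift \<tau>)"
proof (rule convex_onI)
  fix t :: real and p q assume t: "0 < t" "t < 1"
  obtain b c s where h: "(b, c, s) \<in> H" "lift \<tau> p = c + \<tau> * s + L * norm (p - b)" by (rule lift_attained)
  obtain b' c' s' where h': "(b', c', s') \<in> H" "lift \<tau> q = c' + \<tau> * s' + L * norm (q - b')" by (rule lift_attained)
  have conv: "convex H" by (simp add: H_def)
  have "(1 - t) *\<^sub>R (b, c, s) + t *\<^sub>R (b', c', s') \<in> H" using conv h(1) h'(1) t by (intro convexD) auto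
  then have "((1 - t) *\<^sub>R b + t *\<^sub>R b', (1 - t) * c + t * c', (1 - t) * s + t * s') \<in> H" by simp
  note le = lift_le[OF this, of \<tau> "(1 - t) *\<^sub>R p + t *\<^sub>R q"]
  have "(1 - t) *\<^sub>R p + t *\<^sub>R q - ((1 - t) *\<^sub>R b + t *\<^sub>R b') = (1 - t) *\<^sub>R (p - b) + t *\<^sub>R (q - b')"
    by (simp add: algebra_simps)
  then have "norm ((1 - t) *\<^sub>R p + t *\<^sub>R q - ((1 - t) *\<^sub>R b + t *\<^sub>R b')) \<le> (1 - t) * norm (p - b) + t * norm (q - b')"
    using t norm_triangle_ineq[of "(1 - t) *\<^sub>R (p - b)" "t *\<^sub>R (q - b')"] by simp
  then have "L * norm ((1 - t) *\<^sub>R p + t *\<^sub>R q - ((1 - t) *\<^sub>R b + t *\<^sub>R b')) \<le> L * ((1 - t) * norm (p - b) + t * norm (q - b'))"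
    using L_nonneg by (rule mult_left_mono)
  then show "lift \<tau> ((1 - t) *\<^sub>R p + t *\<^sub>R q) \<le> (1 - t) * lift \<tau> p + t * lift \<tau> q"
    using le unfolding h(2) h'(2) by (simp add: algebra_simps)
qed (rule convex_D)

text \<open>The penalty \<open>L * norm (p - b)\<close> compensates exactly for the decrease of the
  \<open>L\<close>-Lipschitz function \<open>g\<close> between \<open>p\<close> and
  \<open>b\<close>, which gives the lower bound. The graph point over \<open>p\<close> gives the
  upper one.\<close>

lemma lift_bounds:
  assumes "p \<in> D" "0 \<le> \<tau>"
  shows "g p \<le> lift \<tau> p" "lift \<tau> p \<le> g p + \<tau> * \<psi> p"
proof -
  show "lift \<tau> p \<le> g p + \<tau> * \<psi> p" using lift_le[OF graph_H[OF assms(1)], of \<tau> p] by simp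
  obtain b c s where h: "(b, c, s) \<in> H" "lift \<tau> p = c + \<tau> * s + L * norm (p - b)" by (rule lift_attained)
  note bd = H_bounds[OF h(1)]
  have "g p \<le> g b + L * norm (p - b)"
    using lipschitz_onD[OF lipschitz_g assms(1) bd(1)] by (simp add: dist_norm abs_le_iff)
  moreover have "0 \<le> \<tau> * s" using bd assms by simp
  ultimately show "g p \<le> lift \<tau> p" using h(2) bd by linarith
qed

lemma convex_potential_lift: "convex_potential D (lift \<tau>)"
  by unfold_locales (auto simp: compact_D convex_D D_nonempty lift_convex
      intro: lipschitz_on_continuous_on[OF lift_lipschitz])

text \<open>By \<open>bound_L\<close>, the quadratic term is \<open>L\<close>-Lipschitz in its point
  of \<open>D\<close> when \<open>norm x \<le> R\<close>. The penalty in \<open>lift\<close> thus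
  pays for moving from the proximal point to \<open>b\<close>, and a lower bound without penalty
  remains.\<close>

lemma moreau_lift_ge:
  assumes "norm x \<le> R"
  obtains b c s where "(b, c, s) \<in> H" "c + \<tau> * s + (norm (x - b))\<^sup>2 / 2 \<le> moreau D (lift \<tau>) x"
proof -
  interpret l: convex_potential D "lift \<tau>" by (rule convex_potential_lift)
  let ?p = "prox D (lift \<tau>) x"
  obtain b c s where h: "(b, c, s) \<in> H" "lift \<tau> ?p = c + \<tau> * s + L * norm (?p - b)" by (rule lift_attained)
  note bd = H_bounds[OF h(1)]
  have "R + norm b \<le> L" "R + norm ?p \<le> L" using bound_L[OF bd(1)] bound_L[OF l.prox(1)] by auto
  then have n: "norm (x - b) \<le> L" "norm (x - ?p) \<le> L"
    using assms norm_triangle_ineq4[of x b] norm_triangle_ineq4[of x ?p] by auto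
  have "(norm (x - b))\<^sup>2 - (norm (x - ?p))\<^sup>2 = (norm (x - b) - norm (x - ?p)) * (norm (x - b) + norm (x - ?p))"
    by (simp add: power2_eq_square algebra_simps)
  also have "\<dots> \<le> norm (?p - b) * (norm (x - b) + norm (x - ?p))"
  proof (rule mult_right_mono)
    show "norm (x - b) - norm (x - ?p) \<le> norm (?p - b)" by norm
  qed simp
  also have "\<dots> \<le> norm (?p - b) * (2 * L)" using n by (intro mult_left_mono) auto
  finally have "(norm (x - b))\<^sup>2 / 2 \<le> (norm (x - ?p))\<^sup>2 / 2 + L * norm (?p - b)" by (simp add: algebra_simps)
  then have "c + \<tau> * s + (norm (x - b))\<^sup>2 / 2 \<le> moreau D (lift \<tau>) x" unfolding l.moreau_eq h(2) by simp
  then show thesis using that h(1) by blast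
qed

lemma moreau_lift_quotient:
  assumes "0 < \<tau>"
  shows "0 \<le> (moreau D (lift \<tau>) x - moreau D g x) / \<tau>" "(moreau D (lift \<tau>) x - moreau D g x) / \<tau> \<le> 1"
proof -
  have "moreau D g x \<le> moreau D (lift \<tau>) x + 0"
    by (rule moreau_mono_dist[OF convex_potential_axioms convex_potential_lift])
       (use lift_bounds assms in auto)
  then show "0 \<le> (moreau D (lift \<tau>) x - moreau D g x) / \<tau>" using assms by simp
  have "moreau D (lift \<tau>) x \<le> moreau D g x + \<tau>"
  proof (rule moreau_mono_dist[OF convex_potential_lift convex_potential_axioms])
    fix p assume p: "p \<in> D"
    have "\<tau> * \<psi> p \<le> \<tau>" using mult_left_mono[of "\<psi> p" 1 \<tau>] psi[OF p] assms by simp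
    then show "lift \<tau> p \<le> g p + \<tau>" using lift_bounds(2)[OF p, of \<tau>] assms by linarith
  qed
  then show "(moreau D (lift \<tau>) x - moreau D g x) / \<tau> \<le> 1" using assms by simp
qed

text \<open>A point of \<open>H\<close> below the envelope of \<open>lift \<tau>\<close> minimises
  the unperturbed problem up to \<open>\<tau>\<close>. If \<open>\<tau>\<close> is below the gap
  from \<open>H_near_extreme\<close>, its last coordinate exceeds \<open>1 - e\<close>, and this
  coordinate is a lower bound for the quotient.\<close>

lemma moreau_lift_quotient_near_extreme:
  assumes ext: "\<And>a b. a \<in> D \<Longrightarrow> b \<in> D \<Longrightarrow> prox D g x = (1/2) *\<^sub>R (a + b)
      \<Longrightarrow> g (prox D g x) = (g a + g b) / 2 \<Longrightarrow> a = b"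
    and psi1: "\<psi> (prox D g x) = 1" and "0 < e" and "norm x \<le> R"
  obtains m where "0 < m" "\<And>\<tau>. 0 < \<tau> \<Longrightarrow> \<tau> < m \<Longrightarrow> 1 - e < (moreau D (lift \<tau>) x - moreau D g x) / \<tau>"
proof -
  obtain m where m: "0 < m" "\<And>b c s. (b, c, s) \<in> H \<Longrightarrow> c + (norm (x - b))\<^sup>2 / 2 < moreau D g x + m \<Longrightarrow> 1 - e < s"
    using H_near_extreme[OF ext psi1 \<open>0 < e\<close>] by blast
  have "1 - e < (moreau D (lift \<tau>) x - moreau D g x) / \<tau>" if \<tau>: "0 < \<tau>" "\<tau> < m" for \<tau>
  proof -
    obtain b c s where h: "(b, c, s) \<in> H" "c + \<tau> * s + (norm (x - b))\<^sup>2 / 2 \<le> moreau D (lift \<tau>) x"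
      using moreau_lift_ge[OF assms(4)] by blast
    note bd = H_bounds[OF h(1)]
    have "moreau D (lift \<tau>) x \<le> moreau D g x + \<tau>"
      using moreau_lift_quotient(2)[OF \<tau>(1), of x] \<tau> by simp
    moreover have "0 \<le> \<tau> * s" using bd \<tau> by simp
    ultimately have "c + (norm (x - b))\<^sup>2 / 2 < moreau D g x + m" using h(2) \<tau> by linarith
    then have s: "1 - e < s" by (rule m(2)[OF h(1)])
    have "moreau D g x \<le> c + (norm (x - b))\<^sup>2 / 2" using moreau_le[OF bd(1), of x] bd(2) by simp
    then have "\<tau> * s \<le> moreau D (lift \<tau>) x - moreau D g x" using h(2) by linarith
    then have "s \<le> (moreau D (lift \<tau>) x - moreau D g x) / \<tau>" using \<tau> by (simp add: pos_le_divide_eq mult.commute)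
    then show ?thesis using s by linarith
  qed
  then show thesis using that m(1) by blast
qed

end

section \<open>A firmly nonexpansive map translating along segments\<close>

text \<open>The factor \<open>a\<close> gives Lebesgue measure on \<open>D\<close> the mass of
  \<open>\<nu>\<close>, so that the functional \<open>J\<close> does not change when a constant is
  added. The common Lipschitz constant \<open>L\<close> provides compactness.\<close>

locale dual_problem =
  fixes D :: "'b::euclidean_space set" and L a :: real and \<nu> :: "'b measure" and K :: "'b set"
  assumes D: "compact D" "convex D" "D \<noteq> {}"
    and fin: "finite_measure \<nu>" and sets_nu [measurable_cong, simp]: "sets \<nu> = sets borel"
    and K: "compact K" and conc: "AE x in \<nu>. x \<in> K"
    and a: "0 \<le> a" "a * measure lborel D = measure \<nu> UNIV" and L_nonneg: "0 \<le> L"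
begin

definition admissible :: "('b \<Rightarrow> real) set" where
  "admissible = {g. convex_on D g \<and> L-lipschitz_on D g}"

definition J :: "('b \<Rightarrow> real) \<Rightarrow> real" where
  "J g = a * (\<integral>x. indicator D x *\<^sub>R g x \<partial>lborel) - (\<integral>x. moreau D g x \<partial>\<nu>)"

lemma space_nu [simp]: "space \<nu> = UNIV"
  using sets_eq_imp_space_eq[OF sets_nu] by simp

lemma admissible_potential: "g \<in> admissible \<Longrightarrow> convex_potential D g"
  unfolding admissible_def by unfold_locales (auto simp: D intro: lipschitz_on_continuous_on)

lemma integrable_D: "g \<in> admissible \<Longrightarrow> integrable lborel (\<lambda>x. indicator D x *\<^sub>R g x)"
  unfolding admissible_def by (intro borel_integrable_compact D) (auto intro: lipschitz_on_continuous_on)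

lemma integrable_continuous_nu:
  assumes "continuous_on UNIV (f :: 'b \<Rightarrow> real)"
  shows "integrable \<nu> f"
proof -
  have "bounded (f ` K)"
    using assms K by (intro compact_imp_bounded compact_continuous_image) (auto intro: continuous_on_subset)
  then obtain B where B: "\<And>x. x \<in> K \<Longrightarrow> norm (f x) \<le> B" by (auto simp: bounded_iff)
  show ?thesis
  proof (rule finite_measure.integrable_const_bound[OF fin])
    show "AE x in \<nu>. norm (f x) \<le> B" using conc B by auto
    show "f \<in> borel_measurable \<nu>" using borel_measurable_continuous_onI[OF assms] by (simp cong: measurable_cong_sets)
  qed
qed

lemma integrable_moreau: "g \<in> admissible \<Longrightarrow> integrable \<nu> (moreau D g)"
  by (intro integrable_continuous_nu convex_potential.continuous_moreau admissible_potential)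

lemma emeasure_D: "emeasure lborel D < \<infinity>"
  using D by (intro emeasure_lborel_cbox_finite emeasure_compact_finite) 

lemma integral_indicator_D: "(\<integral>x. indicator D x *\<^sub>R (c::real) \<partial>lborel) = c * measure lborel D"
  "integrable lborel (\<lambda>x. indicator D x *\<^sub>R (c::real))"
  using emeasure_D D(1) by (auto simp: borel_compact)

lemma J_dist:
  assumes g: "g \<in> admissible" and h: "h \<in> admissible" and e: "\<And>p. p \<in> D \<Longrightarrow> \<bar>g p - h p\<bar> \<le> e"
  shows "J g \<le> J h + 2 * e * measure \<nu> UNIV"
proof -
  have "(\<integral>x. indicator D x *\<^sub>R g x \<partial>lborel) \<le> (\<integral>x. indicator D x *\<^sub>R h x + indicator D x *\<^sub>R e \<partial>lborel)"
    using e by (intro integral_mono Bochner_Integration.integrable_add integrable_D g h integral_indicator_D)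
      (auto simp: indicator_def abs_le_iff algebra_simps)
  also have "\<dots> = (\<integral>x. indicator D x *\<^sub>R h x \<partial>lborel) + e * measure lborel D"
    using integral_indicator_D[of e] by (simp add: integrable_D[OF h, simplified])
  finally have "a * (\<integral>x. indicator D x *\<^sub>R g x \<partial>lborel) \<le> a * ((\<integral>x. indicator D x *\<^sub>R h x \<partial>lborel) + e * measure lborel D)"
    by (rule mult_left_mono[OF _ a(1)])
  then have "a * (\<integral>x. indicator D x *\<^sub>R g x \<partial>lborel) \<le> a * (\<integral>x. indicator D x *\<^sub>R h x \<partial>lborel) + e * measure \<nu> UNIV"
    unfolding a(2)[symmetric] by (simp only: distrib_left mult.left_commute)
  moreover have "(\<integral>x. moreau D h x \<partial>\<nu>) \<le> (\<integral>x. moreau D g x + e \<partial>\<nu>)"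
  proof (intro integral_mono Bochner_Integration.integrable_add integrable_moreau g h)
    show "integrable \<nu> (\<lambda>x. e)" by (rule finite_measure.integrable_const[OF fin])
    fix x show "moreau D h x \<le> moreau D g x + e"
      by (rule moreau_mono_dist[OF admissible_potential[OF h] admissible_potential[OF g]]) (use e in \<open>force simp: abs_le_iff\<close>)
  qed
  moreover have "(\<integral>x. moreau D g x + e \<partial>\<nu>) = (\<integral>x. moreau D g x \<partial>\<nu>) + e * measure \<nu> UNIV"
    using finite_measure.integrable_const[OF fin, of e] integrable_moreau[OF g] by (simp add: measure_def)
  ultimately show ?thesis unfolding J_def by linarith
qed

lemma admissible_add_const: "g \<in> admissible \<Longrightarrow> (\<lambda>p. g p + c) \<in> admissible"
  unfolding admissible_def lipschitz_on_def
  using convex_on_add[of D g "\<lambda>_. c"] convex_on_const[of D c] D(2) by (auto simp: dist_real_def)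

lemma J_add_const:
  assumes g: "g \<in> admissible"
  shows "J (\<lambda>p. g p + c) = J g"
proof -
  have "(\<integral>x. indicator D x *\<^sub>R (g x + c) \<partial>lborel) = (\<integral>x. indicator D x *\<^sub>R g x + indicator D x *\<^sub>R c \<partial>lborel)"
    by (simp add: distrib_left)
  also have "\<dots> = (\<integral>x. indicator D x *\<^sub>R g x \<partial>lborel) + c * measure lborel D"
    using integral_indicator_D[of c] by (simp add: integrable_D[OF g, simplified])
  finally have 1: "a * (\<integral>x. indicator D x *\<^sub>R (g x + c) \<partial>lborel) = a * (\<integral>x. indicator D x *\<^sub>R g x \<partial>lborel) + c * measure \<nu> UNIV"
    unfolding a(2)[symmetric] by (simp add: algebra_simps)
  have "(\<integral>x. moreau D (\<lambda>p. g p + c) x \<partial>\<nu>) = (\<integral>x. moreau D g x \<partial>\<nu>) + c * measure \<nu> UNIV"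
    unfolding moreau_add_const[OF admissible_potential[OF g]]
    using finite_measure.integrable_const[OF fin, of c] integrable_moreau[OF g] by (simp add: measure_def)
  then show ?thesis using 1 unfolding J_def by linarith
qed

text \<open>Direct method: normalised to vanish at one point, which \<open>J\<close> does not
  notice, a minimising sequence is bounded and uniformly Lipschitz. Arzela-Ascoli gives a uniform
  limit, and \<open>J_dist\<close> compares the values of \<open>J\<close>.\<close>

lemma minimiser_exists:
  obtains g where "g \<in> admissible" "\<And>h. h \<in> admissible \<Longrightarrow> J g \<le> J h"
proof -
  obtain c0 where c0: "c0 \<in> D" using D by blast
  define M where "M = L * diameter D"
  define N where "N = {g \<in> admissible. g c0 = 0}"
  have zero: "(\<lambda>_. 0) \<in> N" unfolding N_def admissible_def using D L_nonneg
    by (auto simp: lipschitz_on_def convex_on_def)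
  have bd: "\<bar>g p\<bar> \<le> M" if "g \<in> N" "p \<in> D" for g p
  proof -
    have "dist (g p) (g c0) \<le> L * dist p c0"
      using that c0 lipschitz_onD[of L D g p c0] unfolding N_def admissible_def by blast
    also have "\<dots> \<le> M" unfolding M_def
      using L_nonneg diameter_bounded_bound[OF compact_imp_bounded[OF D(1)] that(2) c0] by (intro mult_left_mono) auto
    finally show ?thesis using that by (simp add: N_def dist_real_def)
  qed
  have "J (\<lambda>_. 0) - 2 * M * measure \<nu> UNIV \<le> J g" if "g \<in> N" for g
    using J_dist[of "\<lambda>_. 0" g M] zero that bd[OF that] by (auto simp: N_def)
  then have bddJ: "bdd_below (J ` N)" by (auto intro!: bdd_belowI2)
  define I where "I = Inf (J ` N)"
  have "\<exists>g\<in>N. J g < I + 1 / real (Suc n)" for n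
  proof -
    have "I < I + 1 / real (Suc n)" by simp
    then show ?thesis unfolding I_def using zero bddJ by (subst (asm) cInf_less_iff) auto
  qed
  then obtain G where G: "\<And>n. G n \<in> N" "\<And>n. J (G n) < I + 1 / real (Suc n)" by metis
  have lip: "L-lipschitz_on D (G n)" and conv: "convex_on D (G n)" for n
    using G(1)[of n] by (auto simp: N_def admissible_def)
  have eq: "\<exists>d. 0 < d \<and> (\<forall>n y. y \<in> D \<and> norm (x - y) < d \<longrightarrow> norm (G n x - G n y) < e)"
    if "x \<in> D" "0 < e" for x e
  proof (intro exI conjI allI impI)
    show "0 < e / (L + 1)" using that L_nonneg by simp
    fix n y assume y: "y \<in> D \<and> norm (x - y) < e / (L + 1)"
    have "norm (G n x - G n y) \<le> L * norm (x - y)"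
      using lipschitz_onD[OF lip[of n] that(1), of y] y by (simp add: dist_norm)
    also have "\<dots> \<le> (L + 1) * norm (x - y)" by (simp add: algebra_simps)
    also have "\<dots> < e" using y L_nonneg by (simp add: pos_less_divide_eq mult.commute)
    finally show "norm (G n x - G n y) < e" .
  qed
  obtain g k where gk: "continuous_on D g" "strict_mono (k :: nat \<Rightarrow> nat)"
      "\<And>e. 0 < e \<Longrightarrow> \<exists>N. \<forall>n x. n \<ge> N \<and> x \<in> D \<longrightarrow> norm (G (k n) x - g x) < e"
    by (rule Arzela_Ascoli[OF D(1), of G M]) (use bd G(1) eq in auto)
  have lim: "(\<lambda>n. G (k n) x) \<longlonglongrightarrow> g x" if "x \<in> D" for x
    unfolding LIMSEQ_iff using gk(3) that by metis
  have gadm: "g \<in> admissible"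
    unfolding admissible_def
  proof (intro CollectI conjI)
    show "convex_on D g"
    proof (rule convex_onI)
      fix t :: real and x y assume t: "0 < t" "t < 1" "x \<in> D" "y \<in> D"
      then have z: "(1 - t) *\<^sub>R x + t *\<^sub>R y \<in> D" using D(2) by (intro convexD) auto
      show "g ((1 - t) *\<^sub>R x + t *\<^sub>R y) \<le> (1 - t) * g x + t * g y"
        by (rule LIMSEQ_le[OF lim[OF z] tendsto_add[OF tendsto_mult_left[OF lim] tendsto_mult_left[OF lim]]])
           (use t in \<open>auto intro!: exI[of _ 0] convex_onD[OF conv]\<close>)
    qed (rule D)
    show "L-lipschitz_on D g"
    proof (rule lipschitz_onI)
      fix x y assume "x \<in> D" "y \<in> D"
      then show "dist (g x) (g y) \<le> L * dist x y"
        by (intro LIMSEQ_le_const2[OF tendsto_dist[OF lim lim]]) (auto intro!: exI[of _ 0] lipschitz_onD[OF lip])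
    qed (rule L_nonneg)
  qed
  have gI: "J g \<le> I"
  proof (rule field_le_epsilon)
    fix e :: real assume e: "0 < e"
    define m where "m = measure \<nu> UNIV"
    have m: "0 \<le> m" by (simp add: m_def)
    obtain N1 where N1: "\<And>n x. n \<ge> N1 \<Longrightarrow> x \<in> D \<Longrightarrow> norm (G (k n) x - g x) < e / (4 * (m + 1))"
      using gk(3)[of "e / (4 * (m + 1))"] e m by auto
    obtain N2 :: nat where N2: "2 / e < real N2" using reals_Archimedean2 by blast
    define n where "n = max N1 N2"
    have "J g \<le> J (G (k n)) + 2 * (e / (4 * (m + 1))) * m"
      unfolding m_def using N1[of n] G(1) by (intro J_dist gadm)
        (auto simp: n_def m_def[symmetric] N_def abs_minus_commute intro: less_imp_le)
    moreover have "2 * (e / (4 * (m + 1))) * m \<le> e / 2" using e m by (simp add: field_simps)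
    moreover have "1 / real (Suc (k n)) \<le> e / 2"
    proof -
      have "N2 \<le> k n" using seq_suble[OF gk(2), of n] by (simp add: n_def)
      then have "2 / e < real (Suc (k n))" using N2 by linarith
      then show ?thesis using e by (simp add: field_simps)
    qed
    ultimately show "J g \<le> I + e" using G(2)[of "k n"] by linarith
  qed
  show thesis
  proof (rule that[OF gadm])
    fix h assume h: "h \<in> admissible"
    have "(\<lambda>p. h p + (- h c0)) \<in> N" using admissible_add_const[OF h, of "- h c0"] by (simp add: N_def)
    then have "I \<le> J (\<lambda>p. h p + (- h c0))" unfolding I_def using bddJ by (intro cInf_lower) auto
    with gI have "J g \<le> J (\<lambda>p. h p + (- h c0))" by (rule order_trans)
    then show "J g \<le> J h" unfolding J_add_const[OF h] .
  qed
qed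

text \<open>Where \<open>prox D g x\<close> is an extreme point of the graph of \<open>g\<close>, raising \<open>g\<close> by \<open>\<tau> \<psi>\<close> survives the convexification
  to first order and raises the envelope at \<open>x\<close> by \<open>\<tau>\<close>. By minimality, the mass of such \<open>x\<close> is at most the
  Lebesgue integral of \<open>\<psi>\<close>, and \<open>\<psi>\<close> may be concentrated near the null set \<open>prox D g ` K\<close>.\<close>

lemma affine_segment_AE:
  assumes null: "negligible K" and R: "\<And>x. x \<in> K \<Longrightarrow> norm x \<le> R" and bound_L: "\<And>p. p \<in> D \<Longrightarrow> R + norm p \<le> L"
    and g: "g \<in> admissible" and min: "\<And>h. h \<in> admissible \<Longrightarrow> J g \<le> J h"
  shows "AE x in \<nu>. \<exists>p\<in>D. \<exists>q\<in>D. p \<noteq> q \<and> prox D g x = (1/2) *\<^sub>R (p + q) \<and> g (prox D g x) = (g p + g q) / 2"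
proof (cases "K = {}")
  case True
  then show ?thesis using conc by auto
next
  case False
  interpret convex_potential D g by (rule admissible_potential[OF g])
  let ?T = "prox D g"
  let ?C = "?T ` K"
  \<comment> \<open>The bad points, whose images are extreme on the graph of \<open>g\<close>. No
    measurability of \<open>E\<close> is claimed; it will be covered by measurable sets of small
    mass.\<close>
  define E where "E = {x\<in>K. \<not> (\<exists>p\<in>D. \<exists>q\<in>D. p \<noteq> q \<and> ?T x = (1/2) *\<^sub>R (p + q) \<and> g (?T x) = (g p + g q) / 2)}"
  have cC: "compact ?C" by (intro compact_continuous_image continuous_prox K)
  \<comment> \<open>Singularity of \<open>\<nu>\<close> enters here: the nonexpansive map sends the
    null set \<open>K\<close> to a null set.\<close>
  have nC: "negligible ?C"
  proof (rule negligible_locally_Lipschitz_image[OF _ null])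
    fix x assume "x \<in> K"
    show "\<exists>T B. open T \<and> x \<in> T \<and> (\<forall>y\<in>K \<inter> T. norm (?T y - ?T x) \<le> B * norm (y - x))"
      by (rule exI[of _ UNIV], rule exI[of _ 1]) (use prox_nonexpansive in auto)
  qed simp
  \<comment> \<open>Tent functions that equal 1 on the compact set \<open>?C\<close> and decrease to
    0 off it, so that their Lebesgue integrals over \<open>D\<close> tend to 0.\<close>
  define \<psi> where "\<psi> k p = max 0 (1 - real k * infdist p ?C)" for k p
  have cpsi: "continuous_on S (\<psi> k)" for S k unfolding \<psi>_def by (intro continuous_intros)
  have bpsi: "0 \<le> \<psi> k p" "\<psi> k p \<le> 1" for k p by (auto simp: \<psi>_def infdist_nonneg)
  have lim0: "(\<lambda>k. \<integral>x. indicator D x *\<^sub>R \<psi> k x \<partial>lborel) \<longlonglongrightarrow> (\<integral>x. 0 \<partial>(lborel :: 'b measure))"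
  proof (rule integral_dominated_convergence[where w = "\<lambda>x. indicator D x *\<^sub>R 1"])
    show "(\<lambda>x. indicator D x *\<^sub>R \<psi> k x) \<in> borel_measurable lborel" for k
      using borel_integrable_compact[OF D(1) cpsi] by (rule borel_measurable_integrable)
    show "integrable lborel (\<lambda>x::'b. indicator D x *\<^sub>R (1::real))" by (rule integral_indicator_D)
    show "AE x in lborel. norm (indicator D x *\<^sub>R \<psi> k x) \<le> indicator D x *\<^sub>R 1" for k
      using bpsi by (auto simp: indicator_def)
    have "?C \<in> null_sets lborel"
      using nC cC by (simp add: negligible_iff_null_sets null_sets_completion_iff borel_compact)
    then have "AE x in lborel. x \<notin> ?C" by (rule AE_not_in)
    then show "AE x in lborel. (\<lambda>k. indicator D x *\<^sub>R \<psi> k x) \<longlonglongrightarrow> 0"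
    proof (eventually_elim)
      fix x assume "x \<notin> ?C"
      then have pos: "0 < infdist x ?C" using cC False
        by (simp add: infdist_pos_not_in_closed compact_imp_closed)
      obtain k0 :: nat where k0: "1 / infdist x ?C < real k0" using reals_Archimedean2 by blast
      have "\<psi> k x = 0" if "k \<ge> k0" for k
      proof -
        have "1 / infdist x ?C < real k" using k0 that by linarith
        then show ?thesis using pos by (simp add: \<psi>_def field_simps)
      qed
      then have "eventually (\<lambda>k. indicator D x *\<^sub>R \<psi> k x = 0) sequentially"
        unfolding eventually_sequentially by auto
      then show "(\<lambda>k. indicator D x *\<^sub>R \<psi> k x) \<longlonglongrightarrow> 0" by (rule tendsto_eventually)
    qed
  qed simp
  have "\<exists>S\<in>sets \<nu>. E \<subseteq> S \<and> emeasure \<nu> S \<le> ennreal (a * (\<integral>x. indicator D x *\<^sub>R \<psi> k x \<partial>lborel))" for k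
  proof -
    interpret P: perturbation D g L R "\<psi> k"
      by unfold_locales (use g bpsi cpsi bound_L in \<open>auto simp: admissible_def\<close>)
    have ladm: "P.lift \<tau> \<in> admissible" for \<tau>
      unfolding admissible_def using P.lift_convex P.lift_lipschitz by auto
    define r where "r j x = (moreau D (P.lift (1 / real (Suc j))) x - moreau D g x) / (1 / real (Suc j))" for j x
    have r01: "0 \<le> r j x" "r j x \<le> 1" for j x
      unfolding r_def using P.moreau_lift_quotient[of "1 / real (Suc j)" x] by auto
    have rint: "integrable \<nu> (r j)" for j
      unfolding r_def by (intro integrable_divide Bochner_Integration.integrable_diff integrable_moreau ladm g)
    then have [measurable]: "r j \<in> borel_measurable borel" for j
      using borel_measurable_integrable[of \<nu> "r j"] by (simp cong: measurable_cong_sets)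
    have rle: "(\<integral>x. r j x \<partial>\<nu>) \<le> a * (\<integral>x. indicator D x *\<^sub>R \<psi> k x \<partial>lborel)" for j
    proof -
      let ?t = "1 / real (Suc j)"
      let ?h = "P.lift ?t"
      have "(\<integral>x. indicator D x *\<^sub>R ?h x \<partial>lborel) \<le> (\<integral>x. indicator D x *\<^sub>R g x + ?t * (indicator D x *\<^sub>R \<psi> k x) \<partial>lborel)"
        by (intro integral_mono Bochner_Integration.integrable_add integrable_D integrable_mult_right ladm g
            borel_integrable_compact D cpsi) (use P.lift_bounds(2)[of _ ?t] in \<open>auto simp: indicator_def\<close>)
      also have "\<dots> = (\<integral>x. indicator D x *\<^sub>R g x \<partial>lborel) + ?t * (\<integral>x. indicator D x *\<^sub>R \<psi> k x \<partial>lborel)"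
        by (subst Bochner_Integration.integral_add) (intro integrable_D integrable_mult_right g
            borel_integrable_compact D cpsi | simp only: integral_mult_right_zero)+
      finally have "a * (\<integral>x. indicator D x *\<^sub>R ?h x \<partial>lborel)
          \<le> a * ((\<integral>x. indicator D x *\<^sub>R g x \<partial>lborel) + ?t * (\<integral>x. indicator D x *\<^sub>R \<psi> k x \<partial>lborel))"
        by (rule mult_left_mono[OF _ a(1)])
      then have 1: "a * (\<integral>x. indicator D x *\<^sub>R ?h x \<partial>lborel)
          \<le> a * (\<integral>x. indicator D x *\<^sub>R g x \<partial>lborel) + ?t * (a * (\<integral>x. indicator D x *\<^sub>R \<psi> k x \<partial>lborel))"
        by (simp only: distrib_left mult.left_commute)
      \<comment> \<open>Passing from \<open>g\<close> to \<open>?h\<close> raises the Lebesgue term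
        by at most \<open>?t * a\<close> times the integral of \<open>\<psi> k\<close>; by
        minimality the envelope term cannot rise by more.\<close>
      have "J g \<le> J ?h" by (rule min[OF ladm])
      then have "(\<integral>x. moreau D ?h x \<partial>\<nu>) - (\<integral>x. moreau D g x \<partial>\<nu>)
          \<le> ?t * (a * (\<integral>x. indicator D x *\<^sub>R \<psi> k x \<partial>lborel))" using 1 unfolding J_def by linarith
      then have "((\<integral>x. moreau D ?h x \<partial>\<nu>) - (\<integral>x. moreau D g x \<partial>\<nu>)) / ?t
          \<le> a * (\<integral>x. indicator D x *\<^sub>R \<psi> k x \<partial>lborel)"
        by (subst pos_divide_le_eq) (auto simp only: mult.commute of_nat_0_less_iff zero_less_divide_1_iff)
      moreover have "(\<integral>x. r j x \<partial>\<nu>) = ((\<integral>x. moreau D ?h x \<partial>\<nu>) - (\<integral>x. moreau D g x \<partial>\<nu>)) / ?t"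
        unfolding r_def by (simp only: integral_divide_zero Bochner_Integration.integral_diff[OF integrable_moreau[OF ladm] integrable_moreau[OF g]])
      ultimately show ?thesis by simp
    qed
    \<comment> \<open>A measurable set containing \<open>E\<close>. The quotients are nonnegative,
      so Fatou's lemma turns the bound on their integrals into a bound on its measure.\<close>
    define S where "S = {x \<in> space \<nu>. 1 \<le> liminf (\<lambda>j. ennreal (r j x))}"
    have S: "S \<in> sets \<nu>" unfolding S_def by measurable
    have "emeasure \<nu> S = (\<integral>\<^sup>+x. indicator S x \<partial>\<nu>)" using S by simp
    also have "\<dots> \<le> (\<integral>\<^sup>+x. liminf (\<lambda>j. ennreal (r j x)) \<partial>\<nu>)"
      by (intro nn_integral_mono) (auto simp: S_def indicator_def)
    also have "\<dots> \<le> liminf (\<lambda>j. \<integral>\<^sup>+x. ennreal (r j x) \<partial>\<nu>)" by (rule nn_integral_liminf) measurable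
    also have "\<dots> \<le> ennreal (a * (\<integral>x. indicator D x *\<^sub>R \<psi> k x \<partial>lborel))"
    proof -
      have "(\<integral>\<^sup>+x. ennreal (r j x) \<partial>\<nu>) \<le> ennreal (a * (\<integral>x. indicator D x *\<^sub>R \<psi> k x \<partial>lborel))" for j
        using rle[of j] r01 by (subst nn_integral_eq_integral[OF rint]) (auto intro: ennreal_leI)
      then show ?thesis by (intro Liminf_le) auto
    qed
    finally have em: "emeasure \<nu> S \<le> ennreal (a * (\<integral>x. indicator D x *\<^sub>R \<psi> k x \<partial>lborel))" .
    have "E \<subseteq> S"
    proof
      fix x assume x: "x \<in> E"
      then have xK: "x \<in> K" by (simp add: E_def)
      have psi1: "\<psi> k (?T x) = 1" using xK by (simp add: \<psi>_def)
      have "1 \<le> liminf (\<lambda>j. ennreal (r j x))"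
      proof (rule ennreal_le_epsilon)
        fix e :: real assume e: "0 < e"
        obtain m where m: "0 < m" "\<And>\<tau>. 0 < \<tau> \<Longrightarrow> \<tau> < m \<Longrightarrow> 1 - e < (moreau D (P.lift \<tau>) x - moreau D g x) / \<tau>"
          using P.moreau_lift_quotient_near_extreme[of x e] x psi1 e R[OF xK] unfolding E_def by blast
        obtain N :: nat where N: "1 / m < real N" using reals_Archimedean2 by blast
        have "ennreal (1 - e) \<le> ennreal (r j x)" if "j \<ge> N" for j
        proof -
          have "1 / m < real (Suc j)" using N that by linarith
          then have "1 / real (Suc j) < m" using m(1) by (simp add: field_simps)
          then have "1 - e < r j x" unfolding r_def by (intro m(2)) auto
          then show ?thesis by (intro ennreal_leI) simp
        qed
        then have "ennreal (1 - e) \<le> liminf (\<lambda>j. ennreal (r j x))"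
          by (intro Liminf_bounded) (auto simp: eventually_sequentially)
        then have "ennreal (1 - e) + ennreal e \<le> liminf (\<lambda>j. ennreal (r j x)) + ennreal e" by (rule add_right_mono)
        \<comment> \<open>For \<open>e > 1\<close> the first summand is truncated to 0, hence the
          case distinction.\<close>
        moreover have "1 \<le> ennreal (1 - e) + ennreal e"
        proof (cases "e \<le> 1")
          case True
          then show ?thesis using e by (simp flip: ennreal_plus)
        next
          case False
          then have "1 \<le> ennreal e" using ennreal_leI[of 1 e] by simp
          then show ?thesis by (simp add: add_increasing)
        qed
        ultimately show "1 \<le> liminf (\<lambda>j. ennreal (r j x)) + ennreal e" by (rule order_trans[rotated])
      qed
      then show "x \<in> S" by (simp add: S_def)
    qed
    then show ?thesis using S em by blast
  qed
  then obtain S where S: "\<And>k. S k \<in> sets \<nu>" "\<And>k. E \<subseteq> S k"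
      "\<And>k. emeasure \<nu> (S k) \<le> ennreal (a * (\<integral>x. indicator D x *\<^sub>R \<psi> k x \<partial>lborel))" by metis
  have "(\<Inter>k. S k) \<in> null_sets \<nu>"
  proof (rule null_setsI)
    show m: "(\<Inter>k. S k) \<in> sets \<nu>" using S(1) by auto
    have "emeasure \<nu> (\<Inter>k. S k) \<le> ennreal (a * (\<integral>x. indicator D x *\<^sub>R \<psi> k x \<partial>lborel))" for k
      using emeasure_mono[OF _ S(1), of "\<Inter>k. S k" k] S(3)[of k] by (auto intro: order_trans)
    moreover have "(\<lambda>k. ennreal (a * (\<integral>x. indicator D x *\<^sub>R \<psi> k x \<partial>lborel))) \<longlonglongrightarrow> ennreal (a * (\<integral>x. 0 \<partial>(lborel :: 'b measure)))"
      by (intro tendsto_ennrealI tendsto_mult_left lim0)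
    ultimately have "emeasure \<nu> (\<Inter>k. S k) \<le> ennreal (a * (\<integral>x. 0 \<partial>(lborel :: 'b measure)))"
      by (intro LIMSEQ_le_const) auto
    then show "emeasure \<nu> (\<Inter>k. S k) = 0" by simp
  qed
  then have "AE x in \<nu>. x \<notin> (\<Inter>k. S k)" by (rule AE_not_in)
  with conc show ?thesis
  proof eventually_elim
    fix x assume "x \<in> K" "x \<notin> (\<Inter>k. S k)"
    then have "x \<notin> E" using S(2) by blast
    then show "\<exists>p\<in>D. \<exists>q\<in>D. p \<noteq> q \<and> prox D g x = (1/2) *\<^sub>R (p + q) \<and> g (prox D g x) = (g p + g q) / 2"
      using \<open>x \<in> K\<close> unfolding E_def by blast
  qed
qed

end

text \<open>With \<open>D\<close> the ball of radius \<open>d\<close>, the bound on \<open>T\<close>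
  is automatic, and the Lipschitz constant \<open>R + d\<close> is what \<open>bound_L\<close> asks
  for. The vector \<open>e\<close> runs from the midpoint \<open>T x\<close> of an affine segment of
  the potential to one of its ends.\<close>

theorem firmly_nonexpansive_translating_AE:
  fixes \<nu> :: "'b::euclidean_space measure"
  assumes "finite_measure \<nu>" and "sets \<nu> = sets borel" and "compact K" and "negligible K"
    and "AE x in \<nu>. x \<in> K" and "0 < d"
  obtains T :: "'b \<Rightarrow> 'b" where "\<And>x. norm (T x) \<le> d"
    "\<And>x y. (norm (T x - T y))\<^sup>2 \<le> (x - y) \<bullet> (T x - T y)"
    "AE x in \<nu>. \<exists>e. e \<noteq> 0 \<and> T (x + e) = T x + e \<and> T (x - e) = T x - e"
proof -
  obtain B where B: "\<And>x. x \<in> K \<Longrightarrow> norm x \<le> B"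
    using compact_imp_bounded[OF assms(3)] unfolding bounded_iff by blast
  define R where "R = max 0 B"
  have R: "0 \<le> R" "\<And>x. x \<in> K \<Longrightarrow> norm x \<le> R" using B by (auto simp: R_def intro: max.coboundedI2)
  define D where "D = cball (0::'b) d"
  have pos: "0 < measure lborel D" using assms(6) content_cball_pos[of d 0] by (simp add: D_def)
  define a where "a = measure \<nu> UNIV / measure lborel D"
  interpret dual_problem D "R + d" a \<nu> K
  proof (rule dual_problem.intro)
    show "D \<noteq> {}" "0 \<le> R + d" using assms(6) R(1) by (auto simp: D_def)
    show "0 \<le> a" "a * measure lborel D = measure \<nu> UNIV" using pos by (auto simp: a_def)
  qed (use assms(1-5) in \<open>simp_all add: D_def\<close>)
  obtain g where g: "g \<in> admissible" "\<And>h. h \<in> admissible \<Longrightarrow> J g \<le> J h"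
    using minimiser_exists by blast
  interpret convex_potential D g by (rule admissible_potential[OF g(1)])
  have AE: "AE x in \<nu>. \<exists>p\<in>D. \<exists>q\<in>D. p \<noteq> q \<and> prox D g x = (1/2) *\<^sub>R (p + q) \<and> g (prox D g x) = (g p + g q) / 2"
    by (rule affine_segment_AE[OF assms(4) R(2) _ g]) (auto simp: D_def)
  show thesis
  proof (rule that[of "prox D g"])
    show "norm (prox D g x) \<le> d" for x using prox(1)[of x] by (simp add: D_def)
    show "(norm (prox D g x - prox D g y))\<^sup>2 \<le> (x - y) \<bullet> (prox D g x - prox D g y)" for x y
      by (rule prox_firmly_nonexpansive)
    show "AE x in \<nu>. \<exists>e. e \<noteq> 0 \<and> prox D g (x + e) = prox D g x + e \<and> prox D g (x - e) = prox D g x - e"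
      using AE
    proof eventually_elim
      fix x assume "\<exists>p\<in>D. \<exists>q\<in>D. p \<noteq> q \<and> prox D g x = (1/2) *\<^sub>R (p + q) \<and> g (prox D g x) = (g p + g q) / 2"
      then obtain p q where pq: "p \<in> D" "q \<in> D" "p \<noteq> q" "prox D g x = (1/2) *\<^sub>R (p + q)"
        "g (prox D g x) = (g p + g q) / 2" by blast
      let ?y = "prox D g x"
      have "?y + ?y = p + q" unfolding pq(4) using scaleR_add_left[of "1/2" "1/2" "p + q"] by simp
      moreover have "(q - ?y) + (p - ?y) = (p + q) - (?y + ?y)" by (simp add: algebra_simps)
      ultimately have "(q - ?y) + (p - ?y) = 0" by (simp only: diff_self)
      then have qy: "q - ?y = - (p - ?y)" by (simp only: eq_neg_iff_add_eq_0)
      have "prox D g (x + (p - ?y)) = p" by (rule prox_on_affine_segment[OF pq(1,2,4,5)])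
      moreover have "prox D g (x + (q - ?y)) = q"
        by (rule prox_on_affine_segment[OF pq(2,1)]) (use pq in \<open>auto simp: add.commute\<close>)
      moreover have "p - ?y \<noteq> 0" using qy pq(3) by auto
      ultimately show "\<exists>e. e \<noteq> 0 \<and> prox D g (x + e) = ?y + e \<and> prox D g (x - e) = ?y - e"
        using qy by (intro exI[of _ "p - ?y"]) (auto simp: algebra_simps)
    qed
  qed
qed

section \<open>Mollification\<close>

lemma has_derivative_max0_power2:
  "((\<lambda>t::real. (max 0 t)\<^sup>2) has_real_derivative 2 * max 0 t) (at t)"
proof -
  consider "t > 0" | "t < 0" | "t = 0" by linarith
  then show ?thesis
  proof cases
    case 1
    have "((\<lambda>t::real. t\<^sup>2) has_real_derivative 2 * t) (at t)" by (auto intro!: derivative_eq_intros)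
    then show ?thesis
      by (rule has_field_derivative_transform_within_open[of _ _ _ "{0<..}", THEN DERIV_cong]) (use 1 in auto)
  next
    case 2
    have "((\<lambda>t::real. 0) has_real_derivative 0) (at t)" by simp
    then show ?thesis
      by (rule has_field_derivative_transform_within_open[of _ _ _ "{..<0}", THEN DERIV_cong]) (use 2 in auto)
  next
    case 3
    have "(\<lambda>h::real. (max 0 h)\<^sup>2 / h) \<midarrow>0\<rightarrow> 0"
    proof (rule Lim_null_comparison)
      show "(\<lambda>h::real. \<bar>h\<bar>) \<midarrow>0\<rightarrow> 0" by (rule tendsto_rabs_zero) simp
      show "\<forall>\<^sub>F h::real in at 0. norm ((max 0 h)\<^sup>2 / h) \<le> \<bar>h\<bar>"
        by (rule always_eventually) (auto simp: max_def power2_eq_square)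
    qed
    then show ?thesis using 3 by (simp add: DERIV_def)
  qed
qed

text \<open>An unnormalised kernel supported in the ball of radius \<open>e\<close>. The squared
  positive part is once continuously differentiable, which is enough here, and its mass and gradient
  have elementary bounds.\<close>

definition bump :: "real \<Rightarrow> 'b::euclidean_space \<Rightarrow> real" where
  "bump e z = (max 0 (e\<^sup>2 - z \<bullet> z))\<^sup>2"

text \<open>A scalar factor: the gradient of \<open>bump e\<close> at \<open>z\<close> is
  \<open>- bump_grad e z *\<^sub>R z\<close>.\<close>

definition bump_grad :: "real \<Rightarrow> 'b::euclidean_space \<Rightarrow> real" where
  "bump_grad e z = 4 * max 0 (e\<^sup>2 - z \<bullet> z)"

definition bump_mass :: "real \<Rightarrow> 'b::euclidean_space itself \<Rightarrow> real" where
  "bump_mass e _ = (\<integral>z. bump e (z::'b) \<partial>lborel)"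

definition mollify :: "real \<Rightarrow> ('b::euclidean_space \<Rightarrow> real) \<Rightarrow> 'b \<Rightarrow> real" where
  "mollify e f x = (\<integral>z. bump e z * f (x + z) \<partial>lborel) / bump_mass e TYPE('b)"

text \<open>The derivative is put on the kernel, so \<open>f\<close> need only be continuous. The
  sign is positive because, after the substitution \<open>y = x + z\<close>, the variable
  \<open>x\<close> occurs as \<open>bump e (y - x)\<close>.\<close>

definition mollify_grad :: "real \<Rightarrow> ('b::euclidean_space \<Rightarrow> real) \<Rightarrow> 'b \<Rightarrow> 'b" where
  "mollify_grad e f x = (\<integral>z. (bump_grad e z * f (x + z)) *\<^sub>R z \<partial>lborel) /\<^sub>R bump_mass e TYPE('b)"

lemma bump_nonneg: "0 \<le> bump e z" by (simp add: bump_def)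

lemma bump_zero: "e \<ge> 0 \<Longrightarrow> norm z > e \<Longrightarrow> bump e z = 0" "e \<ge> 0 \<Longrightarrow> norm z > e \<Longrightarrow> bump_grad e z = 0"
  unfolding bump_def bump_grad_def
  by (auto simp: max_def power2_norm_eq_inner[symmetric] dest: power_strict_mono[of e "norm z" 2])

lemma continuous_bump [continuous_intros]:
  "continuous_on S f \<Longrightarrow> continuous_on S (\<lambda>x. bump e (f x))"
  "continuous_on S f \<Longrightarrow> continuous_on S (\<lambda>x. bump_grad e (f x))"
  unfolding bump_def bump_grad_def by (auto intro!: continuous_intros)

lemma integrable_compact_support:
  fixes F :: "'b::euclidean_space \<Rightarrow> 'c::{banach, second_countable_topology}"
  assumes "continuous_on UNIV F" and "\<And>z. norm z > e \<Longrightarrow> F z = 0"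
  shows "integrable lborel F"
proof -
  have "integrable lborel (\<lambda>z. indicator (cball 0 e) z *\<^sub>R F z)"
    by (intro borel_integrable_compact continuous_on_subset[OF assms(1)]) auto
  also have "(\<lambda>z. indicator (cball 0 e) z *\<^sub>R F z) = F"
    using assms(2) by (auto simp: indicator_def fun_eq_iff not_le)
  finally show ?thesis .
qed

lemma continuous_shift:
  "continuous_on UNIV (f :: 'b::real_normed_vector \<Rightarrow> 'c::topological_space) \<Longrightarrow> continuous_on S (\<lambda>z. f (x + z))"
  by (rule continuous_on_compose2[of UNIV f]) (auto intro!: continuous_intros)

lemma integrable_bump:
  assumes "continuous_on UNIV (f :: 'b::euclidean_space \<Rightarrow> real)" and "0 \<le> e"
  shows "integrable lborel (\<lambda>z. bump e z * f (x + z))"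
    "integrable lborel (\<lambda>z. (bump_grad e z * f (x + z)) *\<^sub>R z)"
  by (rule integrable_compact_support[where e = e];
      use assms bump_zero in \<open>auto intro!: continuous_intros continuous_shift\<close>)+

text \<open>On the ball of half the radius \<open>e\<^sup>2 - z \<bullet> z\<close> is at least
  \<open>3 / 4 * e\<^sup>2\<close>, and squaring gives the constant. The bound scales like the
  kernel, which later makes the gradient estimate uniform in \<open>e\<close>.\<close>

lemma bump_mass_ge:
  assumes "0 < e"
  shows "9 / 16 * e ^ 4 * measure lborel (ball (0::'b::euclidean_space) (e / 2)) \<le> bump_mass e TYPE('b)"
proof -
  have "(\<integral>z. 9 / 16 * e ^ 4 * indicator (ball (0::'b) (e / 2)) z \<partial>lborel) \<le> (\<integral>z. bump e (z::'b) \<partial>lborel)"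
  proof (rule integral_mono)
    show "integrable lborel (\<lambda>z::'b. 9 / 16 * e ^ 4 * indicator (ball 0 (e / 2)) z)"
      by (intro integrable_mult_right integrable_real_indicator emeasure_bounded_finite bounded_ball) auto
    show "integrable lborel (bump e :: 'b \<Rightarrow> real)"
      using integrable_bump(1)[of "\<lambda>_. 1" e 0] assms by simp
    fix z :: 'b
    show "9 / 16 * e ^ 4 * indicator (ball 0 (e / 2)) z \<le> bump e z"
    proof (cases "norm z < e / 2")
      case True
      then have "(norm z)\<^sup>2 \<le> (e / 2)\<^sup>2" by (intro power_mono) auto
      then have "3 / 4 * e\<^sup>2 \<le> e\<^sup>2 - z \<bullet> z" by (simp add: power2_norm_eq_inner power_divide)
      also have "\<dots> \<le> max 0 (e\<^sup>2 - z \<bullet> z)" by simp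
      finally have "3 / 4 * e\<^sup>2 \<le> max 0 (e\<^sup>2 - z \<bullet> z)" .
      then have "(3 / 4 * e\<^sup>2)\<^sup>2 \<le> bump e z" unfolding bump_def by (intro power_mono) auto
      moreover have "(3 / 4 * e\<^sup>2)\<^sup>2 = 9 / 16 * e ^ 4" by (simp add: power_mult_distrib power_divide)
      ultimately show ?thesis using True by simp
    qed (simp add: bump_nonneg)
  qed
  then show ?thesis unfolding bump_mass_def by simp
qed

lemma bump_mass_pos: "0 < e \<Longrightarrow> 0 < bump_mass e TYPE('b::euclidean_space)"
  using bump_mass_ge[of e, where 'b = 'b] content_ball_pos[of "e/2" "0::'b"]
  by (smt (verit) mult_pos_pos divide_pos_pos zero_less_power)

lemma mollify_bound:
  assumes f: "continuous_on UNIV (f :: 'b::euclidean_space \<Rightarrow> real)" and e: "0 < e" and B: "\<And>z. f z \<le> B"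
  shows "mollify e f x \<le> B"
proof -
  have "(\<integral>z. bump e z * f (x + z) \<partial>lborel) \<le> (\<integral>z. bump e (z::'b) * B \<partial>lborel)"
    by (rule integral_mono)
       (use integrable_bump(1)[OF f, of e x] integrable_bump(1)[of "\<lambda>_. B" e x] e B in \<open>auto intro!: mult_left_mono bump_nonneg\<close>)
  also have "\<dots> = bump_mass e TYPE('b) * B" by (simp add: bump_mass_def)
  finally show ?thesis using bump_mass_pos[OF e, where 'b = 'b]
    by (simp add: mollify_def pos_divide_le_eq mult.commute)
qed

lemma mollify_linear:
  assumes "continuous_on UNIV (f :: 'b::euclidean_space \<Rightarrow> real)" "continuous_on UNIV g" "0 < e"
  shows "mollify e (\<lambda>x. a * f x + b * g x) x = a * mollify e f x + b * mollify e g x"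
    "mollify_grad e (\<lambda>x. a * f x + b * g x) x = a *\<^sub>R mollify_grad e f x + b *\<^sub>R mollify_grad e g x"
proof -
  have "(\<integral>z. bump e z * (a * f (x + z) + b * g (x + z)) \<partial>lborel)
      = (\<integral>z. a * (bump e z * f (x + z)) + b * (bump e z * g (x + z)) \<partial>lborel)"
    by (simp add: algebra_simps)
  also have "\<dots> = a * (\<integral>z. bump e z * f (x + z) \<partial>lborel) + b * (\<integral>z. bump e z * g (x + z) \<partial>lborel)"
    using integrable_bump(1)[OF assms(1), of e x] integrable_bump(1)[OF assms(2), of e x] assms(3) by simp
  finally show "mollify e (\<lambda>x. a * f x + b * g x) x = a * mollify e f x + b * mollify e g x"
    by (simp add: mollify_def add_divide_distrib)
  have "(\<integral>z. (bump_grad e z * (a * f (x + z) + b * g (x + z))) *\<^sub>R z \<partial>lborel)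
      = (\<integral>z. a *\<^sub>R ((bump_grad e z * f (x + z)) *\<^sub>R z) + b *\<^sub>R ((bump_grad e z * g (x + z)) *\<^sub>R z) \<partial>lborel)"
    by (simp add: algebra_simps)
  also have "\<dots> = a *\<^sub>R (\<integral>z. (bump_grad e z * f (x + z)) *\<^sub>R z \<partial>lborel) + b *\<^sub>R (\<integral>z. (bump_grad e z * g (x + z)) *\<^sub>R z \<partial>lborel)"
    using integrable_bump(2)[OF assms(1), of e x] integrable_bump(2)[OF assms(2), of e x] assms(3)
    by (simp add: Bochner_Integration.integral_add integrable_scaleR_right del: scaleR_scaleR)
  finally show "mollify_grad e (\<lambda>x. a * f x + b * g x) x = a *\<^sub>R mollify_grad e f x + b *\<^sub>R mollify_grad e g x"
    by (simp add: mollify_grad_def scaleR_add_right mult.commute)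
qed

lemma mollify_const: "0 < e \<Longrightarrow> mollify e (\<lambda>_. c) x = c"
  for x :: "'b::euclidean_space"
  using bump_mass_pos[of e, where 'b = 'b] by (simp add: mollify_def bump_mass_def)

lemma has_derivative_bump:
  "((\<lambda>x. bump e (y - x)) has_derivative (\<lambda>v. (bump_grad e (y - x) *\<^sub>R (y - x)) \<bullet> v)) (at x within U)"
proof -
  have 1: "((\<lambda>x. e\<^sup>2 - (y - x) \<bullet> (y - x)) has_derivative (\<lambda>v. 2 * ((y - x) \<bullet> v))) (at x within U)"
    by (auto intro!: derivative_eq_intros simp: inner_commute)
  have 2: "((\<lambda>t::real. (max 0 t)\<^sup>2) has_derivative (*) (2 * max 0 (e\<^sup>2 - (y - x) \<bullet> (y - x))))
      (at (e\<^sup>2 - (y - x) \<bullet> (y - x)))"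
    using has_derivative_max0_power2 unfolding has_field_derivative_def .
  show ?thesis
    using has_derivative_compose[OF 1 2] by (simp add: bump_def bump_grad_def algebra_simps)
qed

lemma lborel_integral_shift:
  fixes F :: "'b::euclidean_space \<Rightarrow> 'c::{banach, second_countable_topology}"
  assumes "F \<in> borel_measurable borel"
  shows "(\<integral>y. F (y - x) \<partial>lborel) = (\<integral>z. F z \<partial>lborel)"
proof -
  have "(\<integral>y. F y \<partial>(lborel :: 'b measure)) = (\<integral>y. F y \<partial>distr lborel borel ((+) (- x)))"
    by (simp add: lborel_distr_plus)
  also have "\<dots> = (\<integral>y. F (- x + y) \<partial>lborel)" using assms by (intro integral_distr) auto
  finally show ?thesis by simp
qed

lemma lborel_integral_eq_integral_cbox:
  fixes F :: "'b::euclidean_space \<Rightarrow> 'c::euclidean_space"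
  assumes "continuous_on UNIV F" "\<And>y. y \<notin> cbox a b \<Longrightarrow> F y = 0"
  shows "(\<integral>y. F y \<partial>lborel) = integral (cbox a b) F"
proof -
  have "(\<integral>y. F y \<partial>lborel) = (LINT y:cbox a b|lborel. F y)"
    unfolding set_lebesgue_integral_def using assms(2) by (intro Bochner_Integration.integral_cong) (auto simp: indicator_def)
  also have "\<dots> = integral (cbox a b) F"
    unfolding set_integrable_def
    by (rule set_borel_integral_eq_integral) (use borel_integrable_compact[OF compact_cbox continuous_on_subset[OF assms(1)]] in \<open>auto simp: set_integrable_def\<close>)
  finally show ?thesis .
qed

text \<open>The substitution \<open>y = x + z\<close> moves \<open>x\<close> from \<open>f\<close>
  into the kernel. For \<open>x\<close> in a unit ball all supports lie in one box, so that results
  on parameter integrals over a fixed box apply.\<close>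

lemma mollify_near:
  assumes f: "continuous_on UNIV (f :: 'b::euclidean_space \<Rightarrow> real)" and e: "0 < e"
  shows "\<exists>b. \<forall>x\<in>ball x0 1. mollify e f x = integral (cbox (-b) b) (\<lambda>y. bump e (y - x) * f y) / bump_mass e TYPE('b) \<and>
      mollify_grad e f x = integral (cbox (-b) b) (\<lambda>y. (bump_grad e (y - x) * f y) *\<^sub>R (y - x)) /\<^sub>R bump_mass e TYPE('b)"
proof -
  obtain b where b: "cball x0 (1 + e) \<subseteq> cbox (-b) b"
    using bounded_subset_cbox_symmetric[OF bounded_cball] by blast
  have out: "norm (y - x) > e" if "x \<in> ball x0 1" "y \<notin> cbox (-b) b" for x y
  proof -
    have "1 + e < dist x0 y" using b that(2) by (auto simp: subset_iff not_le[symmetric])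
    also have "\<dots> \<le> dist x0 x + norm (y - x)" using dist_triangle[of x0 y x] by (simp add: dist_norm norm_minus_commute)
    finally show ?thesis using that(1) by simp
  qed
  show ?thesis
  proof (intro exI[of _ b] ballI conjI)
    fix x assume x: "x \<in> ball x0 1"
    have "(\<integral>z. bump e z * f (x + z) \<partial>lborel) = (\<integral>y. bump e (y - x) * f (x + (y - x)) \<partial>lborel)"
      by (rule lborel_integral_shift[symmetric])
         (intro borel_measurable_continuous_onI continuous_intros continuous_shift f)
    also have "\<dots> = integral (cbox (-b) b) (\<lambda>y. bump e (y - x) * f y)"
    proof (subst lborel_integral_eq_integral_cbox[of _ "-b" b])
      show "continuous_on UNIV (\<lambda>y. bump e (y - x) * f (x + (y - x)))"
        using f by (simp add: continuous_intros)
      show "bump e (y - x) * f (x + (y - x)) = 0" if "y \<notin> cbox (-b) b" for y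
        using bump_zero(1)[OF _ out[OF x that]] e by simp
    qed simp
    finally show "mollify e f x = integral (cbox (-b) b) (\<lambda>y. bump e (y - x) * f y) / bump_mass e TYPE('b)"
      by (simp add: mollify_def)
  next
    fix x assume x: "x \<in> ball x0 1"
    have "(\<integral>z. (bump_grad e z * f (x + z)) *\<^sub>R z \<partial>lborel) = (\<integral>y. (bump_grad e (y - x) * f (x + (y - x))) *\<^sub>R (y - x) \<partial>lborel)"
      by (rule lborel_integral_shift[symmetric])
         (intro borel_measurable_continuous_onI continuous_intros continuous_shift f)
    also have "\<dots> = integral (cbox (-b) b) (\<lambda>y. (bump_grad e (y - x) * f y) *\<^sub>R (y - x))"
    proof (subst lborel_integral_eq_integral_cbox[of _ "-b" b])
      show "continuous_on UNIV (\<lambda>y. (bump_grad e (y - x) * f (x + (y - x))) *\<^sub>R (y - x))"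
        using f by (simp add: continuous_intros)
      show "(bump_grad e (y - x) * f (x + (y - x))) *\<^sub>R (y - x) = 0" if "y \<notin> cbox (-b) b" for y
        using bump_zero(2)[OF _ out[OF x that]] e by simp
    qed simp
    finally show "mollify_grad e f x = integral (cbox (-b) b) (\<lambda>y. (bump_grad e (y - x) * f y) *\<^sub>R (y - x)) /\<^sub>R bump_mass e TYPE('b)"
      by (simp add: mollify_grad_def)
  qed
qed

lemma has_derivative_mollify:
  assumes f: "continuous_on UNIV (f :: 'b::euclidean_space \<Rightarrow> real)" and e: "0 < e"
  shows "(mollify e f has_derivative (\<lambda>v. mollify_grad e f x0 \<bullet> v)) (at x0)"
proof -
  let ?Z = "bump_mass e TYPE('b)"
  obtain b where b': "\<forall>x\<in>ball x0 1. mollify e f x = integral (cbox (-b) b) (\<lambda>y. bump e (y - x) * f y) / ?Z \<and>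
      mollify_grad e f x = integral (cbox (-b) b) (\<lambda>y. (bump_grad e (y - x) * f y) *\<^sub>R (y - x)) /\<^sub>R ?Z"
    using mollify_near[OF f e, of x0] ..
  have b: "\<And>x. x \<in> ball x0 1 \<Longrightarrow> mollify e f x = integral (cbox (-b) b) (\<lambda>y. bump e (y - x) * f y) / ?Z"
    "\<And>x. x \<in> ball x0 1 \<Longrightarrow> mollify_grad e f x = integral (cbox (-b) b) (\<lambda>y. (bump_grad e (y - x) * f y) *\<^sub>R (y - x)) /\<^sub>R ?Z"
    using b' by blast+
  let ?w = "\<lambda>x y. (bump_grad e (y - x) * f y) *\<^sub>R (y - x)"
  have cf: "continuous_on S f" for S using f by (rule continuous_on_subset) simp
  have "((\<lambda>x. integral (cbox (-b) b) (\<lambda>y. bump e (y - x) * f y)) has_derivative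
      integral (cbox (-b) b) (\<lambda>y. blinfun_inner_left (?w x0 y))) (at x0 within ball x0 1)"
  proof (rule leibniz_rule)
    fix x t
    have "((\<lambda>x. bump e (t - x) * f t) has_derivative (\<lambda>v. ((bump_grad e (t - x) *\<^sub>R (t - x)) \<bullet> v) * f t)) (at x within ball x0 1)"
      by (rule has_derivative_mult_left[OF has_derivative_bump])
    then show "((\<lambda>x. bump e (t - x) * f t) has_derivative blinfun_apply (blinfun_inner_left (?w x t))) (at x within ball x0 1)"
      by (simp add: blinfun_inner_left.rep_eq inner_commute mult_ac)
  next
    show "(\<lambda>y. bump e (y - x) * f y) integrable_on cbox (-b) b" for x
      by (intro integrable_continuous continuous_intros cf)
    have "continuous_on (ball x0 1 \<times> cbox (- b) b) (\<lambda>p. blinfun_inner_left (?w (fst p) (snd p)))"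
      by (intro bounded_linear.continuous_on[OF bounded_linear_blinfun_inner_left] continuous_intros
          continuous_on_compose2[OF f]) auto
    then show "continuous_on (ball x0 1 \<times> cbox (- b) b) (\<lambda>(x, t). blinfun_inner_left (?w x t))"
      by (simp add: case_prod_beta)
  qed auto
  moreover have "integral (cbox (-b) b) (\<lambda>y. blinfun_inner_left (?w x0 y)) = blinfun_inner_left (integral (cbox (-b) b) (?w x0))"
  proof -
    have "?w x0 integrable_on cbox (-b) b" by (intro integrable_continuous continuous_intros cf)
    from integral_linear[OF this bounded_linear_blinfun_inner_left] show ?thesis by (simp add: o_def)
  qed
  ultimately have "((\<lambda>x. integral (cbox (-b) b) (\<lambda>y. bump e (y - x) * f y)) has_derivative
      (\<lambda>v. integral (cbox (-b) b) (?w x0) \<bullet> v)) (at x0)"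
    by (simp add: blinfun_inner_left.rep_eq inner_commute at_within_open[of x0 "ball x0 1"])
  from has_derivative_mult_right[OF this, of "inverse ?Z"]
  have "((\<lambda>x. integral (cbox (-b) b) (\<lambda>y. bump e (y - x) * f y) / ?Z) has_derivative
      (\<lambda>v. mollify_grad e f x0 \<bullet> v)) (at x0)"
    by (simp add: b(2) divide_inverse mult.commute)
  then show ?thesis
    by (rule has_derivative_transform_within_open[of _ _ _ _ "ball x0 1"]) (auto simp: b(1))
qed

lemma continuous_mollify_grad:
  assumes f: "continuous_on UNIV (f :: 'b::euclidean_space \<Rightarrow> real)" and e: "0 < e"
  shows "continuous_on UNIV (mollify_grad e f)"
proof -
  have "continuous (at x0) (mollify_grad e f)" for x0
  proof -
    obtain b where b': "\<forall>x\<in>ball x0 1. mollify e f x = integral (cbox (-b) b) (\<lambda>y. bump e (y - x) * f y) / bump_mass e TYPE('b) \<and>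
        mollify_grad e f x = integral (cbox (-b) b) (\<lambda>y. (bump_grad e (y - x) * f y) *\<^sub>R (y - x)) /\<^sub>R bump_mass e TYPE('b)"
      using mollify_near[OF f e, of x0] ..
    have b: "\<And>x. x \<in> ball x0 1 \<Longrightarrow> mollify_grad e f x = integral (cbox (-b) b) (\<lambda>y. (bump_grad e (y - x) * f y) *\<^sub>R (y - x)) /\<^sub>R bump_mass e TYPE('b)"
      using b' by blast
    have "continuous_on (ball x0 1) (\<lambda>x. integral (cbox (-b) b) (\<lambda>y. (bump_grad e (y - x) * f y) *\<^sub>R (y - x)))"
    proof (rule integral_continuous_on_param)
      show "continuous_on (ball x0 1 \<times> cbox (- b) b) (\<lambda>(x, y). (bump_grad e (y - x) * f y) *\<^sub>R (y - x))"
        unfolding case_prod_beta by (intro continuous_intros continuous_on_compose2[OF f]) auto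
    qed
    then have "continuous_on (ball x0 1) (\<lambda>x. integral (cbox (-b) b) (\<lambda>y. (bump_grad e (y - x) * f y) *\<^sub>R (y - x)) /\<^sub>R bump_mass e TYPE('b))"
      by (intro continuous_intros)
    then have "continuous_on (ball x0 1) (mollify_grad e f)" by (subst continuous_on_cong[OF refl b])
    then show ?thesis by (rule continuous_on_interior) simp
  qed
  then show ?thesis by (simp add: continuous_on_eq_continuous_at)
qed

lemma mollify_grad_bound:
  "\<exists>C\<ge>0. \<forall>e>0. \<forall>f. \<forall>x::'b::euclidean_space. \<forall>M. continuous_on UNIV f \<longrightarrow> (\<forall>z. norm z \<le> e \<longrightarrow> \<bar>f (x + z)\<bar> \<le> M)
      \<longrightarrow> norm (mollify_grad e f x) \<le> C * M / e"
proof (intro exI conjI allI impI)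
  \<comment> \<open>The quotient of the upper bound
    \<open>4 * e ^ 3 * M * (2 ^ DIM('b) * ?V)\<close> for the integral by the lower bound
    \<open>9 / 16 * e ^ 4 * ?V\<close> for the mass, up to the factor \<open>M / e\<close>.\<close>
  let ?C = "(64 / 9 :: real) * 2 ^ DIM('b)"
  show "0 \<le> ?C" by simp
  fix e M :: real and f and x :: 'b
  assume e: "0 < e" and f: "continuous_on UNIV f" and M': "\<forall>z. norm z \<le> e \<longrightarrow> \<bar>f (x + z)\<bar> \<le> M"
  then have M: "\<bar>f (x + z)\<bar> \<le> M" if "norm z \<le> e" for z using that by blast
  let ?Z = "bump_mass e TYPE('b)"
  let ?V = "measure lborel (ball (0::'b) (e / 2))"
  have V: "?V > 0" using e content_ball_pos[of "e / 2"] by simp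
  have V2: "measure lborel (cball (0::'b) e) = 2 ^ DIM('b) * ?V"
    using e by (simp add: content_cball content_ball power_divide)
  have "0 \<le> M" using M[of 0] e by simp
  have "norm (\<integral>z. (bump_grad e z * f (x + z)) *\<^sub>R z \<partial>lborel) \<le> (\<integral>z. norm ((bump_grad e z * f (x + z)) *\<^sub>R z) \<partial>lborel)"
    by (rule integral_norm_bound)
  also have "\<dots> \<le> (\<integral>z. 4 * e ^ 3 * M * indicator (cball (0::'b) e) z \<partial>lborel)"
  proof (rule integral_mono)
    show "integrable lborel (\<lambda>z. norm ((bump_grad e z * f (x + z)) *\<^sub>R z))"
      using e by (intro integrable_norm integrable_bump f) auto
    show "integrable lborel (\<lambda>z::'b. 4 * e ^ 3 * M * indicator (cball 0 e) z)"
      by (intro integrable_mult_right integrable_real_indicator emeasure_bounded_finite bounded_cball) auto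
    fix z :: 'b
    show "norm ((bump_grad e z * f (x + z)) *\<^sub>R z) \<le> 4 * e ^ 3 * M * indicator (cball 0 e) z"
    proof (cases "norm z \<le> e")
      case True
      have "\<bar>bump_grad e z\<bar> \<le> 4 * e\<^sup>2" by (simp add: bump_grad_def max_def)
      then have "\<bar>bump_grad e z\<bar> * \<bar>f (x + z)\<bar> * norm z \<le> 4 * e\<^sup>2 * M * e"
        using True M[OF True] by (intro mult_mono) auto
      then show ?thesis using True by (simp add: abs_mult power2_eq_square power3_eq_cube mult_ac)
    next
      case False
      then show ?thesis using e bump_zero(2)[of e z] by simp
    qed
  qed
  also have "\<dots> = 4 * e ^ 3 * M * (2 ^ DIM('b) * ?V)" using V2 by simp
  finally have "norm (\<integral>z. (bump_grad e z * f (x + z)) *\<^sub>R z \<partial>lborel) \<le> 4 * e ^ 3 * M * (2 ^ DIM('b) * ?V)" .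
  also have "\<dots> = (?C * M / e) * (9 / 16 * e ^ 4 * ?V)"
    using e by (simp add: field_simps power_numeral_reduce)
  also have "\<dots> \<le> (?C * M / e) * ?Z"
    using bump_mass_ge[OF e, where 'b = 'b] e \<open>0 \<le> M\<close> by (intro mult_left_mono) auto
  finally have le: "norm (\<integral>z. (bump_grad e z * f (x + z)) *\<^sub>R z \<partial>lborel) \<le> (?C * M / e) * ?Z" .
  have Z: "0 < ?Z" by (rule bump_mass_pos[OF e])
  then have "norm (mollify_grad e f x) = norm (\<integral>z. (bump_grad e z * f (x + z)) *\<^sub>R z \<partial>lborel) / ?Z"
    by (simp add: mollify_grad_def divide_inverse mult.commute)
  also have "\<dots> \<le> ?C * M / e" using le unfolding pos_divide_le_eq[OF Z] .
  finally show "norm (mollify_grad e f x) \<le> ?C * M / e" .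
qed

text \<open>Translating an affine function only adds a constant, so its mollification is affine with
  the same slope; uniqueness of the derivative then identifies the gradient.\<close>

lemma mollify_grad_affine:
  assumes e: "0 < e"
  shows "mollify_grad e (\<lambda>y. v \<bullet> y + c) x = (v :: 'b::euclidean_space)"
proof -
  let ?f = "\<lambda>y. v \<bullet> y + c"
  have c: "continuous_on UNIV ?f" by (intro continuous_intros)
  have A: "mollify e ?f x = v \<bullet> x + mollify e ?f 0" for x
  proof -
    have "mollify e (\<lambda>y. 1 * (v \<bullet> y + c) + (v \<bullet> x) * 1) 0 = 1 * mollify e ?f 0 + (v \<bullet> x) * mollify e (\<lambda>_::'b. 1) 0"
      by (rule mollify_linear(1)[of "\<lambda>y. v \<bullet> y + c" "\<lambda>_. 1" e 1 "v \<bullet> x" 0]) (use e in \<open>auto intro!: continuous_intros\<close>)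
    moreover have "mollify e (\<lambda>y. 1 * (v \<bullet> y + c) + (v \<bullet> x) * 1) 0 = mollify e ?f x"
      unfolding mollify_def by (simp add: algebra_simps)
    ultimately show ?thesis by (simp add: mollify_const[OF e])
  qed
  have eq: "(\<lambda>x. v \<bullet> x + mollify e ?f 0) = mollify e ?f" by (rule ext) (rule A[symmetric])
  have "((\<lambda>x. v \<bullet> x + mollify e ?f 0) has_derivative (\<lambda>h. v \<bullet> h)) (at x)"
    by (auto intro!: derivative_eq_intros)
  then have "(mollify e ?f has_derivative (\<lambda>h. v \<bullet> h)) (at x)" unfolding eq .
  then have U: "(\<lambda>h. v \<bullet> h) = (\<lambda>h. mollify_grad e ?f x \<bullet> h)"
    by (rule has_derivative_unique) (rule has_derivative_mollify[OF c e])
  define m where "m = mollify_grad e ?f x"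
  have "v \<bullet> h = m \<bullet> h" for h unfolding m_def by (rule fun_cong[OF U])
  from this[of "v - m"] have "(v - m) \<bullet> (v - m) = 0" by (simp add: inner_diff_left)
  then have "m = v" by simp
  then show ?thesis by (rule trans[OF m_def[symmetric]])
qed

text \<open>Nonexpansiveness relative to the two translated points \<open>x + e\<close> and \<open>x - e\<close> leaves only a quadratic error, also
  in directions transversal to \<open>e\<close>. Hence mollification preserves the derivative along \<open>e\<close> in the limit.\<close>

lemma translating_second_order:
  fixes T :: "'b::real_inner \<Rightarrow> 'b"
  assumes nonexp: "\<And>x y. norm (T x - T y) \<le> norm (x - y)"
    and "T (x + e) = T x + e" "T (x - e) = T x - e"
  shows "\<bar>(T (x + z) - T x - z) \<bullet> e\<bar> \<le> (norm z)\<^sup>2 / 2"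
proof -
  \<comment> \<open>Used with \<open>w = z + e\<close> and \<open>w = e - z\<close>. There is
    equality at \<open>z = 0\<close>, which is why only half of \<open>(norm z)\<^sup>2\<close> is
    lost.\<close>
  have amgm: "norm e * norm w \<le> (e \<bullet> e + w \<bullet> w) / 2" for w :: 'b
    using sum_squares_bound[of "norm e" "norm w"] by (simp add: power2_norm_eq_inner)
  have "(T (x + z) - T (x - e)) \<bullet> e \<le> norm (T (x + z) - T (x - e)) * norm e" by (rule norm_cauchy_schwarz)
  also have "\<dots> \<le> norm (z + e) * norm e" using nonexp[of "x + z" "x - e"] by (intro mult_right_mono) auto
  also have "\<dots> \<le> (e \<bullet> e + (z + e) \<bullet> (z + e)) / 2" using amgm[of "z + e"] by (simp add: mult.commute)
  also have "\<dots> = e \<bullet> e + z \<bullet> e + (norm z)\<^sup>2 / 2" by (simp add: power2_norm_eq_inner algebra_simps inner_commute)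
  finally have 1: "(T (x + z) - T x) \<bullet> e \<le> z \<bullet> e + (norm z)\<^sup>2 / 2"
    unfolding assms(3) by (simp add: algebra_simps)
  have "(T (x + e) - T (x + z)) \<bullet> e \<le> norm (T (x + e) - T (x + z)) * norm e" by (rule norm_cauchy_schwarz)
  also have "\<dots> \<le> norm (e - z) * norm e" using nonexp[of "x + e" "x + z"] by (intro mult_right_mono) auto
  also have "\<dots> \<le> (e \<bullet> e + (e - z) \<bullet> (e - z)) / 2" using amgm[of "e - z"] by (simp add: mult.commute)
  also have "\<dots> = e \<bullet> e - z \<bullet> e + (norm z)\<^sup>2 / 2" by (simp add: power2_norm_eq_inner inner_diff_left inner_diff_right inner_commute field_simps)
  finally have 2: "(T (x + z) - T x) \<bullet> e \<ge> z \<bullet> e - (norm z)\<^sup>2 / 2"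
    unfolding assms(2) by (simp add: algebra_simps)
  have "(T (x + z) - T x - z) \<bullet> e = (T (x + z) - T x) \<bullet> e - z \<bullet> e" by (simp add: inner_diff_left)
  then show ?thesis using 1 2 by linarith
qed

section \<open>Mollified maps, their derivative matrices and traces\<close>

definition mollify_vec :: "real \<Rightarrow> (real ^ 'n \<Rightarrow> real ^ 'n) \<Rightarrow> real ^ 'n \<Rightarrow> real ^ 'n" where
  "mollify_vec e T x = (\<chi> i. mollify e (\<lambda>y. T y $ i) x)"

definition mollify_mat :: "real \<Rightarrow> (real ^ 'n \<Rightarrow> real ^ 'n) \<Rightarrow> real ^ 'n \<Rightarrow> real ^ 'n ^ 'n" where
  "mollify_mat e T x = (\<chi> i. mollify_grad e (\<lambda>y. T y $ i) x)"

lemma has_derivative_mollify_vec: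
  fixes T :: "real ^ 'n \<Rightarrow> real ^ 'n"
  assumes "continuous_on UNIV T" "0 < e"
  shows "(mollify_vec e T has_derivative (\<lambda>v. mollify_mat e T x *v v)) (at x)"
proof (subst has_derivative_componentwise_within, intro ballI)
  fix b :: "real ^ 'n" assume "b \<in> Basis"
  then obtain i where b: "b = axis i 1" by (auto simp: Basis_vec_def)
  have "(mollify e (\<lambda>y. T y $ i) has_derivative (\<lambda>v. mollify_grad e (\<lambda>y. T y $ i) x \<bullet> v)) (at x)"
    using assms by (intro has_derivative_mollify continuous_intros)
  then show "((\<lambda>x. mollify_vec e T x \<bullet> b) has_derivative (\<lambda>v. (mollify_mat e T x *v v) \<bullet> b)) (at x)"
    unfolding b by (simp add: inner_axis mollify_vec_def mollify_mat_def matrix_vector_mul_component)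
qed

lemma mollify_sum:
  fixes f :: "'i \<Rightarrow> 'b::euclidean_space \<Rightarrow> real"
  assumes "finite I" "\<And>i. i \<in> I \<Longrightarrow> continuous_on UNIV (f i)" "0 < e"
  shows "mollify e (\<lambda>x. \<Sum>i\<in>I. a i * f i x) x = (\<Sum>i\<in>I. a i * mollify e (f i) x)"
    "mollify_grad e (\<lambda>x. \<Sum>i\<in>I. a i * f i x) x = (\<Sum>i\<in>I. a i *\<^sub>R mollify_grad e (f i) x)"
proof -
  have "mollify e (\<lambda>x. \<Sum>i\<in>I. a i * f i x) x = (\<Sum>i\<in>I. a i * mollify e (f i) x) \<and>
    mollify_grad e (\<lambda>x. \<Sum>i\<in>I. a i * f i x) x = (\<Sum>i\<in>I. a i *\<^sub>R mollify_grad e (f i) x)"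
    using assms(1,2)
  proof (induction I rule: finite_induct)
    case empty
    then show ?case by (simp add: mollify_def mollify_grad_def)
  next
    case (insert j I)
    have c: "continuous_on UNIV (f j)" "continuous_on UNIV (\<lambda>x. \<Sum>i\<in>I. a i * f i x)"
      using insert.prems by (auto intro!: continuous_intros)
    show ?case
      using insert mollify_linear[OF c assms(3), of "a j" 1 x] by simp
  qed
  then show "mollify e (\<lambda>x. \<Sum>i\<in>I. a i * f i x) x = (\<Sum>i\<in>I. a i * mollify e (f i) x)"
    "mollify_grad e (\<lambda>x. \<Sum>i\<in>I. a i * f i x) x = (\<Sum>i\<in>I. a i *\<^sub>R mollify_grad e (f i) x)" by auto
qed

lemma mollify_vec_inner:
  fixes T :: "real ^ 'n \<Rightarrow> real ^ 'n"
  assumes "continuous_on UNIV T" "0 < e"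
  shows "c \<bullet> mollify_vec e T x = mollify e (\<lambda>y. c \<bullet> T y) x"
    "c \<bullet> (mollify_mat e T x *v v) = mollify_grad e (\<lambda>y. c \<bullet> T y) x \<bullet> v"
proof -
  have cont: "\<And>i. continuous_on UNIV (\<lambda>y. T y $ i)" using assms(1) by (intro continuous_intros)
  show "c \<bullet> mollify_vec e T x = mollify e (\<lambda>y. c \<bullet> T y) x"
    using mollify_sum(1)[of UNIV "\<lambda>i y. T y $ i" e "\<lambda>i. c $ i" x] cont assms(2)
    by (simp add: inner_vec_def mollify_vec_def)
  show "c \<bullet> (mollify_mat e T x *v v) = mollify_grad e (\<lambda>y. c \<bullet> T y) x \<bullet> v"
    using mollify_sum(2)[of UNIV "\<lambda>i y. T y $ i" e "\<lambda>i. c $ i" x] cont assms(2)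
    by (simp add: inner_vec_def[of c] mollify_mat_def matrix_vector_mul_component inner_sum_left)
qed

text \<open>An increment of the mollified map is an average of increments \<open>d\<close> of
  \<open>T\<close> over translated pairs of points. The condition
  \<open>d \<bullet> d \<le> (x - y) \<bullet> d\<close> describes a ball, and balls are
  convex.\<close>

lemma mollify_vec_firmly_nonexpansive:
  fixes T :: "real ^ 'n \<Rightarrow> real ^ 'n"
  assumes T: "continuous_on UNIV T" and e: "0 < e"
    and firm: "\<And>x y. (norm (T x - T y))\<^sup>2 \<le> (x - y) \<bullet> (T x - T y)"
  shows "(norm (mollify_vec e T x - mollify_vec e T y))\<^sup>2 \<le> (x - y) \<bullet> (mollify_vec e T x - mollify_vec e T y)"
proof -
  let ?c = "mollify_vec e T x - mollify_vec e T y"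
  \<comment> \<open>The gradient at \<open>?c\<close> of the convex function
    \<open>d \<bullet> d - (x - y) \<bullet> d\<close>. Testing the average against this one vector
    takes the place of Jensen's inequality.\<close>
  define u where "u = 2 *\<^sub>R ?c - (x - y)"
  have sh: "mollify e f x - mollify e f y = mollify e (\<lambda>z. f (z + (x - y)) - f z) y"
    if f: "continuous_on UNIV f" for f :: "real ^ 'n \<Rightarrow> real"
  proof -
    have "continuous_on UNIV (\<lambda>z. f (z + (x - y)))"
      by (rule continuous_on_compose2[OF f]) (auto intro!: continuous_intros)
    then have "mollify e (\<lambda>z. 1 * f (z + (x - y)) + (-1) * f z) y = 1 * mollify e (\<lambda>z. f (z + (x - y))) y + (-1) * mollify e f y"
      using f e by (rule mollify_linear(1))
    moreover have "mollify e (\<lambda>z. f (z + (x - y))) y = mollify e f x"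
      unfolding mollify_def by (simp add: algebra_simps)
    ultimately show ?thesis by simp
  qed
  have cu: "continuous_on UNIV (\<lambda>z. u \<bullet> T z)" using T by (intro continuous_intros)
  have "u \<bullet> ?c = mollify e (\<lambda>z. u \<bullet> T z) x - mollify e (\<lambda>z. u \<bullet> T z) y"
    unfolding inner_diff_right mollify_vec_inner(1)[OF T e] ..
  also have "\<dots> = mollify e (\<lambda>z. u \<bullet> T (z + (x - y)) - u \<bullet> T z) y" by (rule sh[OF cu])
  also have "\<dots> \<le> ?c \<bullet> ?c"
  proof (rule mollify_bound[OF _ e])
    show "continuous_on UNIV (\<lambda>z. u \<bullet> T (z + (x - y)) - u \<bullet> T z)"
      by (intro continuous_intros continuous_on_compose2[OF T] T) auto
    fix z
    let ?d = "T (z + (x - y)) - T z"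
    have "?d \<bullet> ?d \<le> (x - y) \<bullet> ?d" using firm[of "z + (x - y)" z] by (simp add: power2_norm_eq_inner)
    moreover have "0 \<le> (?d - ?c) \<bullet> (?d - ?c)" by (rule inner_ge_zero)
    moreover have "(?d - ?c) \<bullet> (?d - ?c) = ?d \<bullet> ?d - 2 * (?c \<bullet> ?d) + ?c \<bullet> ?c"
      using dot_norm_neg[of ?d ?c] by (simp add: power2_norm_eq_inner inner_commute)
    moreover have "u \<bullet> T (z + (x - y)) - u \<bullet> T z = 2 * (?c \<bullet> ?d) - (x - y) \<bullet> ?d"
      unfolding inner_diff_right[symmetric] u_def by (simp only: inner_diff_left inner_scaleR_left)
    ultimately show "u \<bullet> T (z + (x - y)) - u \<bullet> T z \<le> ?c \<bullet> ?c" by linarith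
  qed
  finally have "2 * (?c \<bullet> ?c) - (x - y) \<bullet> ?c \<le> ?c \<bullet> ?c"
    unfolding u_def by (simp only: inner_diff_left inner_scaleR_left)
  then show ?thesis unfolding power2_norm_eq_inner by linarith
qed

lemma firmly_nonexpansive_derivative:
  fixes S :: "real ^ 'n \<Rightarrow> real ^ 'n"
  assumes firm: "\<And>x y. (norm (S x - S y))\<^sup>2 \<le> (x - y) \<bullet> (S x - S y)"
    and der: "(S has_derivative (\<lambda>v. A *v v)) (at x)"
  shows "(norm (A *v v))\<^sup>2 \<le> v \<bullet> (A *v v)"
proof -
  have "((\<lambda>t. S (x + t *\<^sub>R v)) has_vector_derivative A *v v) (at 0)"
  proof -
    have "((\<lambda>t. x + t *\<^sub>R v) has_derivative (\<lambda>t. t *\<^sub>R v)) (at (0::real))"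
      by (auto intro!: derivative_eq_intros)
    from has_derivative_compose[OF this, of S "\<lambda>v. A *v v"] der
    have "((\<lambda>t. S (x + t *\<^sub>R v)) has_derivative (\<lambda>t. A *v (t *\<^sub>R v))) (at 0)" by simp
    then show ?thesis by (simp add: has_vector_derivative_def matrix_vector_mult_scaleR)
  qed
  then have "((\<lambda>t. norm ((S (x + t *\<^sub>R v) - S x) - t *\<^sub>R (A *v v)) / norm t) \<longlongrightarrow> 0) (at 0)"
    by (simp add: has_vector_derivative_def has_derivative_iff_norm)
  then have "((\<lambda>t. norm ((S (x + t *\<^sub>R v) - S x) /\<^sub>R t - A *v v)) \<longlongrightarrow> 0) (at 0)"
  proof (rule Lim_transform_eventually)
    show "\<forall>\<^sub>F t in at 0. norm ((S (x + t *\<^sub>R v) - S x) - t *\<^sub>R (A *v v)) / norm t = norm ((S (x + t *\<^sub>R v) - S x) /\<^sub>R t - A *v v)"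
      unfolding eventually_at_filter
    proof (intro always_eventually allI impI)
      fix t :: real assume t: "t \<noteq> 0"
      have "(S (x + t *\<^sub>R v) - S x) /\<^sub>R t - A *v v = inverse t *\<^sub>R ((S (x + t *\<^sub>R v) - S x) - t *\<^sub>R (A *v v))"
        unfolding scaleR_diff_right scaleR_scaleR using t by simp
      then show "norm ((S (x + t *\<^sub>R v) - S x) - t *\<^sub>R (A *v v)) / norm t = norm ((S (x + t *\<^sub>R v) - S x) /\<^sub>R t - A *v v)"
        by (simp only: norm_scaleR) (simp add: divide_inverse mult.commute)
    qed
  qed
  then have lim: "((\<lambda>t. (S (x + t *\<^sub>R v) - S x) /\<^sub>R t) \<longlongrightarrow> A *v v) (at 0)"
    by (simp add: tendsto_norm_zero_iff LIM_zero_iff)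
  show ?thesis
  proof (rule tendsto_le[OF _ tendsto_inner[OF tendsto_const lim] tendsto_power[OF tendsto_norm[OF lim]]])
    show "\<forall>\<^sub>F t in at 0. (norm ((S (x + t *\<^sub>R v) - S x) /\<^sub>R t))\<^sup>2 \<le> v \<bullet> ((S (x + t *\<^sub>R v) - S x) /\<^sub>R t)"
      unfolding eventually_at_filter
    proof (intro always_eventually allI impI)
      fix t :: real assume t: "t \<noteq> 0"
      let ?d = "S (x + t *\<^sub>R v) - S x"
      have "(norm ?d)\<^sup>2 \<le> t * (v \<bullet> ?d)" using firm[of "x + t *\<^sub>R v" x] by simp
      then have "inverse t ^ 2 * (norm ?d)\<^sup>2 \<le> inverse t ^ 2 * (t * (v \<bullet> ?d))" by (intro mult_left_mono) auto
      moreover have w: "inverse t ^ 2 * (t * (v \<bullet> ?d)) = inverse t * (v \<bullet> ?d)"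
        using t by (simp add: power2_eq_square)
      ultimately show "(norm (?d /\<^sub>R t))\<^sup>2 \<le> v \<bullet> (?d /\<^sub>R t)"
        unfolding norm_scaleR power_mult_distrib inner_scaleR_right power2_abs by (simp only: w)
    qed
  qed simp
qed

text \<open>Summing the hypothesis over the standard basis bounds the squared Frobenius norm by the
  trace. Hence the trace is nonnegative, and it is nearly 1 or more as soon as \<open>A\<close>
  almost fixes one nonzero vector, however it acts transversally.\<close>

lemma trace_firmly_nonexpansive:
  fixes A :: "real ^ 'n ^ 'n"
  assumes firm: "\<And>v. (norm (A *v v))\<^sup>2 \<le> v \<bullet> (A *v v)"
  shows "norm (A $ i) \<le> 1" and "(norm A)\<^sup>2 \<le> trace A"
    and "(e \<bullet> (A *v e))\<^sup>2 \<le> trace A * (e \<bullet> e)\<^sup>2"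
proof -
  have n1: "norm (A *v v) \<le> norm v" for v
  proof -
    have "norm (A *v v) * norm (A *v v) \<le> norm v * norm (A *v v)"
      using firm[of v] norm_cauchy_schwarz[of v "A *v v"] by (simp add: power2_eq_square)
    then show ?thesis by (cases "norm (A *v v) = 0") (simp_all add: mult_le_cancel_right)
  qed
  show "norm (A $ i) \<le> 1"
  proof -
    have "norm (A $ i) * norm (A $ i) = (A *v (A $ i)) $ i"
      by (simp add: matrix_vector_mul_component power2_norm_eq_inner[symmetric] power2_eq_square)
    also have "\<dots> \<le> norm (A *v (A $ i))" using component_le_norm_cart[of "A *v (A $ i)" i] by simp
    also have "\<dots> \<le> 1 * norm (A $ i)" using n1 by simp
    finally show ?thesis by (cases "norm (A $ i) = 0") (simp_all add: mult_le_cancel_right)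
  qed
  have "(norm A)\<^sup>2 = (\<Sum>i\<in>UNIV. \<Sum>j\<in>UNIV. (A $ i $ j)\<^sup>2)"
    unfolding power2_norm_eq_inner inner_vec_def by (simp add: power2_eq_square)
  also have "\<dots> = (\<Sum>j\<in>UNIV. \<Sum>i\<in>UNIV. (A $ i $ j)\<^sup>2)" by (rule sum.swap)
  also have "\<dots> \<le> (\<Sum>j\<in>UNIV. A $ j $ j)"
  proof (rule sum_mono)
    fix j
    show "(\<Sum>i\<in>UNIV. (A $ i $ j)\<^sup>2) \<le> A $ j $ j"
      using firm[of "axis j 1"]
      by (simp add: power2_norm_eq_inner inner_axis' matrix_vector_mult_basis column_def)
         (simp add: inner_vec_def power2_eq_square)
  qed
  finally show tr: "(norm A)\<^sup>2 \<le> trace A" by (simp add: trace_def)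
  have le: "norm (A *v e) \<le> norm A * norm e"
  proof -
    have "(norm (A *v e))\<^sup>2 = (\<Sum>i\<in>UNIV. (A $ i \<bullet> e)\<^sup>2)"
      unfolding power2_norm_eq_inner inner_vec_def[of "A *v e"] by (simp add: matrix_vector_mul_component power2_eq_square)
    also have "\<dots> \<le> (\<Sum>i\<in>UNIV. (norm (A $ i) * norm e)\<^sup>2)"
      by (intro sum_mono abs_le_square_iff[THEN iffD1]) (use Cauchy_Schwarz_ineq2 in force)
    also have "\<dots> = (norm A * norm e)\<^sup>2"
      by (simp add: power_mult_distrib power2_norm_eq_inner inner_vec_def[of A] sum_distrib_right)
    finally show ?thesis by (rule power2_le_imp_le) simp
  qed
  have "\<bar>e \<bullet> (A *v e)\<bar> \<le> norm e * (norm A * norm e)"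
    using Cauchy_Schwarz_ineq2[of e "A *v e"] mult_left_mono[OF le, of "norm e"] by simp
  then have "(e \<bullet> (A *v e))\<^sup>2 \<le> (norm e * (norm A * norm e))\<^sup>2"
    by (intro abs_le_square_iff[THEN iffD1]) simp
  also have "\<dots> = (norm A)\<^sup>2 * (e \<bullet> e)\<^sup>2"
    by (simp add: power_mult_distrib flip: power2_norm_eq_inner)
  also have "\<dots> \<le> trace A * (e \<bullet> e)\<^sup>2" using tr by (intro mult_right_mono) auto
  finally show "(e \<bullet> (A *v e))\<^sup>2 \<le> trace A * (e \<bullet> e)\<^sup>2" .
qed

lemma continuous_mollify_mat:
  fixes T :: "real ^ 'n \<Rightarrow> real ^ 'n"
  assumes "continuous_on UNIV T" "0 < e"
  shows "continuous_on UNIV (mollify_mat e T)"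
  unfolding mollify_mat_def using assms by (intro continuous_intros continuous_mollify_grad)

text \<open>From \<open>e \<bullet> T\<close> subtract the affine function with gradient
  \<open>e\<close> and the same value at \<open>x\<close>. The rest is quadratically small near
  \<open>x\<close> by \<open>translating_second_order\<close>; the mollified gradient costs a factor
  \<open>1 / r\<close>, so an error of order \<open>r\<close> remains.\<close>

lemma mollify_mat_direction:
  fixes T :: "real ^ 'n \<Rightarrow> real ^ 'n"
  assumes T: "continuous_on UNIV T" and nonexp: "\<And>x y. norm (T x - T y) \<le> norm (x - y)"
    and e: "T (x + e) = T x + e" "T (x - e) = T x - e"
  shows "((\<lambda>r. e \<bullet> (mollify_mat r T x *v e)) \<longlongrightarrow> e \<bullet> e) (at_right 0)"
proof -
  obtain C where "0 \<le> C" and C: "\<forall>r>0. \<forall>f. \<forall>x::real^'n. \<forall>M. continuous_on UNIV f \<longrightarrow> (\<forall>z. norm z \<le> r \<longrightarrow> \<bar>f (x + z)\<bar> \<le> M)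
      \<longrightarrow> norm (mollify_grad r f x) \<le> C * M / r" using mollify_grad_bound by blast
  have est: "\<bar>e \<bullet> (mollify_mat r T x *v e) - e \<bullet> e\<bar> \<le> C * r / 2 * norm e" if r: "0 < r" for r
  proof -
    let ?s = "\<lambda>y. 1 * (e \<bullet> T y) + (-1) * (e \<bullet> y + (e \<bullet> T x - e \<bullet> x))"
    have "mollify_grad r ?s x = 1 *\<^sub>R mollify_grad r (\<lambda>y. e \<bullet> T y) x + (-1) *\<^sub>R mollify_grad r (\<lambda>y. e \<bullet> y + (e \<bullet> T x - e \<bullet> x)) x"
      using T r by (intro mollify_linear(2) continuous_intros)
    then have g: "mollify_grad r ?s x = mollify_grad r (\<lambda>y. e \<bullet> T y) x - e"
      using mollify_grad_affine[OF r, of e "e \<bullet> T x - e \<bullet> x" x] by simp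
    have "norm (mollify_grad r ?s x) \<le> C * (r\<^sup>2 / 2) / r"
    proof (rule C[rule_format, OF r])
      show "continuous_on UNIV ?s" using T by (intro continuous_intros)
      fix z :: "real ^ 'n" assume z: "norm z \<le> r"
      have "\<bar>(T (x + z) - T x - z) \<bullet> e\<bar> \<le> (norm z)\<^sup>2 / 2" by (rule translating_second_order[OF nonexp e])
      also have "\<dots> \<le> r\<^sup>2 / 2" using z by (simp add: power_mono)
      finally show "\<bar>?s (x + z)\<bar> \<le> r\<^sup>2 / 2" by (simp add: algebra_simps inner_commute)
    qed
    then have n: "norm (mollify_grad r ?s x) \<le> C * r / 2" using r by (simp add: power2_eq_square)
    have "e \<bullet> (mollify_mat r T x *v e) - e \<bullet> e = mollify_grad r ?s x \<bullet> e"
      unfolding g using mollify_vec_inner(2)[OF T r] by (simp add: inner_diff_left)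
    then have "\<bar>e \<bullet> (mollify_mat r T x *v e) - e \<bullet> e\<bar> \<le> norm (mollify_grad r ?s x) * norm e"
      using Cauchy_Schwarz_ineq2[of "mollify_grad r ?s x" e] by simp
    also have "\<dots> \<le> C * r / 2 * norm e" using n by (rule mult_right_mono) simp
    finally show ?thesis .
  qed
  have "((\<lambda>r. e \<bullet> (mollify_mat r T x *v e) - e \<bullet> e) \<longlongrightarrow> 0) (at_right 0)"
  proof (rule Lim_null_comparison)
    show "\<forall>\<^sub>F r in at_right 0. norm (e \<bullet> (mollify_mat r T x *v e) - e \<bullet> e) \<le> C * r / 2 * norm e"
      using est by (auto simp: eventually_at_filter)
    show "((\<lambda>r. C * r / 2 * norm e) \<longlongrightarrow> 0) (at_right 0)"
      by (auto intro!: tendsto_eq_intros)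
  qed
  then show ?thesis by (simp add: LIM_zero_iff)
qed

text \<open>\<open>G\<close> is carried along as the Jacobian matrix of \<open>H\<close>. Every
  condition is preserved by averaging two pairs, and the set grows with \<open>d\<close>. The
  normalisation \<open>H 0 = 0\<close> serves the composition axioms, which require functions
  vanishing at 0.\<close>

definition gradient_fields :: "(real ^ 'n) measure \<Rightarrow> real \<Rightarrow> real \<Rightarrow> ((real ^ 'n \<Rightarrow> real ^ 'n) \<times> (real ^ 'n \<Rightarrow> real ^ 'n ^ 'n)) set" where
  "gradient_fields \<nu> c d = {(H, G). H 0 = 0 \<and> (\<forall>x i. \<bar>H x $ i\<bar> \<le> d) \<and>
     (\<forall>x i. ((\<lambda>x. H x $ i) has_derivative (\<lambda>v. G x $ i \<bullet> v)) (at x)) \<and> continuous_on UNIV G \<and>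
     (\<forall>x i. norm (G x $ i) \<le> 1) \<and> c \<le> (\<integral>x. trace (G x) \<partial>\<nu>)}"

text \<open>The translating map is mollified at radii tending to 0. The traces are nonnegative with
  lower limit at least 1 almost everywhere, so by Fatou's lemma some radius reaches half of the
  total mass.\<close>

theorem smooth_field_with_large_divergence:
  fixes \<nu> :: "(real ^ 'n) measure"
  assumes fin: "finite_measure \<nu>" and sets: "sets \<nu> = sets borel" and "compact K" and "negligible K"
    and "AE x in \<nu>. x \<in> K" and "0 < d"
  shows "gradient_fields \<nu> (measure \<nu> UNIV / 2) d \<noteq> {}"
proof -
  \<comment> \<open>The bound is \<open>d / 2\<close> because subtracting the value at 0, done at
    the end, may double it.\<close>
  obtain T :: "real ^ 'n \<Rightarrow> real ^ 'n" where T: "\<And>x. norm (T x) \<le> d / 2"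
    "\<And>x y. (norm (T x - T y))\<^sup>2 \<le> (x - y) \<bullet> (T x - T y)"
    "AE x in \<nu>. \<exists>e. e \<noteq> 0 \<and> T (x + e) = T x + e \<and> T (x - e) = T x - e"
    using firmly_nonexpansive_translating_AE[OF assms(1-5), of "d / 2"] assms(6) by auto
  note nonexp = firmly_nonexpansive_nonexpansive[OF T(2)]
  have contT: "continuous_on UNIV T"
    by (rule lipschitz_on_continuous_on[of 1], rule lipschitz_onI) (use nonexp in \<open>auto simp: dist_norm\<close>)
  define r where "r k = 1 / real (Suc k)" for k
  have r: "0 < r k" for k by (simp add: r_def)
  define G where "G k = mollify_mat (r k) T" for k
  have contG: "continuous_on UNIV (G k)" for k unfolding G_def by (rule continuous_mollify_mat[OF contT r])
  have der: "(mollify_vec (r k) T has_derivative (\<lambda>v. G k x *v v)) (at x)" for k x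
    unfolding G_def by (rule has_derivative_mollify_vec[OF contT r])
  have firmG: "(norm (G k x *v v))\<^sup>2 \<le> v \<bullet> (G k x *v v)" for k x v
    by (rule firmly_nonexpansive_derivative[OF mollify_vec_firmly_nonexpansive[OF contT r T(2)] der])
  note tr = trace_firmly_nonexpansive[OF firmG]
  have tr0: "0 \<le> trace (G k x)" for k x using tr(2)[of k x] zero_le_power2 order_trans by blast
  have trn: "trace (G k x) \<le> real CARD('n)" for k x
  proof -
    have "trace (G k x) \<le> (\<Sum>i\<in>(UNIV :: 'n set). 1)" unfolding trace_def
    proof (rule sum_mono)
      fix i :: 'n
      show "G k x $ i $ i \<le> 1" using component_le_norm_cart[of "G k x $ i" i] tr(1)[of k x i] by linarith
    qed
    then show ?thesis by simp
  qed
  have meas: "(\<lambda>x. trace (G k x)) \<in> borel_measurable \<nu>" for k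
  proof -
    have "continuous_on UNIV (\<lambda>x. trace (G k x))" unfolding trace_def using contG by (intro continuous_intros)
    then show ?thesis using borel_measurable_continuous_onI sets by (metis measurable_cong_sets)
  qed
  have int: "integrable \<nu> (\<lambda>x. trace (G k x))" for k
    using tr0 trn meas by (intro finite_measure.integrable_const_bound[OF fin, of _ "real CARD('n)"]) auto
  have lim1: "AE x in \<nu>. 1 \<le> liminf (\<lambda>k. ennreal (trace (G k x)))"
    using T(3)
  proof eventually_elim
    fix x assume "\<exists>e. e \<noteq> 0 \<and> T (x + e) = T x + e \<and> T (x - e) = T x - e"
    then obtain e where e: "e \<noteq> 0" "T (x + e) = T x + e" "T (x - e) = T x - e" by blast
    have "filterlim r (at_right 0) sequentially"
      unfolding filterlim_at r_def
      using LIMSEQ_inverse_real_of_nat by (auto simp: divide_inverse simp del: of_nat_Suc)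
    from filterlim_compose[OF mollify_mat_direction[OF contT nonexp e(2,3)] this]
    have "(\<lambda>k. e \<bullet> (G k x *v e)) \<longlonglongrightarrow> e \<bullet> e" unfolding G_def .
    then have "(\<lambda>k. (e \<bullet> (G k x *v e))\<^sup>2 / (e \<bullet> e)\<^sup>2) \<longlonglongrightarrow> (e \<bullet> e)\<^sup>2 / (e \<bullet> e)\<^sup>2"
      using e(1) by (intro tendsto_divide tendsto_power tendsto_const) auto
    then have l: "(\<lambda>k. ennreal ((e \<bullet> (G k x *v e))\<^sup>2 / (e \<bullet> e)\<^sup>2)) \<longlonglongrightarrow> ennreal 1"
      using e(1) by (intro tendsto_ennrealI) auto
    have "1 = liminf (\<lambda>k. ennreal ((e \<bullet> (G k x *v e))\<^sup>2 / (e \<bullet> e)\<^sup>2))"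
      using lim_imp_Liminf[OF _ l] by simp
    also have "\<dots> \<le> liminf (\<lambda>k. ennreal (trace (G k x)))"
      using tr(3)[of e _ x] e(1)
      by (intro Liminf_mono always_eventually allI ennreal_leI) (simp add: pos_divide_le_eq)
    finally show "1 \<le> liminf (\<lambda>k. ennreal (trace (G k x)))" .
  qed
  have sp: "space \<nu> = UNIV" using sets_eq_imp_space_eq[OF sets] by simp
  have "\<exists>k. measure \<nu> UNIV / 2 \<le> (\<integral>x. trace (G k x) \<partial>\<nu>)"
  proof (rule ccontr)
    assume "\<not> ?thesis"
    then have lt: "(\<integral>x. trace (G k x) \<partial>\<nu>) < measure \<nu> UNIV / 2" for k by (simp add: not_le)
    have "0 \<le> (\<integral>x. trace (G 0 x) \<partial>\<nu>)" using tr0 by simp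
    then have pos: "0 < measure \<nu> UNIV" using lt[of 0] by linarith
    have "ennreal (measure \<nu> UNIV) = (\<integral>\<^sup>+x. 1 \<partial>\<nu>)"
      using sp finite_measure.emeasure_eq_measure[OF fin] by simp
    also have "\<dots> \<le> (\<integral>\<^sup>+x. liminf (\<lambda>k. ennreal (trace (G k x))) \<partial>\<nu>)"
      by (rule nn_integral_mono_AE[OF lim1])
    also have "\<dots> \<le> liminf (\<lambda>k. \<integral>\<^sup>+x. ennreal (trace (G k x)) \<partial>\<nu>)"
      by (rule nn_integral_liminf) (use meas in measurable)
    also have "\<dots> \<le> ennreal (measure \<nu> UNIV / 2)"
    proof -
      have "(\<integral>\<^sup>+x. ennreal (trace (G k x)) \<partial>\<nu>) \<le> ennreal (measure \<nu> UNIV / 2)" for k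
        using lt[of k] tr0 by (subst nn_integral_eq_integral[OF int]) (auto intro: ennreal_leI)
      then show ?thesis by (intro Liminf_le) auto
    qed
    finally show False using pos by (simp add: ennreal_le_iff)
  qed
  then obtain k where k: "measure \<nu> UNIV / 2 \<le> (\<integral>x. trace (G k x) \<partial>\<nu>)" by blast
  define S where "S = mollify_vec (r k) T"
  have Sb: "\<bar>S x $ i\<bar> \<le> d / 2" for x i
  proof -
    have c: "continuous_on UNIV (\<lambda>y. T y $ i)" using contT by (intro continuous_intros)
    have b: "\<bar>T y $ i\<bar> \<le> d / 2" for y using component_le_norm_cart[of "T y" i] T(1)[of y] by linarith
    have "mollify (r k) (\<lambda>y. T y $ i) x \<le> d / 2"
      by (rule mollify_bound[OF c r]) (use b abs_le_iff in blast)
    moreover have "mollify (r k) (\<lambda>y. (-1) * T y $ i + 0 * T y $ i) x \<le> d / 2"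
    proof (rule mollify_bound[OF _ r])
      show "continuous_on UNIV (\<lambda>y. (-1) * T y $ i + 0 * T y $ i)" using contT by (intro continuous_intros)
      show "(-1) * T y $ i + 0 * T y $ i \<le> d / 2" for y using b[of y] by linarith
    qed
    then have "- mollify (r k) (\<lambda>y. T y $ i) x \<le> d / 2"
      using mollify_linear(1)[OF c c r, of k "-1" 0 x] by simp
    ultimately show ?thesis by (simp add: S_def mollify_vec_def abs_le_iff)
  qed
  have "(\<lambda>x. S x - S 0, G k) \<in> gradient_fields \<nu> (measure \<nu> UNIV / 2) d"
    unfolding gradient_fields_def mem_Collect_eq case_prod_conv
  proof (intro conjI allI)
    show "S 0 - S 0 = 0" by simp
    show "\<bar>(S x - S 0) $ i\<bar> \<le> d" for x i
      using Sb[of x i] Sb[of 0 i] by (simp add: abs_le_iff) linarith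
    show "((\<lambda>x. (S x - S 0) $ i) has_derivative (\<lambda>v. G k x $ i \<bullet> v)) (at x)" for x i
    proof -
      have "((\<lambda>x. S x $ i) has_derivative (\<lambda>v. (G k x *v v) $ i)) (at x)"
        using bounded_linear.has_derivative[OF bounded_linear_vec_nth der[of k x], of i] by (simp add: S_def)
      then have "((\<lambda>x. S x $ i - S 0 $ i) has_derivative (\<lambda>v. (G k x *v v) $ i - 0)) (at x)"
        by (intro has_derivative_diff has_derivative_const)
      then show ?thesis by (simp add: matrix_vector_mul_component)
    qed
    show "continuous_on UNIV (G k)" by (rule contG)
    show "norm (G k x $ i) \<le> 1" for x i by (rule tr(1))
    show "measure \<nu> UNIV / 2 \<le> (\<integral>x. trace (G k x) \<partial>\<nu>)" by (rule k)
  qed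
  then show ?thesis by blast
qed

section \<open>Calculus in p-Dirichlet spaces\<close>

lemma sum_powr_le:
  fixes a :: "'i \<Rightarrow> real"
  assumes "finite I" "\<And>i. i \<in> I \<Longrightarrow> 0 \<le> a i" "0 \<le> p"
  shows "(\<Sum>i\<in>I. a i) powr p \<le> real (card I) powr p * (\<Sum>i\<in>I. a i powr p)"
proof (cases "I = {}")
  case False
  obtain j where j: "j \<in> I" "\<And>i. i \<in> I \<Longrightarrow> a i \<le> a j"
    using Max_in[of "a ` I"] Max_ge[of "a ` I"] assms(1) False by (metis (no_types, lifting) finite_imageI image_iff image_is_empty)
  have "(\<Sum>i\<in>I. a i) \<le> real (card I) * a j" using sum_bounded_above[of I a "a j"] j by auto
  then have "(\<Sum>i\<in>I. a i) powr p \<le> (real (card I) * a j) powr p"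
    using assms by (intro powr_mono2) (auto intro: sum_nonneg)
  also have "\<dots> = real (card I) powr p * a j powr p" using assms j by (simp add: powr_mult)
  also have "\<dots> \<le> real (card I) powr p * (\<Sum>i\<in>I. a i powr p)"
    using assms j by (intro mult_left_mono member_le_sum) auto
  finally show ?thesis .
qed simp

locale p_dirichlet = local_p_dirichlet_space p \<mu> E F \<Gamma>
  for p and \<mu> :: "'a::metric_space measure" and E F \<Gamma> +
  assumes p_gt_1: "1 < p"
begin

text \<open>The \<open>p\<close>-th root, and not the measure itself, satisfies the triangle
  inequality; for each Borel set \<open>B\<close> it is a seminorm in \<open>f\<close> on
  \<open>F\<close>.\<close>

definition gam :: "('a \<Rightarrow> real) \<Rightarrow> 'a set \<Rightarrow> real" where
  "gam f B = measure (\<Gamma> f) B powr (1 / p)"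

definition lpint :: "('a \<Rightarrow> real) \<Rightarrow> real" where
  "lpint f = (\<integral>x. \<bar>f x\<bar> powr p \<partial>completion \<mu>)"

lemma gam_nonneg [simp]: "0 \<le> gam f B" by (simp add: gam_def)

lemma gam_powr: "gam f B powr p = measure (\<Gamma> f) B"
  using p_gt_1 by (simp add: gam_def powr_powr)

lemma gam_le_iff: "0 \<le> c \<Longrightarrow> gam f B \<le> c \<longleftrightarrow> measure (\<Gamma> f) B \<le> c powr p"
proof
  assume "0 \<le> c" "gam f B \<le> c"
  then have "gam f B powr p \<le> c powr p" using p_gt_1 by (intro powr_mono2) auto
  then show "measure (\<Gamma> f) B \<le> c powr p" by (simp add: gam_powr)
next
  assume c: "0 \<le> c" and "measure (\<Gamma> f) B \<le> c powr p"
  then have "measure (\<Gamma> f) B powr (1 / p) \<le> (c powr p) powr (1 / p)" using p_gt_1 by (intro powr_mono2) auto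
  then show "gam f B \<le> c" using c p_gt_1 by (simp add: gam_def powr_powr)
qed

lemma gam_mono:
  assumes "f \<in> F" "B \<subseteq> C" "C \<in> sets borel"
  shows "gam f B \<le> gam f C" "measure (\<Gamma> f) B \<le> measure (\<Gamma> f) C"
proof -
  interpret finite_measure "\<Gamma> f" by (rule finite_\<Gamma>[OF assms(1)])
  show "measure (\<Gamma> f) B \<le> measure (\<Gamma> f) C"
    using assms sets_\<Gamma>[OF assms(1)] by (intro finite_measure_mono) auto
  then show "gam f B \<le> gam f C" unfolding gam_def using p_gt_1 by (intro powr_mono2) auto
qed

lemma E_eq: "f \<in> F \<Longrightarrow> E f = gam f UNIV powr p"
  using \<Gamma>_total by (simp add: gam_powr)

lemma gam_add: "f \<in> F \<Longrightarrow> g \<in> F \<Longrightarrow> B \<in> sets borel \<Longrightarrow> gam (\<lambda>x. f x + g x) B \<le> gam f B + gam g B"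
  unfolding gam_def by (rule \<Gamma>_triangle)

lemma gam_scale: "f \<in> F \<Longrightarrow> B \<in> sets borel \<Longrightarrow> gam (\<lambda>x. c * f x) B = \<bar>c\<bar> * gam f B"
  unfolding gam_def using p_gt_1 by (simp add: \<Gamma>_scale powr_mult powr_powr)

lemma uminus_mem: "f \<in> F \<Longrightarrow> (\<lambda>x. - f x) \<in> F"
  using scale_mem[of f "-1"] by simp

lemma gam_uminus: "f \<in> F \<Longrightarrow> B \<in> sets borel \<Longrightarrow> gam (\<lambda>x. - f x) B = gam f B"
  using gam_scale[of f B "-1"] by simp

lemma diff_mem: "f \<in> F \<Longrightarrow> g \<in> F \<Longrightarrow> (\<lambda>x. f x - g x) \<in> F"
  using add_mem[of f "\<lambda>x. - g x"] uminus_mem[of g] by simp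

lemma gam_diff: "f \<in> F \<Longrightarrow> g \<in> F \<Longrightarrow> B \<in> sets borel \<Longrightarrow> gam (\<lambda>x. f x - g x) B \<le> gam f B + gam g B"
  using gam_add[of f "\<lambda>x. - g x" B] by (simp add: uminus_mem gam_uminus)

lemma gam_zero: "B \<in> sets borel \<Longrightarrow> gam (\<lambda>x. 0) B = 0"
  using gam_scale[OF zero_mem, of B 0] by simp

lemma sum_mem: "finite I \<Longrightarrow> (\<And>i. i \<in> I \<Longrightarrow> f i \<in> F) \<Longrightarrow> (\<lambda>x. \<Sum>i\<in>I. f i x) \<in> F"
  by (induction I rule: finite_induct) (auto intro: zero_mem add_mem)

lemma gam_sum:
  assumes "finite I" "\<And>i. i \<in> I \<Longrightarrow> f i \<in> F" "B \<in> sets borel"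
  shows "gam (\<lambda>x. \<Sum>i\<in>I. f i x) B \<le> (\<Sum>i\<in>I. gam (f i) B)"
  using assms(1,2)
proof (induction I rule: finite_induct)
  case empty
  then show ?case using gam_zero[OF assms(3)] by simp
next
  case (insert j I)
  have "gam (\<lambda>x. f j x + (\<Sum>i\<in>I. f i x)) B \<le> gam (f j) B + gam (\<lambda>x. \<Sum>i\<in>I. f i x) B"
    using insert assms(3) by (intro gam_add sum_mem) auto
  then show ?case using insert by simp
qed

lemma lip_mem: "f \<in> F \<Longrightarrow> L-lipschitz_on UNIV g \<Longrightarrow> g 0 = 0 \<Longrightarrow> (\<lambda>x. g (f x)) \<in> F"
  using lipschitz_mem[of f g] by (auto simp: o_def)

lemma gam_lip:
  assumes "f \<in> F" "L-lipschitz_on UNIV g" "g 0 = 0" "B \<in> sets borel"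
  shows "gam (\<lambda>x. g (f x)) B \<le> L * gam f B"
proof -
  have L: "0 \<le> L" using assms(2) by (rule lipschitz_on_nonneg)
  have bdd: "bdd_below {L. L-lipschitz_on UNIV g}" by (auto intro!: bdd_belowI[of _ 0] lipschitz_on_nonneg)
  have le: "LIP g \<le> L" unfolding LIP_def using bdd assms(2) by (intro cInf_lower) auto
  have ge: "0 \<le> LIP g" unfolding LIP_def using assms(2) by (intro cInf_greatest) (auto intro: lipschitz_on_nonneg)
  have "measure (\<Gamma> (g \<circ> f)) B \<le> LIP g powr p * measure (\<Gamma> f) B" using assms by (intro \<Gamma>_lipschitz) auto
  also have "\<dots> \<le> L powr p * measure (\<Gamma> f) B" using le ge p_gt_1 by (intro mult_right_mono powr_mono2) auto
  also have "\<dots> = (L * gam f B) powr p" using L by (simp add: powr_mult gam_powr)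
  finally have "gam (g \<circ> f) B \<le> L * gam f B" using L by (subst gam_le_iff) auto
  then show ?thesis by (simp add: o_def)
qed

lemma lpint_nonneg [simp]: "0 \<le> lpint f" by (simp add: lpint_def)

lemma Lp_norm_eq: "Lp_norm p \<mu> f = lpint f powr (1 / p)" by (simp add: Lp_norm_def lpint_def)

lemma Lp_norm_powr: "Lp_norm p \<mu> f powr p = lpint f"
  using p_gt_1 by (simp add: Lp_norm_eq powr_powr)

lemma Lp_meas: "f \<in> Lp_space p \<mu> \<Longrightarrow> f \<in> borel_measurable (completion \<mu>)"
  and Lp_int: "f \<in> Lp_space p \<mu> \<Longrightarrow> integrable (completion \<mu>) (\<lambda>x. \<bar>f x\<bar> powr p)"
  by (auto simp: Lp_space_def)

lemma F_Lp: "f \<in> F \<Longrightarrow> f \<in> Lp_space p \<mu>" using subset_Lp by blast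

lemma Lp_bounded:
  assumes w: "w \<in> Lp_space p \<mu>" and f: "f \<in> borel_measurable (completion \<mu>)" and le: "\<And>x. \<bar>f x\<bar> \<le> C * \<bar>w x\<bar>"
  shows "f \<in> Lp_space p \<mu>"
  unfolding Lp_space_def
proof (intro CollectI conjI f)
  show "integrable (completion \<mu>) (\<lambda>x. \<bar>f x\<bar> powr p)"
  proof (rule Bochner_Integration.integrable_bound)
    show "integrable (completion \<mu>) (\<lambda>x. \<bar>C\<bar> powr p * \<bar>w x\<bar> powr p)" using Lp_int[OF w] by simp
    show "(\<lambda>x. \<bar>f x\<bar> powr p) \<in> borel_measurable (completion \<mu>)" using f by measurable
    have "\<bar>f x\<bar> powr p \<le> \<bar>C\<bar> powr p * \<bar>w x\<bar> powr p" for x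
    proof -
      have "\<bar>f x\<bar> \<le> \<bar>C\<bar> * \<bar>w x\<bar>" using le[of x] by (meson abs_ge_self abs_ge_zero mult_right_mono order_trans)
      then have "\<bar>f x\<bar> powr p \<le> (\<bar>C\<bar> * \<bar>w x\<bar>) powr p" using p_gt_1 by (intro powr_mono2) auto
      then show ?thesis by (simp add: powr_mult)
    qed
    then show "AE x in completion \<mu>. norm (\<bar>f x\<bar> powr p) \<le> norm (\<bar>C\<bar> powr p * \<bar>w x\<bar> powr p)" by simp
  qed
qed

lemma lpint_mono:
  assumes "g \<in> Lp_space p \<mu>" "f \<in> borel_measurable (completion \<mu>)" "\<And>x. \<bar>f x\<bar> \<le> \<bar>g x\<bar>"
  shows "lpint f \<le> lpint g"
  unfolding lpint_def
proof (rule integral_mono)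
  show "integrable (completion \<mu>) (\<lambda>x. \<bar>f x\<bar> powr p)"
    by (rule Lp_int[OF Lp_bounded[of g f 1]]) (use assms in auto)
  show "\<bar>f x\<bar> powr p \<le> \<bar>g x\<bar> powr p" for x using assms(3) p_gt_1 by (intro powr_mono2) auto
qed (rule Lp_int[OF assms(1)])

lemma lpint_scale: "lpint (\<lambda>x. c * f x) = \<bar>c\<bar> powr p * lpint f"
  by (simp add: lpint_def abs_mult powr_mult)

lemma lpint_sum:
  assumes "finite I" "\<And>i. i \<in> I \<Longrightarrow> f i \<in> Lp_space p \<mu>" "(\<lambda>x. \<Sum>i\<in>I. f i x) \<in> Lp_space p \<mu>"
  shows "lpint (\<lambda>x. \<Sum>i\<in>I. f i x) \<le> real (card I) powr p * (\<Sum>i\<in>I. lpint (f i))"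
proof -
  have "lpint (\<lambda>x. \<Sum>i\<in>I. f i x) \<le> (\<integral>x. real (card I) powr p * (\<Sum>i\<in>I. \<bar>f i x\<bar> powr p) \<partial>completion \<mu>)"
    unfolding lpint_def
  proof (rule integral_mono)
    show "integrable (completion \<mu>) (\<lambda>x. real (card I) powr p * (\<Sum>i\<in>I. \<bar>f i x\<bar> powr p))"
      using assms by (intro integrable_mult_right Bochner_Integration.integrable_sum Lp_int) auto
    fix x
    have "\<bar>\<Sum>i\<in>I. f i x\<bar> powr p \<le> (\<Sum>i\<in>I. \<bar>f i x\<bar>) powr p" using p_gt_1 by (intro powr_mono2 sum_abs) auto
    also have "\<dots> \<le> real (card I) powr p * (\<Sum>i\<in>I. \<bar>f i x\<bar> powr p)" using p_gt_1 assms by (intro sum_powr_le) auto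
    finally show "\<bar>\<Sum>i\<in>I. f i x\<bar> powr p \<le> real (card I) powr p * (\<Sum>i\<in>I. \<bar>f i x\<bar> powr p)" .
  qed (rule Lp_int[OF assms(3)])
  also have "\<dots> = real (card I) powr p * (\<Sum>i\<in>I. lpint (f i))"
    unfolding lpint_def using assms by (subst integral_mult_right_zero, subst Bochner_Integration.integral_sum) (auto intro: Lp_int)
  finally show ?thesis .
qed

lemma lpint_add:
  assumes "f \<in> Lp_space p \<mu>" "g \<in> Lp_space p \<mu>" "(\<lambda>x. f x + g x) \<in> Lp_space p \<mu>"
  shows "lpint (\<lambda>x. f x + g x) \<le> 2 powr p * (lpint f + lpint g)"
  using lpint_sum[of "{False, True}" "\<lambda>i. if i then f else g"] assms by (auto simp: add.commute cong: if_cong)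

lemma lpint_dominated:
  assumes w: "w \<in> Lp_space p \<mu>" and u: "\<And>i. u i \<in> borel_measurable (completion \<mu>)"
    and f: "f \<in> borel_measurable (completion \<mu>)"
    and bd: "\<And>i x. \<bar>u i x - f x\<bar> \<le> C * \<bar>w x\<bar>" and lim: "\<And>x. (\<lambda>i. u i x) \<longlonglongrightarrow> f x"
  shows "(\<lambda>i. lpint (\<lambda>x. u i x - f x)) \<longlonglongrightarrow> 0"
proof -
  have "(\<lambda>i. lpint (\<lambda>x. u i x - f x)) \<longlonglongrightarrow> (\<integral>x. 0 \<partial>completion \<mu>)"
    unfolding lpint_def
  proof (rule integral_dominated_convergence[where w = "\<lambda>x. \<bar>C\<bar> powr p * \<bar>w x\<bar> powr p"])
    show "integrable (completion \<mu>) (\<lambda>x. \<bar>C\<bar> powr p * \<bar>w x\<bar> powr p)" using Lp_int[OF w] by simp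
    show "(\<lambda>x. \<bar>u i x - f x\<bar> powr p) \<in> borel_measurable (completion \<mu>)" for i using u f by measurable
    have "(\<lambda>i. \<bar>u i x - f x\<bar> powr p) \<longlonglongrightarrow> 0" for x
    proof (rule tendsto_zero_powrI)
      show "(\<lambda>i. \<bar>u i x - f x\<bar>) \<longlonglongrightarrow> 0" using lim[of x] by (intro tendsto_rabs_zero) (simp add: LIM_zero_iff)
      show "(\<lambda>i. p) \<longlonglongrightarrow> p" by simp
    qed (use p_gt_1 in auto)
    then show "AE x in completion \<mu>. (\<lambda>i. \<bar>u i x - f x\<bar> powr p) \<longlonglongrightarrow> 0" by simp
    fix i
    have "\<bar>u i x - f x\<bar> powr p \<le> \<bar>C\<bar> powr p * \<bar>w x\<bar> powr p" for x
    proof -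
      have "\<bar>u i x - f x\<bar> \<le> \<bar>C\<bar> * \<bar>w x\<bar>" using bd[of i x] by (meson abs_ge_self abs_ge_zero mult_right_mono order_trans)
      then have "\<bar>u i x - f x\<bar> powr p \<le> (\<bar>C\<bar> * \<bar>w x\<bar>) powr p" using p_gt_1 by (intro powr_mono2) auto
      then show ?thesis by (simp add: powr_mult)
    qed
    then show "AE x in completion \<mu>. norm (\<bar>u i x - f x\<bar> powr p) \<le> \<bar>C\<bar> powr p * \<bar>w x\<bar> powr p" by simp
  qed simp
  then show ?thesis by simp
qed

lemma Lp_norm_tendsto:
  assumes "(\<lambda>i. lpint (u i)) \<longlonglongrightarrow> 0"
  shows "(\<lambda>i. Lp_norm p \<mu> (u i)) \<longlonglongrightarrow> 0"
  unfolding Lp_norm_eq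
  by (rule tendsto_zero_powrI[OF assms, of "\<lambda>_. 1 / p" "1 / p"]) (use p_gt_1 in auto)

lemma limit_mem':
  assumes "f \<in> Lp_space p \<mu>" "\<And>i. u i \<in> F" "(\<lambda>i. lpint (\<lambda>x. u i x - f x)) \<longlonglongrightarrow> 0" "\<And>i. gam (u i) UNIV \<le> C"
  shows "f \<in> F"
  using assms p_gt_1 by (intro limit_mem[of f u "C powr p"] Lp_norm_tendsto) (auto simp: E_eq intro!: powr_mono2)

text \<open>Lower semicontinuity in the form used below: not the energies on \<open>B\<close> but
  upper bounds for them have to converge.\<close>

lemma Gamma_limit_le:
  assumes f: "f \<in> F" and u: "\<And>i. u i \<in> F" and lim: "(\<lambda>i. lpint (\<lambda>x. u i x - f x)) \<longlonglongrightarrow> 0"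
    and C: "\<And>i. gam (u i) UNIV \<le> C" and B: "B \<in> sets borel"
    and le: "\<And>i. measure (\<Gamma> (u i)) B \<le> b i" and b: "b \<longlonglongrightarrow> l"
  shows "measure (\<Gamma> f) B \<le> l"
proof -
  have "emeasure (\<Gamma> f) B \<le> liminf (\<lambda>i. emeasure (\<Gamma> (u i)) B)"
    using f u lim C B p_gt_1
    by (intro \<Gamma>_lower_semicontinuous[of f u "C powr p"] Lp_norm_tendsto F_Lp) (auto simp: E_eq intro!: powr_mono2)
  also have "\<dots> \<le> liminf (\<lambda>i. ennreal (b i))"
    using le finite_measure.emeasure_eq_measure[OF finite_\<Gamma>[OF u]] by (intro Liminf_mono) (auto intro!: always_eventually ennreal_leI)
  also have "\<dots> = ennreal l" by (intro lim_imp_Liminf tendsto_ennrealI b) simp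
  finally have "ennreal (measure (\<Gamma> f) B) \<le> ennreal l"
    using finite_measure.emeasure_eq_measure[OF finite_\<Gamma>[OF f]] by simp
  moreover have "0 \<le> l" using b le by (intro LIMSEQ_le_const[OF b]) (auto intro: order_trans[OF measure_nonneg])
  ultimately show ?thesis by (simp add: ennreal_le_iff)
qed

text \<open>Carries locality from open sets to a Borel set \<open>B\<close>: the approximants are
  constant on open sets around \<open>B\<close> which may vary with \<open>i\<close>.\<close>

lemma approximation_local:
  assumes f: "f \<in> F" and u: "\<And>i. u i \<in> F" and lim: "(\<lambda>i. lpint (\<lambda>x. u i x - f x)) \<longlonglongrightarrow> 0"
    and C: "\<And>i. gam (u i) UNIV \<le> C" and B: "B \<in> sets borel"
    and S: "\<And>i. open (S i)" "\<And>i. B \<subseteq> S i" and const: "\<And>i. AE x in completion \<mu>. x \<in> S i \<longrightarrow> u i x = c"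
  shows "measure (\<Gamma> f) B = 0"
proof -
  have "measure (\<Gamma> (u i)) B \<le> 0" for i
    using gam_mono(2)[OF u[of i] S(2)[of i]] S(1)[of i] \<Gamma>_local[OF u[of i] S(1)[of i] const[of i]] by simp
  then have "measure (\<Gamma> f) B \<le> 0" by (rule Gamma_limit_le[OF f u lim C B]) (rule tendsto_const)
  then show ?thesis using measure_nonneg[of "\<Gamma> f" B] by linarith
qed

lemma gam_eq_0_iff: "gam f B = 0 \<longleftrightarrow> measure (\<Gamma> f) B = 0"
  using p_gt_1 by (simp add: gam_def)

end

section \<open>Locality for quasicontinuous functions\<close>

lemma abs_max_diff_le: "\<bar>max a s - max a t\<bar> \<le> \<bar>s - (t::real)\<bar>"
  by (simp add: max_def)

lemma abs_min_diff_le: "\<bar>min s a - min t a\<bar> \<le> \<bar>s - (t::real)\<bar>"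
  by (simp add: min_def)

lemma lipschitz_max0: "1-lipschitz_on UNIV (\<lambda>t. max 0 (t - c :: real))"
  by (rule lipschitz_onI) (use abs_max_diff_le[of 0 "_ - c" "_ - c"] in \<open>auto simp: dist_real_def\<close>)

lemma lipschitz_min: "1-lipschitz_on UNIV (\<lambda>t. min t (c :: real))"
  by (rule lipschitz_onI) (use abs_min_diff_le in \<open>auto simp: dist_real_def\<close>)

text \<open>\<open>Os\<close> are exceptional sets of quasicontinuity and \<open>ps\<close> are
  functions of small norm that are at least 1 on them. The quadratic rate leaves room for factors of
  order \<open>j + 1\<close>: the multiples of \<open>ps j\<close> then keep bounded energy and
  still tend to 0 in the \<open>p\<close>-norm.\<close>

locale dirichlet_nest = p_dirichlet p \<mu> E F \<Gamma>
  for p and \<mu> :: "'a::metric_space measure" and E F \<Gamma> +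
  fixes Os :: "nat \<Rightarrow> 'a set" and ps :: "nat \<Rightarrow> 'a \<Rightarrow> real"
  assumes open_Os: "open (Os j)" and ps_mem: "ps j \<in> F" and ps_nonneg: "0 \<le> ps j x"
    and ps_ge_1: "AE x in completion \<mu>. x \<in> Os j \<longrightarrow> 1 \<le> ps j x"
    and gam_ps: "gam (ps j) UNIV \<le> 1 / (real (Suc j))\<^sup>2"
    and lpint_ps: "lpint (ps j) \<le> (1 / (real (Suc j))\<^sup>2) powr p"
begin

definition N :: "'a set" where "N = (\<Inter>j. Os j)"

text \<open>Quasicontinuity along the fixed sequence \<open>Os\<close>, so that sums and
  compositions need no new exceptional sets.\<close>

definition qc :: "('a \<Rightarrow> real) \<Rightarrow> bool" where "qc f \<longleftrightarrow> (\<forall>j. continuous_on (- Os j) f)"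

lemma N_borel [measurable]: "N \<in> sets borel"
  unfolding N_def using open_Os by auto

lemma scaled_ps:
  assumes a: "\<And>j. 0 \<le> a j" "\<And>j. a j \<le> K * real (Suc j)"
  shows "(\<lambda>x. a j * ps j x) \<in> F" "gam (\<lambda>x. a j * ps j x) UNIV \<le> K" "(\<lambda>j. lpint (\<lambda>x. a j * ps j x)) \<longlonglongrightarrow> 0"
proof -
  show "(\<lambda>x. a j * ps j x) \<in> F" by (rule scale_mem[OF ps_mem])
  have K: "0 \<le> K" using a(1)[of 0] a(2)[of 0] by simp
  have le: "a j * (1 / (real (Suc j))\<^sup>2) \<le> K / real (Suc j)" for j
  proof -
    have "a j * (1 / (real (Suc j))\<^sup>2) \<le> K * real (Suc j) * (1 / (real (Suc j))\<^sup>2)" by (rule mult_right_mono[OF a(2)]) simp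
    also have "\<dots> = K / real (Suc j)" by (simp add: power2_eq_square del: of_nat_Suc)
    finally show ?thesis .
  qed
  have "gam (\<lambda>x. a j * ps j x) UNIV = a j * gam (ps j) UNIV" using gam_scale[OF ps_mem, of UNIV "a j" j] a(1)[of j] by simp
  also have "\<dots> \<le> a j * (1 / (real (Suc j))\<^sup>2)" by (intro mult_left_mono gam_ps a)
  also have "\<dots> \<le> K / real (Suc j)" by (rule le)
  also have "\<dots> \<le> K / 1" by (rule divide_left_mono) (use K in auto)
  finally show "gam (\<lambda>x. a j * ps j x) UNIV \<le> K" by simp
  have lpj: "lpint (\<lambda>x. a j * ps j x) \<le> (K / real (Suc j)) powr p" for j
  proof -
    have "lpint (\<lambda>x. a j * ps j x) \<le> a j powr p * (1 / (real (Suc j))\<^sup>2) powr p"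
      using lpint_ps[of j] a(1)[of j] unfolding lpint_scale by (intro mult_mono) auto
    also have "\<dots> = (a j * (1 / (real (Suc j))\<^sup>2)) powr p" using a(1)[of j] by (subst powr_mult) auto
    also have "\<dots> \<le> (K / real (Suc j)) powr p" using le[of j] a(1)[of j] p_gt_1 by (intro powr_mono2) (auto simp del: of_nat_Suc)
    finally show ?thesis .
  qed
  have "(\<lambda>j. (K / real (Suc j)) powr p) \<longlonglongrightarrow> 0"
  proof (rule tendsto_zero_powrI[of _ _ "\<lambda>_. p" p])
    have "(\<lambda>j. K * inverse (real (Suc j))) \<longlonglongrightarrow> K * 0" by (intro tendsto_mult_left LIMSEQ_inverse_real_of_nat)
    then show "(\<lambda>j. K / real (Suc j)) \<longlonglongrightarrow> 0" by (simp add: divide_inverse)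
  qed (use p_gt_1 K in auto)
  then show "(\<lambda>j. lpint (\<lambda>x. a j * ps j x)) \<longlonglongrightarrow> 0"
    by (rule tendsto_sandwich[OF _ _ tendsto_const, rotated 2]) (intro always_eventually allI lpint_nonneg lpj)+
qed

lemma lpint_tendsto_add:
  assumes "\<And>j. u j \<in> Lp_space p \<mu>" "\<And>j. v j \<in> Lp_space p \<mu>" "f \<in> Lp_space p \<mu>"
    "(\<lambda>j. lpint (\<lambda>x. u j x - v j x)) \<longlonglongrightarrow> 0" "(\<lambda>j. lpint (\<lambda>x. v j x - f x)) \<longlonglongrightarrow> 0"
    "\<And>j. (\<lambda>x. u j x - v j x) \<in> Lp_space p \<mu>" "\<And>j. (\<lambda>x. v j x - f x) \<in> Lp_space p \<mu>"
    "\<And>j. (\<lambda>x. u j x - f x) \<in> Lp_space p \<mu>"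
  shows "(\<lambda>j. lpint (\<lambda>x. u j x - f x)) \<longlonglongrightarrow> 0"
proof -
  have le: "lpint (\<lambda>x. u j x - f x) \<le> 2 powr p * (lpint (\<lambda>x. u j x - v j x) + lpint (\<lambda>x. v j x - f x))" for j
    using lpint_add[OF assms(6)[of j] assms(7)[of j]] assms(8)[of j] by simp
  have lim: "(\<lambda>j. 2 powr p * (lpint (\<lambda>x. u j x - v j x) + lpint (\<lambda>x. v j x - f x))) \<longlonglongrightarrow> 2 powr p * (0 + 0)"
    by (intro tendsto_intros assms)
  show ?thesis
  proof (rule tendsto_sandwich[OF _ _ tendsto_const])
    show "(\<lambda>j. 2 powr p * (lpint (\<lambda>x. u j x - v j x) + lpint (\<lambda>x. v j x - f x))) \<longlonglongrightarrow> 0" using lim by simp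
  qed (auto intro!: always_eventually le)
qed

text \<open>Subtracting large multiples of \<open>ps j\<close> makes the approximants constant on the exceptional set \<open>Os j\<close>,
  so that locality on open sets suffices.\<close>

lemma cut_above:
  assumes f: "f \<in> F" and c: "0 \<le> c" and B: "B \<in> sets borel"
    and S: "\<And>j. open (S j)" "\<And>j. B \<subseteq> S j" "\<And>j. S j \<subseteq> Os j \<union> {x. f x < c + 1 / real (Suc j)}"
  shows "measure (\<Gamma> (\<lambda>x. max 0 (f x - c))) B = 0"
proof -
  \<comment> \<open>The truncation at height \<open>j + 1\<close> lets \<open>(j + 1) * ps j\<close>
    cancel everything on \<open>Os j\<close>. The shift by \<open>1 / (j + 1)\<close> gives 0
    wherever \<open>f x < c + 1 / (j + 1)\<close>, a strict inequality that yields open sets around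
    a level set.\<close>
  define \<tau> where "\<tau> j t = max 0 (min t (real (Suc j)) - c - 1 / real (Suc j))" for j and t :: real
  define u where "u j x = max 0 (\<tau> j (f x) - real (Suc j) * ps j x)" for j x
  let ?h = "\<lambda>x. max 0 (f x - c)"
  have lip\<tau>: "1-lipschitz_on UNIV (\<tau> j)" for j
  proof (rule lipschitz_onI)
    fix s t
    show "dist (\<tau> j s) (\<tau> j t) \<le> 1 * dist s t"
    proof -
      have "dist (\<tau> j s) (\<tau> j t) \<le> \<bar>(min s (real (Suc j)) - c - 1 / real (Suc j)) - (min t (real (Suc j)) - c - 1 / real (Suc j))\<bar>"
        unfolding \<tau>_def dist_real_def by (rule abs_max_diff_le)
      also have "\<dots> = \<bar>min s (real (Suc j)) - min t (real (Suc j))\<bar>" by simp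
      also have "\<dots> \<le> \<bar>s - t\<bar>" by (rule abs_min_diff_le)
      finally show ?thesis by (simp add: dist_real_def)
    qed
  qed simp
  have lipmax: "1-lipschitz_on UNIV (max (0::real))" using lipschitz_max0[of 0] by simp
  note liph = lipschitz_max0[of c]
  have \<tau>0: "\<tau> j 0 = 0" for j
  proof -
    have "0 \<le> 1 / real (Suc j)" by simp
    then have "min 0 (real (Suc j)) - c - 1 / real (Suc j) \<le> 0" using c by linarith
    then show ?thesis unfolding \<tau>_def by (rule max_absorb1)
  qed
  have h: "?h \<in> F" by (rule lip_mem[OF f liph]) (use c in simp)
  have \<tau>F: "(\<lambda>x. \<tau> j (f x)) \<in> F" for j by (rule lip_mem[OF f lip\<tau> \<tau>0])
  have dF: "(\<lambda>x. \<tau> j (f x) - real (Suc j) * ps j x) \<in> F" for j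
    by (rule diff_mem[OF \<tau>F scale_mem[OF ps_mem]])
  have uF: "u j \<in> F" for j unfolding u_def by (rule lip_mem[OF dF lipmax]) simp
  have ugam: "gam (u j) UNIV \<le> gam f UNIV + 1" for j
  proof -
    have "gam (u j) UNIV \<le> 1 * gam (\<lambda>x. \<tau> j (f x) - real (Suc j) * ps j x) UNIV"
      unfolding u_def by (rule gam_lip[OF dF lipmax]) auto
    also have "\<dots> \<le> gam (\<lambda>x. \<tau> j (f x)) UNIV + gam (\<lambda>x. real (Suc j) * ps j x) UNIV"
      using gam_diff[OF \<tau>F scale_mem[OF ps_mem], of UNIV j "real (Suc j)" j] by simp
    also have "\<dots> \<le> gam f UNIV + 1"
      using gam_lip[OF f lip\<tau> \<tau>0, of UNIV j] scaled_ps(2)[of "\<lambda>j. real (Suc j)" 1 j] by simp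
    finally show ?thesis .
  qed
  have lim: "(\<lambda>j. lpint (\<lambda>x. u j x - ?h x)) \<longlonglongrightarrow> 0"
  proof (rule lpint_tendsto_add[where v = "\<lambda>j x. \<tau> j (f x)"])
    show "(\<lambda>j. lpint (\<lambda>x. u j x - \<tau> j (f x))) \<longlonglongrightarrow> 0"
    proof (rule tendsto_sandwich[OF _ _ tendsto_const])
      show "(\<lambda>j. lpint (\<lambda>x. real (Suc j) * ps j x)) \<longlonglongrightarrow> 0" by (rule scaled_ps(3)[of _ 1]) auto
      show "\<forall>\<^sub>F j in sequentially. lpint (\<lambda>x. u j x - \<tau> j (f x)) \<le> lpint (\<lambda>x. real (Suc j) * ps j x)"
      proof (intro always_eventually allI lpint_mono F_Lp scale_mem ps_mem)
        fix j x
        show "(\<lambda>x. u j x - \<tau> j (f x)) \<in> borel_measurable (completion \<mu>)" by (rule Lp_meas[OF F_Lp[OF diff_mem[OF uF \<tau>F]]])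
        have "0 \<le> \<tau> j (f x)" by (simp add: \<tau>_def)
        moreover have "0 \<le> real (Suc j) * ps j x" using ps_nonneg by simp
        ultimately show "\<bar>u j x - \<tau> j (f x)\<bar> \<le> \<bar>real (Suc j) * ps j x\<bar>" unfolding u_def by linarith
      qed
    qed auto
    show "(\<lambda>j. lpint (\<lambda>x. \<tau> j (f x) - ?h x)) \<longlonglongrightarrow> 0"
    proof (rule lpint_dominated[OF F_Lp[OF f], of _ _ 1])
      show "(\<lambda>x. \<tau> j (f x)) \<in> borel_measurable (completion \<mu>)" for j by (rule Lp_meas[OF F_Lp[OF \<tau>F]])
      show "?h \<in> borel_measurable (completion \<mu>)" by (rule Lp_meas[OF F_Lp[OF h]])
      fix x
      show "\<bar>\<tau> j (f x) - ?h x\<bar> \<le> 1 * \<bar>f x\<bar>" for j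
      proof -
        have "0 \<le> 1 / real (Suc j)" by simp
        moreover have "min (f x) (real (Suc j)) \<le> \<bar>f x\<bar>" by (rule order_trans[OF min.cobounded1 abs_ge_self])
        ultimately have "min (f x) (real (Suc j)) - c - 1 / real (Suc j) \<le> \<bar>f x\<bar>" "f x - c \<le> \<bar>f x\<bar>" using c by linarith+
        then have "0 \<le> \<tau> j (f x)" "\<tau> j (f x) \<le> \<bar>f x\<bar>" "0 \<le> ?h x" "?h x \<le> \<bar>f x\<bar>"
          unfolding \<tau>_def by simp_all
        then show ?thesis by linarith
      qed
      have "(\<lambda>j. max 0 (f x - c - inverse (real (Suc j)))) \<longlonglongrightarrow> max 0 (f x - c - 0)"
        by (intro tendsto_intros LIMSEQ_inverse_real_of_nat)
      moreover have "\<forall>\<^sub>F j in sequentially. max 0 (f x - c - inverse (real (Suc j))) = \<tau> j (f x)"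
      proof -
        obtain n :: nat where n: "f x < real n" using reals_Archimedean2 by blast
        have "max 0 (f x - c - inverse (real (Suc j))) = \<tau> j (f x)" if "j \<ge> n" for j
        proof -
          have "f x < real (Suc j)" using n that by linarith
          then show ?thesis by (simp add: \<tau>_def min_def divide_inverse)
        qed
        then show ?thesis unfolding eventually_sequentially by blast
      qed
      ultimately show "(\<lambda>j. \<tau> j (f x)) \<longlonglongrightarrow> ?h x" by (simp add: Lim_transform_eventually)
    qed
  qed (intro F_Lp uF \<tau>F h diff_mem)+
  show ?thesis
  proof (rule approximation_local[OF h uF lim ugam B S(1,2)])
    fix j
    show "AE x in completion \<mu>. x \<in> S j \<longrightarrow> u j x = 0"
      using ps_ge_1[of j]
    proof eventually_elim
      fix x assume x: "x \<in> Os j \<longrightarrow> 1 \<le> ps j x"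
      show "x \<in> S j \<longrightarrow> u j x = 0"
      proof
        assume "x \<in> S j"
        then consider "x \<in> Os j" | "f x < c + 1 / real (Suc j)" using S(3)[of j] by blast
        then show "u j x = 0"
        proof cases
          case 1
          then have "real (Suc j) \<le> real (Suc j) * ps j x" using x mult_left_mono[of 1 "ps j x" "real (Suc j)"] by (simp only: mult_1_right)
          moreover have "\<tau> j (f x) \<le> real (Suc j)"
          proof -
            have "0 \<le> 1 / real (Suc j)" by simp
            then have "min (f x) (real (Suc j)) - c - 1 / real (Suc j) \<le> real (Suc j)"
              using c min.cobounded2[of "f x" "real (Suc j)"] by linarith
            then show ?thesis unfolding \<tau>_def by simp
          qed
          ultimately have "\<tau> j (f x) \<le> real (Suc j) * ps j x" by (rule order_trans[rotated])
          then show ?thesis unfolding u_def by (intro max_absorb1) simp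
        next
          case 2
          then have "\<tau> j (f x) = 0" by (simp add: \<tau>_def)
          moreover have "0 \<le> real (Suc j) * ps j x" using ps_nonneg by simp
          ultimately have "\<tau> j (f x) - real (Suc j) * ps j x \<le> 0" by linarith
          then show ?thesis unfolding u_def by (rule max_absorb1)
        qed
      qed
    qed
  qed
qed

text \<open>Counterpart of \<open>cut_above\<close>: multiples of \<open>ps j\<close> now lift the
  approximants to the constant \<open>c\<close> on \<open>Os j\<close>. The maps composed with
  \<open>f\<close> must fix 0, so the level is overshot by the factor \<open>1 + 1 / (j + 1)\<close>
  instead of a shift, and this works at a positive level \<open>c\<close>.\<close>

lemma cut_below:
  assumes f: "f \<in> F" and c: "0 < c" and B: "B \<in> sets borel"
    and S: "\<And>j. open (S j)" "\<And>j. B \<subseteq> S j" "\<And>j. S j \<subseteq> Os j \<union> {x. c < (1 + 1 / real (Suc j)) * f x}"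
  shows "measure (\<Gamma> (\<lambda>x. min (f x) c)) B = 0"
proof -
  define \<sigma> where "\<sigma> j t = (1 + 1 / real (Suc j)) * max t (- real (Suc j))" for j and t :: real
  \<comment> \<open>\<open>\<sigma> j\<close> is at least \<open>- (j + 1) - 1\<close>, hence at
    least \<open>- 2 * (j + 1)\<close>; adding \<open>a j\<close> reaches \<open>c\<close>.\<close>
  define a where "a j = c + 2 * real (Suc j)" for j
  define u where "u j x = min (\<sigma> j (f x) + a j * ps j x) c" for j x
  let ?h = "\<lambda>x. min (f x) c"
  have lip\<sigma>: "2-lipschitz_on UNIV (\<sigma> j)" for j
  proof (rule lipschitz_onI)
    fix s t :: real
    have "dist (\<sigma> j s) (\<sigma> j t) = (1 + 1 / real (Suc j)) * \<bar>max s (- real (Suc j)) - max t (- real (Suc j))\<bar>"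
      unfolding \<sigma>_def dist_real_def by (simp add: abs_mult flip: right_diff_distrib)
    also have "\<dots> \<le> 2 * \<bar>s - t\<bar>" by (intro mult_mono) (auto simp: abs_max_diff_le max.commute[of _ "- _"])
    finally show "dist (\<sigma> j s) (\<sigma> j t) \<le> 2 * dist s t" by (simp add: dist_real_def)
  qed simp
  note lipmin = lipschitz_min[of c]
  have \<sigma>0: "\<sigma> j 0 = 0" for j by (simp add: \<sigma>_def max_def)
  have h: "?h \<in> F" by (rule lip_mem[OF f lipmin]) (use c in simp)
  have \<sigma>F: "(\<lambda>x. \<sigma> j (f x)) \<in> F" for j by (rule lip_mem[OF f lip\<sigma> \<sigma>0])
  have m\<sigma>F: "(\<lambda>x. min (\<sigma> j (f x)) c) \<in> F" for j by (rule lip_mem[OF \<sigma>F lipmin]) (use c in simp)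
  have a: "0 \<le> a j" "a j \<le> (c + 2) * real (Suc j)" for j
  proof -
    show "0 \<le> a j" using c by (simp add: a_def)
    have "c * 1 \<le> c * real (Suc j)" using c by (intro mult_left_mono) auto
    then show "a j \<le> (c + 2) * real (Suc j)" unfolding a_def distrib_right by linarith
  qed
  note sps = scaled_ps[of a "c + 2", OF a]
  have dF: "(\<lambda>x. \<sigma> j (f x) + a j * ps j x) \<in> F" for j by (rule add_mem[OF \<sigma>F sps(1)])
  have uF: "u j \<in> F" for j unfolding u_def by (rule lip_mem[OF dF lipmin]) (use c in simp)
  have ugam: "gam (u j) UNIV \<le> 2 * gam f UNIV + (c + 2)" for j
  proof -
    have "gam (u j) UNIV \<le> 1 * gam (\<lambda>x. \<sigma> j (f x) + a j * ps j x) UNIV"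
      unfolding u_def by (rule gam_lip[OF dF lipmin]) (use c in auto)
    also have "\<dots> \<le> gam (\<lambda>x. \<sigma> j (f x)) UNIV + gam (\<lambda>x. a j * ps j x) UNIV"
      using gam_add[OF \<sigma>F sps(1), of UNIV j j] by simp
    also have "\<dots> \<le> 2 * gam f UNIV + (c + 2)"
      using gam_lip[OF f lip\<sigma> \<sigma>0, of UNIV j] sps(2)[of j] by simp
    finally show ?thesis .
  qed
  have lim: "(\<lambda>j. lpint (\<lambda>x. u j x - ?h x)) \<longlonglongrightarrow> 0"
  proof (rule lpint_tendsto_add[where v = "\<lambda>j x. min (\<sigma> j (f x)) c"])
    show "(\<lambda>j. lpint (\<lambda>x. u j x - min (\<sigma> j (f x)) c)) \<longlonglongrightarrow> 0"
    proof (rule tendsto_sandwich[OF _ _ tendsto_const sps(3)])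
      show "\<forall>\<^sub>F j in sequentially. lpint (\<lambda>x. u j x - min (\<sigma> j (f x)) c) \<le> lpint (\<lambda>x. a j * ps j x)"
      proof (intro always_eventually allI lpint_mono F_Lp sps(1))
        fix j x
        show "(\<lambda>x. u j x - min (\<sigma> j (f x)) c) \<in> borel_measurable (completion \<mu>)"
          by (rule Lp_meas[OF F_Lp[OF diff_mem[OF uF m\<sigma>F]]])
        have "0 \<le> a j * ps j x" using ps_nonneg a by simp
        then show "\<bar>u j x - min (\<sigma> j (f x)) c\<bar> \<le> \<bar>a j * ps j x\<bar>" unfolding u_def by linarith
      qed
    qed auto
    show "(\<lambda>j. lpint (\<lambda>x. min (\<sigma> j (f x)) c - ?h x)) \<longlonglongrightarrow> 0"
    proof (rule lpint_dominated[OF F_Lp[OF f], of _ _ 1])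
      show "(\<lambda>x. min (\<sigma> j (f x)) c) \<in> borel_measurable (completion \<mu>)" for j by (rule Lp_meas[OF F_Lp[OF m\<sigma>F]])
      show "?h \<in> borel_measurable (completion \<mu>)" by (rule Lp_meas[OF F_Lp[OF h]])
      fix x
      show "\<bar>min (\<sigma> j (f x)) c - ?h x\<bar> \<le> 1 * \<bar>f x\<bar>" for j
      proof -
        have "\<bar>\<sigma> j (f x) - f x\<bar> \<le> \<bar>f x\<bar>"
        proof (cases "f x < - real (Suc j)")
          case True
          then have "\<sigma> j (f x) = - real (Suc j) - 1" by (simp add: \<sigma>_def max_def field_simps)
          then show ?thesis using True by auto
        next
          case False
          then have "max (f x) (- real (Suc j)) = f x" by simp
          then have "\<sigma> j (f x) - f x = f x / real (Suc j)" unfolding \<sigma>_def by (simp add: algebra_simps del: of_nat_Suc)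
          moreover have "\<bar>f x\<bar> / real (Suc j) \<le> \<bar>f x\<bar> / 1" by (rule divide_left_mono) auto
          ultimately show ?thesis by simp
        qed
        then show ?thesis by linarith
      qed
      have "(\<lambda>j. min ((1 + inverse (real (Suc j))) * f x) c) \<longlonglongrightarrow> min ((1 + 0) * f x) c"
        by (intro tendsto_intros LIMSEQ_inverse_real_of_nat)
      moreover have "\<forall>\<^sub>F j in sequentially. min ((1 + inverse (real (Suc j))) * f x) c = min (\<sigma> j (f x)) c"
      proof -
        obtain n :: nat where n: "- f x < real n" using reals_Archimedean2 by blast
        have "min ((1 + inverse (real (Suc j))) * f x) c = min (\<sigma> j (f x)) c" if "j \<ge> n" for j
        proof -
          have "- real (Suc j) \<le> f x" using n that by linarith
          then show ?thesis by (simp add: \<sigma>_def max_absorb1 divide_inverse)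
        qed
        then show ?thesis unfolding eventually_sequentially by blast
      qed
      ultimately show "(\<lambda>j. min (\<sigma> j (f x)) c) \<longlonglongrightarrow> ?h x" by (simp add: Lim_transform_eventually)
    qed
  qed (intro F_Lp uF m\<sigma>F h diff_mem)+
  show ?thesis
  proof (rule approximation_local[OF h uF lim ugam B S(1,2)])
    fix j
    show "AE x in completion \<mu>. x \<in> S j \<longrightarrow> u j x = c"
      using ps_ge_1[of j]
    proof eventually_elim
      fix x assume x: "x \<in> Os j \<longrightarrow> 1 \<le> ps j x"
      show "x \<in> S j \<longrightarrow> u j x = c"
      proof
        assume "x \<in> S j"
        then consider "x \<in> Os j" | "c < (1 + 1 / real (Suc j)) * f x" using S(3)[of j] by blast
        then show "u j x = c"
        proof cases
          case 1
          then have "a j \<le> a j * ps j x" using x a(1)[of j] mult_left_mono[of 1 "ps j x" "a j"] by simp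
          moreover have "- 2 * real (Suc j) \<le> \<sigma> j (f x)"
          proof -
            have "(1 + 1 / real (Suc j)) * (- real (Suc j)) \<le> \<sigma> j (f x)" unfolding \<sigma>_def by (intro mult_left_mono) auto
            moreover have "(1 + 1 / real (Suc j)) * (- real (Suc j)) = - real (Suc j) - 1" by (simp add: field_simps)
            ultimately show ?thesis by simp
          qed
          moreover have "a j = c + 2 * real (Suc j)" by (simp add: a_def)
          ultimately have "c \<le> \<sigma> j (f x) + a j * ps j x" by linarith
          then show ?thesis unfolding u_def by (rule min_absorb2)
        next
          case 2
          then have "0 < (1 + 1 / real (Suc j)) * f x" using c by linarith
          moreover have "0 < 1 + 1 / real (Suc j)" by (simp add: add_pos_pos)
          ultimately have "0 < f x" using zero_less_mult_pos by blast
          then have "\<sigma> j (f x) = (1 + 1 / real (Suc j)) * f x" by (simp add: \<sigma>_def max_def)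
          moreover have "0 \<le> a j * ps j x" using ps_nonneg a by simp
          ultimately have "c \<le> \<sigma> j (f x) + a j * ps j x" using 2 by linarith
          then show ?thesis unfolding u_def by (rule min_absorb2)
        qed
      qed
    qed
  qed
qed

lemma open_superlevel:
  assumes "qc f"
  shows "open (Os j \<union> {x. f x < c})" "open (Os j \<union> {x. c < f x})"
proof -
  have c: "closed (- Os j)" by (intro closed_Compl open_Os)
  have "closed (- Os j \<inter> f -` {c..})" "closed (- Os j \<inter> f -` {..c})"
    using assms by (auto simp: qc_def intro!: continuous_closed_preimage c)
  moreover have "- Os j \<inter> f -` {c..} = - (Os j \<union> {x. f x < c})" "- Os j \<inter> f -` {..c} = - (Os j \<union> {x. c < f x})"
    by auto
  ultimately show "open (Os j \<union> {x. f x < c})" "open (Os j \<union> {x. c < f x})" by (auto simp: closed_def)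
qed

text \<open>Every \<open>Os j\<close> is an open set around \<open>N\<close>, so the positive parts
  of \<open>f\<close> and of \<open>- f\<close> can be cut to 0 there.\<close>

lemma Gamma_N:
  assumes f: "f \<in> F"
  shows "gam f N = 0"
proof -
  have pos: "measure (\<Gamma> (\<lambda>x. max 0 (g x - 0))) N = 0" if g: "g \<in> F" for g
    by (rule cut_above[OF g order_refl N_borel, of Os]) (auto simp: open_Os N_def)
  have mem: "(\<lambda>x. max 0 (g x)) \<in> F" if g: "g \<in> F" for g using lip_mem[OF g lipschitz_max0[of 0]] by simp
  have "gam (\<lambda>x. max 0 (f x) - max 0 (- f x)) N \<le> gam (\<lambda>x. max 0 (f x)) N + gam (\<lambda>x. max 0 (- f x)) N"
    by (intro gam_diff mem uminus_mem f N_borel)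
  also have "\<dots> = 0" using pos[OF f] pos[OF uminus_mem[OF f]] by (simp add: gam_eq_0_iff[symmetric])
  also have "(\<lambda>x. max 0 (f x) - max 0 (- f x)) = f" by (auto simp: max_def)
  finally show ?thesis using gam_nonneg[of f N] by linarith
qed

lemma gam_positive_part:
  assumes f: "f \<in> F" "qc f" and c: "0 \<le> c" and B: "B \<in> sets borel" "\<And>x. x \<in> B \<Longrightarrow> x \<notin> N \<Longrightarrow> f x \<le> c"
  shows "gam (\<lambda>x. max 0 (f x - c)) B = 0"
  unfolding gam_eq_0_iff
proof (rule cut_above[OF f(1) c B(1), of "\<lambda>j. Os j \<union> {x. f x < c + 1 / real (Suc j)}"])
  fix j
  show "open (Os j \<union> {x. f x < c + 1 / real (Suc j)})" by (rule open_superlevel[OF f(2)])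
  have "f x < c + 1 / real (Suc j)" if "x \<in> B" "x \<notin> Os j" for x
  proof -
    have "f x \<le> c" using that by (intro B(2)) (auto simp: N_def)
    moreover have "0 < 1 / real (Suc j)" by simp
    ultimately show ?thesis by linarith
  qed
  then show "B \<subseteq> Os j \<union> {x. f x < c + 1 / real (Suc j)}" by blast
qed simp

lemma gam_truncation:
  assumes f: "f \<in> F" "qc f" and c: "0 \<le> c" and B: "B \<in> sets borel" "\<And>x. x \<in> B \<Longrightarrow> x \<notin> N \<Longrightarrow> c \<le> f x"
  shows "gam (\<lambda>x. min (f x) c) B = 0"
proof (cases "c = 0")
  \<comment> \<open>\<open>cut_below\<close> asks for a positive level. At level 0 the truncation
    is, up to sign, the positive part of \<open>- f\<close>.\<close>
  case True
  have qcm: "qc (\<lambda>x. - f x)" using f(2) by (auto simp: qc_def intro: continuous_intros)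
  have "gam (\<lambda>x. max 0 (- f x - 0)) B = 0"
    by (rule gam_positive_part[OF uminus_mem[OF f(1)] qcm order_refl B(1)]) (use B(2) True in auto)
  moreover have "(\<lambda>x. max 0 (- f x)) \<in> F" using lip_mem[OF uminus_mem[OF f(1)] lipschitz_max0[of 0]] by simp
  ultimately have "gam (\<lambda>x. - max 0 (- f x)) B = 0" by (subst gam_uminus) (use B in auto)
  moreover have "(\<lambda>x. - max 0 (- f x)) = (\<lambda>x. min (f x) c)" using True by (auto simp: max_def min_def)
  ultimately show ?thesis by simp
next
  case False
  then have c: "0 < c" using c by simp
  show ?thesis
    unfolding gam_eq_0_iff
  proof (rule cut_below[OF f(1) c B(1), of "\<lambda>j. Os j \<union> {x. c / (1 + 1 / real (Suc j)) < f x}"])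
    fix j
    have pos: "0 < 1 + 1 / real (Suc j)" by (simp add: add_pos_pos)
    show "open (Os j \<union> {x. c / (1 + 1 / real (Suc j)) < f x})" by (rule open_superlevel[OF f(2)])
    have lt: "c / (1 + 1 / real (Suc j)) < c"
      using c pos by (simp add: pos_divide_less_eq)
    have "c / (1 + 1 / real (Suc j)) < f x" if "x \<in> B" "x \<notin> Os j" for x
    proof -
      have "c \<le> f x" using that by (intro B(2)) (auto simp: N_def)
      then show ?thesis using lt by linarith
    qed
    then show "B \<subseteq> Os j \<union> {x. c / (1 + 1 / real (Suc j)) < f x}" by blast
    show "Os j \<union> {x. c / (1 + 1 / real (Suc j)) < f x} \<subseteq> Os j \<union> {x. c < (1 + 1 / real (Suc j)) * f x}"
      using pos by (auto simp only: pos_divide_less_eq mult.commute)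
  qed
qed

text \<open>\<open>f\<close> is the sum of \<open>max 0 (f x - c)\<close> and
  \<open>min (f x) c\<close>, and neither part has energy on the level set. A negative level is
  reduced to \<open>- f\<close>.\<close>

lemma gam_level_set:
  assumes f: "f \<in> F" "qc f" and B: "B \<in> sets borel" "\<And>x. x \<in> B \<Longrightarrow> x \<notin> N \<Longrightarrow> f x = c"
  shows "gam f B = 0"
proof -
  have *: "gam g B = 0" if g: "g \<in> F" "qc g" and c: "0 \<le> c" and gc: "\<And>x. x \<in> B \<Longrightarrow> x \<notin> N \<Longrightarrow> g x = c" for g c
  proof -
    note l1 = lipschitz_max0[of c] lipschitz_min[of c]
    have mem: "(\<lambda>x. max 0 (g x - c)) \<in> F" "(\<lambda>x. min (g x) c) \<in> F"
      by (rule lip_mem[OF g(1) l1(1)], use c in simp, rule lip_mem[OF g(1) l1(2)], use c in simp)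
    have "gam (\<lambda>x. max 0 (g x - c) + min (g x) c) B \<le> gam (\<lambda>x. max 0 (g x - c)) B + gam (\<lambda>x. min (g x) c) B"
      by (intro gam_add mem B)
    also have "\<dots> = 0" using gam_positive_part[OF g c B(1)] gam_truncation[OF g c B(1)] gc by simp
    also have "(\<lambda>x. max 0 (g x - c) + min (g x) c) = g" by (auto simp: max_def min_def)
    finally show ?thesis using gam_nonneg[of g B] by linarith
  qed
  show ?thesis
  proof (cases "0 \<le> c")
    case True
    then show ?thesis by (rule *[OF f]) (rule B(2))
  next
    case False
    have qcm: "qc (\<lambda>x. - f x)" using f(2) by (auto simp: qc_def intro: continuous_intros)
    have "gam (\<lambda>x. - f x) B = 0" by (rule *[OF uminus_mem[OF f(1)] qcm, of "- c"]) (use False B(2) in auto)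
    then show ?thesis by (simp add: gam_uminus[OF f(1) B(1)])
  qed
qed

text \<open>Chebyshev: on \<open>N\<close> every \<open>ps j\<close> is at least 1 almost
  everywhere, so the measure of \<open>N\<close> is at most \<open>lpint (ps j)\<close>, which tends
  to 0.\<close>

lemma AE_not_N: "AE x in completion \<mu>. x \<notin> N"
proof -
  have sets_mu: "sets \<mu> = sets borel" using radon by (simp add: radon_measure_def)
  have Nc: "N \<in> sets (completion \<mu>)" using N_borel sets_mu by (simp add: sets_completionI_sets)
  have le: "emeasure (completion \<mu>) N \<le> ennreal (lpint (ps j))" for j
  proof -
    have "emeasure (completion \<mu>) N = (\<integral>\<^sup>+x. indicator N x \<partial>completion \<mu>)" using Nc by simp
    also have "\<dots> \<le> (\<integral>\<^sup>+x. ennreal (\<bar>ps j x\<bar> powr p) \<partial>completion \<mu>)"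
    proof (rule nn_integral_mono_AE)
      show "AE x in completion \<mu>. indicator N x \<le> ennreal (\<bar>ps j x\<bar> powr p)"
        using ps_ge_1[of j]
      proof eventually_elim
        fix x assume x: "x \<in> Os j \<longrightarrow> 1 \<le> ps j x"
        show "indicator N x \<le> ennreal (\<bar>ps j x\<bar> powr p)"
        proof (cases "x \<in> N")
          case True
          then have "1 powr p \<le> \<bar>ps j x\<bar> powr p" using x p_gt_1 by (intro powr_mono2) (auto simp: N_def)
          then show ?thesis using True ennreal_leI by fastforce
        qed simp
      qed
    qed
    also have "\<dots> = ennreal (lpint (ps j))"
      unfolding lpint_def by (rule nn_integral_eq_integral[OF Lp_int[OF F_Lp[OF ps_mem]]]) auto
    finally show ?thesis .
  qed
  have "(\<lambda>j. ennreal (lpint (\<lambda>x. 1 * ps j x))) \<longlonglongrightarrow> ennreal 0"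
    by (rule tendsto_ennrealI[OF scaled_ps(3)[of "\<lambda>_. 1" 1]]) auto
  then have "emeasure (completion \<mu>) N \<le> ennreal 0" using le by (intro LIMSEQ_le_const) auto
  then have "N \<in> null_sets (completion \<mu>)" using Nc by auto
  then show ?thesis by (rule AE_not_in)
qed

end

section \<open>Composition with maps on Euclidean space\<close>

context p_dirichlet
begin

lemma capacity_lessE:
  assumes "capacity p \<mu> E F U < ennreal e"
  obtains f where "f \<in> F" "AE x in completion \<mu>. x \<in> U \<longrightarrow> f x = 1" "lpint f < e" "E f < e"
proof -
  obtain f V where f: "f \<in> F" "U \<subseteq> V" "AE x in completion \<mu>. x \<in> V \<longrightarrow> f x = 1"
    "ennreal (lpint f + E f) < ennreal e"
    using assms unfolding capacity_def INF_less_iff Lp_norm_powr by blast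
  have "lpint f + E f < e" using f(4) by (simp add: ennreal_less_iff E_nonneg f(1) flip: ennreal_plus)
  moreover have "0 \<le> lpint f" "0 \<le> E f" by (simp_all add: E_nonneg f(1))
  ultimately have "lpint f < e" "E f < e" by linarith+
  moreover have "AE x in completion \<mu>. x \<in> U \<longrightarrow> f x = 1" using f(3) by eventually_elim (use f(2) in auto)
  ultimately show thesis using that f(1) by blast
qed

lemma lipschitz_abs: "1-lipschitz_on UNIV (abs :: real \<Rightarrow> real)"
  by (rule lipschitz_onI) (auto simp: dist_real_def)

lemma nest_exists:
  fixes \<phi> :: "'a \<Rightarrow> real ^ 'n"
  assumes qc: "\<And>i. quasicontinuous p \<mu> E F (\<lambda>x. \<phi> x $ i)"
  obtains Os ps where "dirichlet_nest p \<mu> E F \<Gamma> Os ps" "\<And>j i. continuous_on (- Os j) (\<lambda>x. \<phi> x $ i)"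
proof -
  define n where "n = real CARD('n)"
  have n: "1 \<le> n" unfolding n_def using zero_less_card_finite[where 'a = 'n] by linarith
  \<comment> \<open>The seminorms of the \<open>n\<close> components add up to
    \<open>n * \<delta> j\<close>, the required rate. The bound \<open>\<delta> j powr p / n\<close>
    imposed below compensates for the \<open>n\<close> summands in \<open>lpint_sum\<close>, whose
    factor \<open>n powr p\<close> is absorbed by \<open>\<delta> j\<close>.\<close>
  define \<delta> where "\<delta> j = 1 / (n * (real (Suc j))\<^sup>2)" for j
  have \<delta>: "0 < \<delta> j" for j using n unfolding \<delta>_def by (intro divide_pos_pos mult_pos_pos) auto
  define Q where "Q i j U f \<longleftrightarrow> open U \<and> continuous_on (- U) (\<lambda>x. \<phi> x $ i) \<and> f \<in> F \<and> (AE x in completion \<mu>. x \<in> U \<longrightarrow> f x = 1)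
      \<and> lpint f < \<delta> j powr p / n \<and> E f < \<delta> j powr p / n" for i j U and f :: "'a \<Rightarrow> real"
  have "\<exists>U f. Q i j U f" for i j
  proof -
    have "0 < \<delta> j powr p / n" using n \<delta>[of j] by simp
    then obtain U where U: "open U" "capacity p \<mu> E F U < ennreal (\<delta> j powr p / n)" "continuous_on (- U) (\<lambda>x. \<phi> x $ i)"
      using qc[of i] unfolding quasicontinuous_def by blast
    obtain f where "f \<in> F" "AE x in completion \<mu>. x \<in> U \<longrightarrow> f x = 1" "lpint f < \<delta> j powr p / n" "E f < \<delta> j powr p / n"
      by (rule capacity_lessE[OF U(2)])
    then show ?thesis using U(1,3) unfolding Q_def by (intro exI[of _ U] exI[of _ f]) simp
  qed
  then obtain U f where "\<And>i j. Q i j (U i j) (f i j)" by metis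
  then have U: "\<And>i j. open (U i j)" "\<And>i j. continuous_on (- U i j) (\<lambda>x. \<phi> x $ i)"
    and f: "\<And>i j. f i j \<in> F" "\<And>i j. AE x in completion \<mu>. x \<in> U i j \<longrightarrow> f i j x = 1"
      "\<And>i j. lpint (f i j) < \<delta> j powr p / n" "\<And>i j. E (f i j) < \<delta> j powr p / n"
    unfolding Q_def by blast+
  define Os where "Os j = (\<Union>i. U i j)" for j
  define ps where "ps j x = (\<Sum>i\<in>UNIV. \<bar>f i j x\<bar>)" for j x
  have af: "(\<lambda>x. \<bar>f i j x\<bar>) \<in> F" for i j by (rule lip_mem[OF f(1) lipschitz_abs]) simp
  have psF: "ps j \<in> F" for j unfolding ps_def by (rule sum_mem) (auto intro: af)
  have "dirichlet_nest p \<mu> E F \<Gamma> Os ps"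
  proof (intro dirichlet_nest.intro p_dirichlet_axioms dirichlet_nest_axioms.intro)
    show "open (Os j)" for j unfolding Os_def using U(1) by blast
    show "ps j \<in> F" for j by (rule psF)
    show "0 \<le> ps j x" for j x unfolding ps_def by (rule sum_nonneg) simp
    fix j
    have "AE x in completion \<mu>. \<forall>i. x \<in> U i j \<longrightarrow> f i j x = 1" using f(2) by (simp add: AE_all_countable)
    then show "AE x in completion \<mu>. x \<in> Os j \<longrightarrow> 1 \<le> ps j x"
    proof eventually_elim
      fix x assume x: "\<forall>i. x \<in> U i j \<longrightarrow> f i j x = 1"
      show "x \<in> Os j \<longrightarrow> 1 \<le> ps j x"
      proof
        assume "x \<in> Os j"
        then obtain i where "x \<in> U i j" by (auto simp: Os_def)
        then have "1 = \<bar>f i j x\<bar>" using x by simp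
        also have "\<dots> \<le> ps j x" unfolding ps_def by (rule member_le_sum) auto
        finally show "1 \<le> ps j x" .
      qed
    qed
    have g: "gam (\<lambda>x. \<bar>f i j x\<bar>) UNIV \<le> \<delta> j" for i
    proof -
      have "\<delta> j powr p / n \<le> \<delta> j powr p / 1" using n \<delta>[of j] by (intro divide_left_mono) auto
      then have "gam (f i j) UNIV \<le> \<delta> j"
        using f(4)[of i j] \<Gamma>_total[OF f(1), of i j] \<delta>[of j] by (subst gam_le_iff) auto
      then show ?thesis using gam_lip[OF f(1) lipschitz_abs, of UNIV i j] by simp
    qed
    have "gam (ps j) UNIV \<le> (\<Sum>i\<in>UNIV. gam (\<lambda>x. \<bar>f i j x\<bar>) UNIV)" unfolding ps_def by (rule gam_sum) (auto intro: af)
    also have "\<dots> \<le> (\<Sum>i\<in>(UNIV::'n set). \<delta> j)" by (intro sum_mono g)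
    also have "\<dots> = 1 / (real (Suc j))\<^sup>2" using n by (simp add: \<delta>_def n_def[symmetric] del: of_nat_Suc)
    finally show "gam (ps j) UNIV \<le> 1 / (real (Suc j))\<^sup>2" .
    have "lpint (ps j) \<le> real (card (UNIV::'n set)) powr p * (\<Sum>i\<in>UNIV. lpint (\<lambda>x. \<bar>f i j x\<bar>))"
      using psF[of j] unfolding ps_def by (intro lpint_sum F_Lp af) auto
    also have "\<dots> \<le> n powr p * (\<Sum>i\<in>(UNIV::'n set). \<delta> j powr p / n)"
      unfolding n_def[symmetric] using f(3) by (intro mult_left_mono sum_mono) (auto simp: lpint_def intro: less_imp_le)
    also have "\<dots> = n powr p * \<delta> j powr p" using n by (simp add: n_def[symmetric])
    also have "\<dots> = (n * \<delta> j) powr p" using n \<delta>[of j] by (simp add: powr_mult)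
    also have "n * \<delta> j = 1 / (real (Suc j))\<^sup>2" using n by (simp add: \<delta>_def del: of_nat_Suc)
    finally show "lpint (ps j) \<le> (1 / (real (Suc j))\<^sup>2) powr p" .
  qed
  moreover have "continuous_on (- Os j) (\<lambda>x. \<phi> x $ i)" for i j
    by (rule continuous_on_subset[OF U(2)[of i j]]) (auto simp: Os_def)
  ultimately show thesis using that by blast
qed

lemma gam_le_imp: "gam f B \<le> gam g C \<Longrightarrow> measure (\<Gamma> f) B \<le> measure (\<Gamma> g) C"
  using gam_le_iff[of "gam g C" f B] by (simp add: gam_powr)

end

text \<open>Members of \<open>F\<close> are measurable only for the completion of
  \<open>\<mu>\<close>. Borel measurability of \<open>\<phi>\<close> is arranged in the final proof
  by a modification on \<open>N\<close>.\<close>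

locale dirichlet_map = dirichlet_nest p \<mu> E F \<Gamma> Os ps
  for p and \<mu> :: "'a::metric_space measure" and E F \<Gamma> Os ps +
  fixes \<phi> :: "'a \<Rightarrow> real ^ 'n"
  assumes comp_mem: "(\<lambda>x. \<phi> x $ i) \<in> F" and comp_qc: "qc (\<lambda>x. \<phi> x $ i)"
    and phi_borel [measurable]: "\<phi> \<in> borel_measurable borel"
begin

abbreviation "\<Lambda> \<equiv> total_energy_measure \<Gamma> \<phi>"

lemma space_Lambda [simp]: "space \<Lambda> = UNIV"
  using sets_eq_imp_space_eq[OF sets_total_energy_measure, of \<Gamma> \<phi>] by simp

lemma emeasure_Lambda: "B \<in> sets borel \<Longrightarrow> emeasure \<Lambda> B = (\<Sum>i\<in>UNIV. emeasure (\<Gamma> (\<lambda>x. \<phi> x $ i)) B)"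
  by (rule emeasure_total_energy_measure) (rule sets_\<Gamma>[OF comp_mem])

lemma finite_Lambda: "finite_measure \<Lambda>"
proof (rule finite_measureI)
  have "emeasure \<Lambda> UNIV = (\<Sum>i\<in>UNIV. emeasure (\<Gamma> (\<lambda>x. \<phi> x $ i)) UNIV)" by (rule emeasure_Lambda) simp
  also have "\<dots> = (\<Sum>i\<in>UNIV. ennreal (measure (\<Gamma> (\<lambda>x. \<phi> x $ i)) UNIV))"
    using finite_measure.emeasure_eq_measure[OF finite_\<Gamma>[OF comp_mem]] by simp
  also have "\<dots> < \<infinity>" by simp
  finally show "emeasure \<Lambda> (space \<Lambda>) \<noteq> \<infinity>" by simp
qed

lemma measure_Lambda:
  assumes "B \<in> sets borel"
  shows "measure \<Lambda> B = (\<Sum>i\<in>UNIV. measure (\<Gamma> (\<lambda>x. \<phi> x $ i)) B)"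
proof -
  have "ennreal (measure \<Lambda> B) = (\<Sum>i\<in>UNIV. ennreal (measure (\<Gamma> (\<lambda>x. \<phi> x $ i)) B))"
    using emeasure_Lambda[OF assms] finite_measure.emeasure_eq_measure[OF finite_\<Gamma>[OF comp_mem]]
      finite_measure.emeasure_eq_measure[OF finite_Lambda] by simp
  also have "\<dots> = ennreal (\<Sum>i\<in>UNIV. measure (\<Gamma> (\<lambda>x. \<phi> x $ i)) B)" by (rule sum_ennreal) simp
  finally show ?thesis by (simp add: ennreal_inj sum_nonneg)
qed

lemma measure_comp_le: "B \<in> sets borel \<Longrightarrow> measure (\<Gamma> (\<lambda>x. \<phi> x $ i)) B \<le> measure \<Lambda> B"
  unfolding measure_Lambda by (rule member_le_sum) auto

lemma gam_comp_le: "B \<in> sets borel \<Longrightarrow> gam (\<lambda>x. \<phi> x $ i) B \<le> measure \<Lambda> B powr (1 / p)"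
  unfolding gam_def using measure_comp_le p_gt_1 by (intro powr_mono2) auto

lemma qc_comp:
  assumes "continuous_on UNIV (h :: real ^ 'n \<Rightarrow> real)"
  shows "qc (\<lambda>x. h (\<phi> x))"
  unfolding qc_def
proof
  fix j
  have "continuous_on (- Os j) (\<lambda>x. \<chi> i. \<phi> x $ i)"
    using comp_qc by (intro continuous_on_vec_lambda) (auto simp: qc_def)
  then have "continuous_on (- Os j) \<phi>" by simp
  then show "continuous_on (- Os j) (\<lambda>x. h (\<phi> x))"
    by (rule continuous_on_compose2[OF assms]) simp
qed

definition energy_le :: "real \<Rightarrow> ('a \<Rightarrow> real) \<Rightarrow> bool" where
  "energy_le C f \<longleftrightarrow> 0 \<le> C \<and> f \<in> F \<and> (\<forall>B\<in>sets borel. measure (\<Gamma> f) B \<le> C powr p * measure \<Lambda> B)"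

lemma energy_leD: "energy_le C f \<Longrightarrow> B \<in> sets borel \<Longrightarrow> measure (\<Gamma> f) B \<le> C powr p * measure \<Lambda> B"
  by (simp add: energy_le_def)

lemma energy_le_gamI:
  assumes "0 \<le> C" "f \<in> F" "\<And>B. B \<in> sets borel \<Longrightarrow> gam f B \<le> C * measure \<Lambda> B powr (1 / p)"
  shows "energy_le C f"
  unfolding energy_le_def
proof (intro conjI ballI assms)
  fix B :: "'a set" assume "B \<in> sets borel"
  from assms(3)[OF this] have "measure (\<Gamma> f) B \<le> (C * measure \<Lambda> B powr (1 / p)) powr p"
    using assms(1) by (subst (asm) gam_le_iff) auto
  then show "measure (\<Gamma> f) B \<le> C powr p * measure \<Lambda> B" using assms(1) p_gt_1 by (simp add: powr_mult powr_powr)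
qed

lemma energy_le_gam_UNIV:
  assumes "energy_le C f"
  shows "gam f UNIV \<le> C * measure \<Lambda> UNIV powr (1 / p)"
  using assms p_gt_1 unfolding energy_le_def
  by (subst gam_le_iff) (auto simp: powr_mult powr_powr)

text \<open>Where \<open>f x - k x \<le> a\<close>, the minimum is \<open>f\<close> minus a function
  without energy on that set; on the complement it is \<open>k\<close> plus such a function. The
  bound therefore keeps the same \<open>C\<close>, and any number of minima can be taken.\<close>

lemma energy_le_min:
  assumes f: "energy_le C f" "qc f" "f \<in> borel_measurable borel"
    and k: "energy_le C k" "qc k" "k \<in> borel_measurable borel" and a: "0 \<le> a"
  shows "energy_le C (\<lambda>x. min (f x) (a + k x))"
  unfolding energy_le_def
proof (intro conjI ballI)
  note [measurable] = f(3) k(3)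
  have fF: "f \<in> F" and kF: "k \<in> F" and C: "0 \<le> C" using f k by (auto simp: energy_le_def)
  let ?s = "\<lambda>x. f x - k x"
  let ?r = "\<lambda>x. min (f x) (a + k x)"
  have sF: "?s \<in> F" by (rule diff_mem[OF fF kF])
  have sqc: "qc ?s" using f(2) k(2) by (auto simp: qc_def intro: continuous_intros)
  have pF: "(\<lambda>x. max 0 (?s x - a)) \<in> F" by (rule lip_mem[OF sF lipschitz_max0]) (use a in simp)
  have tF: "(\<lambda>x. min (?s x) a) \<in> F" by (rule lip_mem[OF sF lipschitz_min]) (use a in simp)
  have r1: "?r = (\<lambda>x. f x - max 0 (?s x - a))" and r2: "?r = (\<lambda>x. k x + min (?s x) a)"
    by (auto simp: fun_eq_iff max_def min_def)
  show "?r \<in> F" unfolding r2 by (rule add_mem[OF kF tF])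
  then have rF: "?r \<in> F" .
  show "0 \<le> C" by fact
  fix B :: "'a set" assume B [measurable]: "B \<in> sets borel"
  define B1 where "B1 = B \<inter> {x \<in> space borel. ?s x \<le> a}"
  define B2 where "B2 = B \<inter> {x \<in> space borel. a < ?s x}"
  have B12 [measurable]: "B1 \<in> sets borel" "B2 \<in> sets borel" unfolding B1_def B2_def by measurable
  have un: "B = B1 \<union> B2" "B1 \<inter> B2 = {}" by (auto simp: B1_def B2_def)
  have "gam ?r B1 \<le> gam f B1 + gam (\<lambda>x. max 0 (?s x - a)) B1" unfolding r1 by (rule gam_diff[OF fF pF B12(1)])
  also have "gam (\<lambda>x. max 0 (?s x - a)) B1 = 0"
    by (rule gam_positive_part[OF sF sqc a B12(1)]) (auto simp: B1_def)
  finally have "measure (\<Gamma> ?r) B1 \<le> measure (\<Gamma> f) B1" by (intro gam_le_imp) simp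
  then have 1: "measure (\<Gamma> ?r) B1 \<le> C powr p * measure \<Lambda> B1" using energy_leD[OF f(1) B12(1)] by (rule order_trans)
  have "gam ?r B2 \<le> gam k B2 + gam (\<lambda>x. min (?s x) a) B2" unfolding r2 by (rule gam_add[OF kF tF B12(2)])
  also have "gam (\<lambda>x. min (?s x) a) B2 = 0"
    by (rule gam_truncation[OF sF sqc a B12(2)]) (auto simp: B2_def)
  finally have "measure (\<Gamma> ?r) B2 \<le> measure (\<Gamma> k) B2" by (intro gam_le_imp) simp
  then have 2: "measure (\<Gamma> ?r) B2 \<le> C powr p * measure \<Lambda> B2" using energy_leD[OF k(1) B12(2)] by (rule order_trans)
  have "measure (\<Gamma> ?r) B = measure (\<Gamma> ?r) B1 + measure (\<Gamma> ?r) B2"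
    unfolding un(1) using B12 un(2) sets_\<Gamma>[OF rF] by (intro finite_measure.finite_measure_Union finite_\<Gamma>[OF rF]) auto
  moreover have "measure \<Lambda> B = measure \<Lambda> B1 + measure \<Lambda> B2"
    unfolding un(1) using B12 un(2) by (intro finite_measure.finite_measure_Union finite_Lambda) auto
  ultimately show "measure (\<Gamma> ?r) B \<le> C powr p * measure \<Lambda> B" using 1 2 by (simp add: distrib_left)
qed

text \<open>Cones are built from this norm because it is a sum of functions of one coordinate
  each.\<close>

definition l1 :: "real ^ 'n \<Rightarrow> real" where "l1 z = (\<Sum>i\<in>UNIV. \<bar>z $ i\<bar>)"

lemma norm_le_l1: "norm z \<le> l1 z" unfolding l1_def by (rule norm_le_l1_cart)

lemma continuous_l1: "continuous_on S f \<Longrightarrow> continuous_on S (\<lambda>z. l1 (f z))"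
  unfolding l1_def by (intro continuous_intros)

lemma l1_mem: "(\<lambda>x. l1 (\<phi> x)) \<in> F"
  unfolding l1_def by (rule sum_mem) (auto intro!: lip_mem[OF comp_mem lipschitz_abs])

text \<open>Subtracting \<open>l1 y\<close> makes each one-variable summand vanish at 0, as the
  composition axiom demands. The dimension factor comes from the triangle inequality.\<close>

lemma energy_le_cone:
  assumes L: "0 \<le> L"
  shows "energy_le (L * real CARD('n)) (\<lambda>x. L * (l1 (\<phi> x - y) - l1 y))"
proof (rule energy_le_gamI)
  let ?g = "\<lambda>i t. L * (\<bar>t - y $ i\<bar> - \<bar>y $ i\<bar>)"
  have lip: "L-lipschitz_on UNIV (?g i)" for i
  proof (rule lipschitz_onI)
    fix s t
    have "dist (?g i s) (?g i t) = L * \<bar>\<bar>s - y $ i\<bar> - \<bar>t - y $ i\<bar>\<bar>"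
      using L by (simp add: dist_real_def abs_mult flip: right_diff_distrib)
    also have "\<dots> \<le> L * \<bar>s - t\<bar>" using L by (intro mult_left_mono) auto
    finally show "dist (?g i s) (?g i t) \<le> L * dist s t" by (simp add: dist_real_def)
  qed (rule L)
  have mem: "(\<lambda>x. ?g i (\<phi> x $ i)) \<in> F" for i by (rule lip_mem[OF comp_mem lip]) simp
  have eq: "(\<lambda>x. L * (l1 (\<phi> x - y) - l1 y)) = (\<lambda>x. \<Sum>i\<in>UNIV. ?g i (\<phi> x $ i))"
    by (simp add: l1_def sum_subtractf[symmetric] sum_distrib_left)
  show "(\<lambda>x. L * (l1 (\<phi> x - y) - l1 y)) \<in> F" unfolding eq by (rule sum_mem) (auto intro: mem)
  show "0 \<le> L * real CARD('n)" using L by simp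
  fix B :: "'a set" assume B: "B \<in> sets borel"
  have "gam (\<lambda>x. L * (l1 (\<phi> x - y) - l1 y)) B \<le> (\<Sum>i\<in>UNIV. gam (\<lambda>x. ?g i (\<phi> x $ i)) B)"
    unfolding eq by (rule gam_sum) (auto intro: mem B)
  also have "\<dots> \<le> (\<Sum>i\<in>(UNIV::'n set). L * measure \<Lambda> B powr (1 / p))"
  proof (rule sum_mono)
    fix i
    have "gam (\<lambda>x. ?g i (\<phi> x $ i)) B \<le> L * gam (\<lambda>x. \<phi> x $ i) B" by (rule gam_lip[OF comp_mem lip]) (auto simp: B)
    also have "\<dots> \<le> L * measure \<Lambda> B powr (1 / p)" using L by (intro mult_left_mono gam_comp_le B)
    finally show "gam (\<lambda>x. ?g i (\<phi> x $ i)) B \<le> L * measure \<Lambda> B powr (1 / p)" .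
  qed
  also have "\<dots> = L * real CARD('n) * measure \<Lambda> B powr (1 / p)" by simp
  finally show "gam (\<lambda>x. L * (l1 (\<phi> x - y) - l1 y)) B \<le> L * real CARD('n) * measure \<Lambda> B powr (1 / p)" .
qed

text \<open>Only compositions with functions of one variable are given. A Lipschitz function of several variables is a
  decreasing limit of minima of finitely many cones \<open>h y + L |z - y|\<close>, which are built from such compositions.\<close>

theorem energy_le_lipschitz:
  assumes h: "L-lipschitz_on UNIV h" and h0: "h 0 = 0"
  shows "energy_le (L * real CARD('n)) (\<lambda>x. h (\<phi> x))"
proof -
  have L: "0 \<le> L" using h by (rule lipschitz_on_nonneg)
  have hl: "\<bar>h z - h w\<bar> \<le> L * l1 (z - w)" for z w
  proof -
    have "\<bar>h z - h w\<bar> \<le> L * norm (z - w)" using lipschitz_onD[OF h, of z w] by (simp add: dist_norm dist_real_def)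
    also have "\<dots> \<le> L * l1 (z - w)" using L norm_le_l1 by (intro mult_left_mono)
    finally show ?thesis .
  qed
  obtain D :: "(real ^ 'n) set" where D: "countable D" "\<And>X. open X \<Longrightarrow> X \<noteq> {} \<Longrightarrow> \<exists>d\<in>D. d \<in> X"
    using countable_dense_setE by blast
  define y where "y = from_nat_into D"
  \<comment> \<open>Running minima of cones with apexes on the graph of \<open>h\<close> over a
    dense sequence, starting with the cone at 0. The offset \<open>h (y m) + L * l1 (y m)\<close>
    undoes the normalisation of \<open>energy_le_cone\<close>.\<close>
  define P where "P = rec_nat (\<lambda>z. L * (l1 (z - 0) - l1 0)) (\<lambda>m Q z. min (Q z) ((h (y m) + L * l1 (y m)) + L * (l1 (z - y m) - l1 (y m))))"
  have P0: "P 0 = (\<lambda>z. L * (l1 (z - 0) - l1 0))"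
    and PS: "P (Suc m) = (\<lambda>z. min (P m z) ((h (y m) + L * l1 (y m)) + L * (l1 (z - y m) - l1 (y m))))" for m
    by (simp_all add: P_def)
  have contP: "continuous_on UNIV (P m)" for m
    by (induction m) (auto simp: P0 PS intro!: continuous_intros continuous_l1)
  have borelP: "(\<lambda>x. P m (\<phi> x)) \<in> borel_measurable borel" for m
    using borel_measurable_continuous_onI[OF contP[of m]] by measurable
  \<comment> \<open>The cone lies above \<open>h\<close>, hence is nonnegative at 0; this is the
    condition on the offset in \<open>energy_le_min\<close>.\<close>
  have a: "0 \<le> h (y m) + L * l1 (y m)" for m using hl[of "y m" 0] h0 by (simp add: abs_le_iff)
  have eP: "energy_le (L * real CARD('n)) (\<lambda>x. P m (\<phi> x))" for m
  proof (induction m)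
    case 0
    show ?case unfolding P0 by (rule energy_le_cone[OF L])
  next
    case (Suc m)
    have c: "continuous_on UNIV (\<lambda>z. L * (l1 (z - y m) - l1 (y m)))" by (intro continuous_intros continuous_l1)
    have b: "(\<lambda>x. L * (l1 (\<phi> x - y m) - l1 (y m))) \<in> borel_measurable borel"
      using borel_measurable_continuous_onI[OF c] by measurable
    show ?case unfolding PS
      by (rule energy_le_min[OF Suc qc_comp[OF contP] borelP energy_le_cone[OF L] qc_comp[OF c] b a])
  qed
  have lower: "h z \<le> P m z" for m z
  proof (induction m)
    case 0
    show ?case using hl[of z 0] h0 by (simp add: P0 l1_def abs_le_iff)
  next
    case (Suc m)
    then show ?case using hl[of z "y m"] by (simp add: PS algebra_simps abs_le_iff)
  qed
  have upper: "P m z \<le> L * l1 z" for m z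
    by (induction m) (auto simp: P0 PS l1_def min.coboundedI1)
  have lim: "(\<lambda>m. P m z) \<longlonglongrightarrow> h z" for z
  proof (rule LIMSEQ_I)
    fix e :: real assume e: "0 < e"
    let ?X = "{w. 2 * L * l1 (w - z) < e}"
    have "open ?X" by (intro open_Collect_less continuous_intros continuous_l1)
    moreover have "z \<in> ?X" using e by (simp add: l1_def)
    ultimately obtain d where d: "d \<in> D" "2 * L * l1 (d - z) < e" using D(2)[of ?X] by blast
    obtain k where k: "y k = d" using from_nat_into_surj[OF D(1) d(1)] by (auto simp: y_def)
    have sym: "l1 (z - d) = l1 (d - z)" by (simp add: l1_def abs_minus_commute)
    have "P m z < h z + e" if "m \<ge> Suc k" for m
      using that
    proof (induction m rule: dec_induct)
      case base
      have "P (Suc k) z \<le> h d + L * l1 (z - d)" by (simp add: PS k algebra_simps)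
      also have "\<dots> < h z + e" using hl[of d z] d(2) sym by (simp add: abs_le_iff)
      finally show ?case .
    next
      case (step m)
      then show ?case by (simp add: PS)
    qed
    then show "\<exists>no. \<forall>m\<ge>no. norm (P m z - h z) < e" using lower[of z] by (intro exI[of _ "Suc k"]) force
  qed
  \<comment> \<open>A dominating function for the convergence in the \<open>p\<close>-norm:
    \<open>\<mu>\<close> may be infinite, but \<open>l1 (\<phi> x)\<close> belongs to
    \<open>F\<close>.\<close>
  have bd: "\<bar>P m z - h z\<bar> \<le> 2 * L * \<bar>l1 z\<bar>" for m z
  proof -
    have "\<bar>h z\<bar> \<le> L * l1 z" using hl[of z 0] h0 by simp
    moreover have "l1 z \<ge> 0" by (simp add: l1_def sum_nonneg)
    ultimately show ?thesis using lower[of z m] upper[of m z] by (simp add: abs_le_iff)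
  qed
  have PF: "(\<lambda>x. P m (\<phi> x)) \<in> F" for m using eP by (simp add: energy_le_def)
  have measF: "g \<in> borel_measurable (completion \<mu>)" if "g \<in> F" for g by (rule Lp_meas[OF F_Lp[OF that]])
  have hmeas: "(\<lambda>x. h (\<phi> x)) \<in> borel_measurable (completion \<mu>)"
    by (rule borel_measurable_LIMSEQ_real[of _ "\<lambda>m x. P m (\<phi> x)"]) (use lim measF[OF PF] in auto)
  have limp: "(\<lambda>m. lpint (\<lambda>x. P m (\<phi> x) - h (\<phi> x))) \<longlonglongrightarrow> 0"
    by (rule lpint_dominated[OF F_Lp[OF l1_mem] _ hmeas, of _ "2 * L"]) (use bd lim measF[OF PF] in auto)
  have hLp: "(\<lambda>x. h (\<phi> x)) \<in> Lp_space p \<mu>"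
    by (rule Lp_bounded[OF F_Lp[OF l1_mem] hmeas, of L]) (use hl[of _ 0] h0 in \<open>auto simp: l1_def sum_nonneg\<close>)
  note gU = energy_le_gam_UNIV[OF eP]
  have hF: "(\<lambda>x. h (\<phi> x)) \<in> F" by (rule limit_mem'[OF hLp PF limp gU])
  show ?thesis
    unfolding energy_le_def
  proof (intro conjI ballI hF)
    show "0 \<le> L * real CARD('n)" using L by simp
    fix B :: "'a set" assume B: "B \<in> sets borel"
    show "measure (\<Gamma> (\<lambda>x. h (\<phi> x))) B \<le> (L * real CARD('n)) powr p * measure \<Lambda> B"
      by (rule Gamma_limit_le[OF hF PF limp gU B _ tendsto_const]) (use eP B in \<open>auto simp: energy_le_def\<close>)
  qed
qed

end

text \<open>McShane's formula, the infimum of the cones of slope \<open>\<eta>\<close> with apexes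
  on the graph over \<open>V\<close>.\<close>

lemma lipschitz_extension:
  fixes h :: "'m::metric_space \<Rightarrow> real"
  assumes h: "\<eta>-lipschitz_on V h" and V: "V \<noteq> {}"
  obtains k where "\<eta>-lipschitz_on UNIV k" "\<And>z. z \<in> V \<Longrightarrow> k z = h z"
proof -
  define k where "k z = (INF w\<in>V. h w + \<eta> * dist z w)" for z
  have \<eta>: "0 \<le> \<eta>" using h by (rule lipschitz_on_nonneg)
  have lb: "h w0 - \<eta> * dist z w0 \<le> h w + \<eta> * dist z w" if "w0 \<in> V" "w \<in> V" for w0 w z
  proof -
    have "h w0 - h w \<le> \<eta> * dist w0 w" using lipschitz_onD[OF h that] by (simp add: dist_real_def abs_le_iff)
    also have "\<dots> \<le> \<eta> * (dist z w0 + dist z w)"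
      using \<eta> dist_triangle3[of w0 w z] by (intro mult_left_mono) (auto simp: dist_commute)
    finally show ?thesis by (simp add: distrib_left)
  qed
  have bdd: "bdd_below ((\<lambda>w. h w + \<eta> * dist z w) ` V)" for z
    using V lb by (meson bdd_belowI2 ex_in_conv)
  have le: "k z \<le> h w + \<eta> * dist z w" if "w \<in> V" for z w
    unfolding k_def using bdd that by (rule cINF_lower)
  have "k z \<le> k z' + \<eta> * dist z z'" for z z'
  proof -
    have "k z - \<eta> * dist z z' \<le> k z'"
      unfolding k_def[of z']
    proof (rule cINF_greatest[OF V])
      fix w assume w: "w \<in> V"
      have "\<eta> * dist z w \<le> \<eta> * (dist z z' + dist z' w)" using \<eta> by (intro mult_left_mono dist_triangle)
      then show "k z - \<eta> * dist z z' \<le> h w + \<eta> * dist z' w" using le[OF w, of z] by (simp add: distrib_left)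
    qed
    then show ?thesis by simp
  qed
  note * = this
  have "\<eta>-lipschitz_on UNIV k"
  proof (rule lipschitz_onI)
    show "dist (k x) (k y) \<le> \<eta> * dist x y" for x y
      using *[of x y] *[of y x] by (simp add: dist_real_def dist_commute abs_le_iff)
  qed (rule \<eta>)
  moreover have "k z = h z" if "z \<in> V" for z
  proof (rule antisym)
    show "k z \<le> h z" using le[OF that, of z] by simp
    show "h z \<le> k z" unfolding k_def using lb[OF that, of _ z] by (intro cINF_greatest V) simp
  qed
  ultimately show thesis by (rule that)
qed

lemma lipschitz_on_gradient:
  fixes h :: "'b::euclidean_space \<Rightarrow> real"
  assumes "convex S" "\<And>z. z \<in> S \<Longrightarrow> (h has_derivative (\<lambda>v. g z \<bullet> v)) (at z)" "\<And>z. z \<in> S \<Longrightarrow> norm (g z) \<le> C" "0 \<le> C"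
  shows "C-lipschitz_on S h"
proof (rule lipschitz_onI)
  fix x y assume "x \<in> S" "y \<in> S"
  then have "norm (h x - h y) \<le> C * norm (x - y)"
  proof (intro differentiable_bound[OF assms(1)])
    show "(h has_derivative (\<lambda>v. g z \<bullet> v)) (at z within S)" if "z \<in> S" for z
      using assms(2)[OF that] by (rule has_derivative_at_withinI)
    fix z assume z: "z \<in> S"
    show "onorm (\<lambda>v. g z \<bullet> v) \<le> C"
    proof (rule onorm_bound[OF assms(4)])
      fix v
      have "norm (g z \<bullet> v) \<le> norm (g z) * norm v" using Cauchy_Schwarz_ineq2 by simp
      also have "\<dots> \<le> C * norm v" using assms(3)[OF z] by (rule mult_right_mono) simp
      finally show "norm (g z \<bullet> v) \<le> C * norm v" .
    qed
  qed
  then show "dist (h x) (h y) \<le> C * dist x y" by (simp add: dist_norm)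
qed (rule assms)

context dirichlet_map
begin

lemma vimage_borel [measurable]: "V \<in> sets borel \<Longrightarrow> \<phi> -` V \<in> sets borel"
  using measurable_sets_borel[OF phi_borel] by simp

text \<open>A global \<open>\<eta>\<close>-Lipschitz extension of \<open>h\<close> from
  \<open>V\<close> has energy governed by \<open>\<eta>\<close>. Its difference from
  \<open>h\<close> is constant on \<open>V\<close>, so by \<open>gam_level_set\<close> that
  difference contributes nothing over the preimage.\<close>

lemma energy_on_lipschitz_set:
  assumes h: "L-lipschitz_on UNIV h" "h 0 = 0" and V: "V \<noteq> {}" "V \<in> sets borel"
    and loc: "\<eta>-lipschitz_on V h" and B: "B \<in> sets borel"
  shows "measure (\<Gamma> (\<lambda>x. h (\<phi> x))) (B \<inter> \<phi> -` V) \<le> (\<eta> * real CARD('n)) powr p * measure \<Lambda> (B \<inter> \<phi> -` V)"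
proof -
  obtain k where k: "\<eta>-lipschitz_on UNIV k" "\<And>z. z \<in> V \<Longrightarrow> k z = h z" using lipschitz_extension[OF loc V(1)] by blast
  define k' where "k' z = k z - k 0" for z
  have k': "\<eta>-lipschitz_on UNIV k'" "k' 0 = 0"
    using k(1) by (auto simp: k'_def lipschitz_on_def dist_real_def)
  have e: "energy_le (\<eta> * real CARD('n)) (\<lambda>x. k' (\<phi> x))" by (rule energy_le_lipschitz[OF k'])
  then have kF: "(\<lambda>x. k' (\<phi> x)) \<in> F" by (simp add: energy_le_def)
  have hF: "(\<lambda>x. h (\<phi> x)) \<in> F" using energy_le_lipschitz[OF h] by (simp add: energy_le_def)
  let ?C = "B \<inter> \<phi> -` V"
  have C: "?C \<in> sets borel" using B V(2) by simp
  have dF: "(\<lambda>x. h (\<phi> x) - k' (\<phi> x)) \<in> F" by (rule diff_mem[OF hF kF])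
  have "continuous_on UNIV (\<lambda>z. h z - k' z)"
    using lipschitz_on_continuous_on[OF h(1)] lipschitz_on_continuous_on[OF k'(1)] by (intro continuous_intros)
  then have dqc: "qc (\<lambda>x. h (\<phi> x) - k' (\<phi> x))" by (rule qc_comp)
  have "gam (\<lambda>x. k' (\<phi> x) + (h (\<phi> x) - k' (\<phi> x))) ?C \<le> gam (\<lambda>x. k' (\<phi> x)) ?C + gam (\<lambda>x. h (\<phi> x) - k' (\<phi> x)) ?C"
    by (rule gam_add[OF kF dF C])
  also have "gam (\<lambda>x. h (\<phi> x) - k' (\<phi> x)) ?C = 0"
    by (rule gam_level_set[OF dF dqc C, of "k 0"]) (auto simp: k'_def k(2))
  finally have "gam (\<lambda>x. h (\<phi> x)) ?C \<le> gam (\<lambda>x. k' (\<phi> x)) ?C" by simp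
  then have "measure (\<Gamma> (\<lambda>x. h (\<phi> x))) ?C \<le> measure (\<Gamma> (\<lambda>x. k' (\<phi> x))) ?C" by (rule gam_le_imp)
  also have "\<dots> \<le> (\<eta> * real CARD('n)) powr p * measure \<Lambda> ?C" by (rule energy_leD[OF e C])
  finally show ?thesis .
qed

lemma integrable_powr_Lambda:
  assumes "f \<in> borel_measurable borel" "\<And>x. 0 \<le> f x" "\<And>x. f x \<le> C" and B: "B \<in> sets borel"
  shows "integrable \<Lambda> (\<lambda>x. indicator B x * f x powr p)"
proof (rule finite_measure.integrable_const_bound[OF finite_Lambda, of _ "C powr p"])
  have "indicator B x * f x powr p \<le> C powr p" for x
    using assms(2,3)[of x] p_gt_1 by (auto simp: indicator_def intro!: powr_mono2)
  then show "AE x in \<Lambda>. norm (indicator B x * f x powr p) \<le> C powr p" by (simp add: abs_mult)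
  show "(\<lambda>x. indicator B x * f x powr p) \<in> borel_measurable \<Lambda>"
    using B assms(1) by (simp cong: measurable_cong_sets)
qed

text \<open>On a ball where \<open>g\<close> stays within \<open>\<eta>\<close> of its value at the
  centre \<open>z\<close>, \<open>h\<close> has Lipschitz constant
  \<open>norm (g z) + \<eta>\<close>. Replacing \<open>g z\<close> by \<open>g (\<phi> x)\<close>
  costs another \<open>\<eta>\<close>. A countable subcover, made disjoint, allows the local bounds
  to be added.\<close>

theorem chain_rule_bound:
  fixes h :: "real ^ 'n \<Rightarrow> real"
  assumes der: "\<And>z. (h has_derivative (\<lambda>v. g z \<bullet> v)) (at z)" and g: "continuous_on UNIV g"
    and L: "\<And>z. norm (g z) \<le> L" and h0: "h 0 = 0" and \<eta>: "0 < \<eta>" and B: "B \<in> sets borel"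
  shows "measure (\<Gamma> (\<lambda>x. h (\<phi> x))) B
    \<le> (\<integral>x. indicator B x * (real CARD('n) * (norm (g (\<phi> x)) + 2 * \<eta>)) powr p \<partial>\<Lambda>)"
proof -
  have L0: "0 \<le> L" using L[of 0] norm_ge_zero order_trans by blast
  have lip: "L-lipschitz_on UNIV h" by (rule lipschitz_on_gradient) (use der L L0 in auto)
  have hF: "(\<lambda>x. h (\<phi> x)) \<in> F" using energy_le_lipschitz[OF lip h0] by (simp add: energy_le_def)
  define f where "f x = (real CARD('n) * (norm (g (\<phi> x)) + 2 * \<eta>))" for x
  have [measurable]: "g \<in> borel_measurable borel" using g by (rule borel_measurable_continuous_onI)
  have fm [measurable]: "f \<in> borel_measurable borel" unfolding f_def by measurable
  have f0: "0 \<le> f x" for x using \<eta> by (simp add: f_def)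
  have fC: "f x \<le> real CARD('n) * (L + 2 * \<eta>)" for x unfolding f_def using L by (intro mult_left_mono) auto
  define W where "W = {ball z r | z r. 0 < r \<and> (\<forall>w\<in>ball z r. norm (g w - g z) \<le> \<eta>)}"
  have "\<exists>r>0. \<forall>w\<in>ball z r. norm (g w - g z) \<le> \<eta>" for z
  proof -
    have "isCont g z" using g by (simp add: continuous_on_eq_continuous_at)
    then obtain r where "0 < r" "\<And>w. dist w z < r \<Longrightarrow> dist (g w) (g z) < \<eta>"
      using \<eta> unfolding continuous_at_eps_delta by blast
    then show ?thesis by (intro exI[of _ r]) (auto simp: dist_norm norm_minus_commute intro: less_imp_le)
  qed
  then have rad: "\<exists>r. 0 < r \<and> (\<forall>w\<in>ball z r. norm (g w - g z) \<le> \<eta>)" for z by blast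
  have cov: "\<Union>W = UNIV"
  proof (intro set_eqI iffI UNIV_I)
    fix z
    obtain r where "0 < r \<and> (\<forall>w\<in>ball z r. norm (g w - g z) \<le> \<eta>)" using rad[of z] ..
    then have "ball z r \<in> W" "z \<in> ball z r" unfolding W_def by auto
    then show "z \<in> \<Union>W" by blast
  qed
  have "\<And>S. S \<in> W \<Longrightarrow> open S" unfolding W_def by auto
  then obtain W' where W': "W' \<subseteq> W" "countable W'" "\<Union>W' = \<Union>W" by (rule Lindelof)
  have ne: "W' \<noteq> {}" using W'(3) cov by auto
  define w where "w = from_nat_into W'"
  have wW: "w k \<in> W" for k using from_nat_into[OF ne] W'(1) by (auto simp: w_def)
  have wU: "(\<Union>k. w k) = UNIV" using range_from_nat_into[OF ne W'(2)] W'(3) cov by (auto simp: w_def)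
  have wb: "w k \<in> sets borel" for k using wW[of k] by (auto simp: W_def)
  define Dk where "Dk k = disjointed w k" for k
  have Db: "Dk k \<in> sets borel" for k 
  proof -
    have "range (disjointed w) \<subseteq> sets borel" by (rule sets.range_disjointed_sets) (use wb in auto)
    then show ?thesis unfolding Dk_def by blast
  qed
  have Dw: "Dk k \<subseteq> w k" for k unfolding Dk_def by (rule disjointed_subset)
  have DU: "(\<Union>k. Dk k) = UNIV" unfolding Dk_def using wU by (simp add: UN_disjointed_eq)
  define Bk where "Bk k = B \<inter> \<phi> -` Dk k" for k
  have Bkb [measurable]: "Bk k \<in> sets borel" for k unfolding Bk_def using B Db by simp
  have Bd: "disjoint_family Bk"
    using disjoint_family_disjointed[of w] unfolding Bk_def Dk_def disjoint_family_on_def by blast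
  have BU: "(\<Union>k. Bk k) = B" using DU unfolding Bk_def by blast
  define \<rho> where "\<rho> = density \<Lambda> (\<lambda>x. ennreal (f x powr p))"
  have one: "emeasure (\<Gamma> (\<lambda>x. h (\<phi> x))) (Bk k) \<le> emeasure \<rho> (Bk k)" for k
  proof (cases "Dk k = {}")
    case False
    obtain z r where zr: "w k = ball z r" "0 < r" "\<And>y. y \<in> ball z r \<Longrightarrow> norm (g y - g z) \<le> \<eta>"
      using wW[of k] unfolding W_def by blast
    have gy: "norm (g y) \<le> norm (g z) + \<eta>" "norm (g z) \<le> norm (g y) + \<eta>" if "y \<in> ball z r" for y
      using zr(3)[OF that] norm_triangle_ineq2[of "g y" "g z"] norm_triangle_ineq2[of "g z" "g y"]
      by (auto simp: norm_minus_commute)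
    have "(norm (g z) + \<eta>)-lipschitz_on (ball z r) h"
      by (rule lipschitz_on_gradient) (use der gy \<eta> in auto)
    then have "(norm (g z) + \<eta>)-lipschitz_on (Dk k) h"
      using Dw[of k] zr(1) by (auto intro: lipschitz_on_subset)
    from energy_on_lipschitz_set[OF lip h0 False Db this B]
    have le: "measure (\<Gamma> (\<lambda>x. h (\<phi> x))) (Bk k) \<le> ((norm (g z) + \<eta>) * real CARD('n)) powr p * measure \<Lambda> (Bk k)"
      by (simp add: Bk_def)
    have "emeasure (\<Gamma> (\<lambda>x. h (\<phi> x))) (Bk k) = ennreal (measure (\<Gamma> (\<lambda>x. h (\<phi> x))) (Bk k))"
      by (rule finite_measure.emeasure_eq_measure[OF finite_\<Gamma>[OF hF]])
    also have "\<dots> \<le> ennreal (((norm (g z) + \<eta>) * real CARD('n)) powr p * measure \<Lambda> (Bk k))" by (rule ennreal_leI[OF le])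
    also have "\<dots> = ennreal (((norm (g z) + \<eta>) * real CARD('n)) powr p) * emeasure \<Lambda> (Bk k)"
      using finite_measure.emeasure_eq_measure[OF finite_Lambda] by (simp add: ennreal_mult)
    also have "\<dots> = (\<integral>\<^sup>+x. ennreal (((norm (g z) + \<eta>) * real CARD('n)) powr p) * indicator (Bk k) x \<partial>\<Lambda>)"
      by (simp add: nn_integral_cmult_indicator)
    also have "\<dots> \<le> (\<integral>\<^sup>+x. ennreal (f x powr p) * indicator (Bk k) x \<partial>\<Lambda>)"
    proof (rule nn_integral_mono)
      fix x
      show "ennreal (((norm (g z) + \<eta>) * real CARD('n)) powr p) * indicator (Bk k) x \<le> ennreal (f x powr p) * indicator (Bk k) x"
      proof (cases "x \<in> Bk k")
        case True
        then have "\<phi> x \<in> ball z r" using Dw[of k] zr(1) by (auto simp: Bk_def)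
        then have "(norm (g z) + \<eta>) * real CARD('n) \<le> f x"
          unfolding f_def using gy(2) by (subst mult.commute, intro mult_left_mono) force+
        then show ?thesis using \<eta> p_gt_1 by (intro mult_right_mono ennreal_leI powr_mono2) auto
      qed simp
    qed
    also have "\<dots> = emeasure \<rho> (Bk k)" unfolding \<rho>_def by (subst emeasure_density) (auto cong: measurable_cong_sets)
    finally show ?thesis .
  qed (simp add: Bk_def)
  have rng: "range Bk \<subseteq> sets borel" using Bkb by blast
  have "emeasure (\<Gamma> (\<lambda>x. h (\<phi> x))) (\<Union>k. Bk k) = (\<Sum>k. emeasure (\<Gamma> (\<lambda>x. h (\<phi> x))) (Bk k))"
    by (rule suminf_emeasure[symmetric]) (simp_all only: sets_\<Gamma>[OF hF] rng Bd)
  then have "emeasure (\<Gamma> (\<lambda>x. h (\<phi> x))) B = (\<Sum>k. emeasure (\<Gamma> (\<lambda>x. h (\<phi> x))) (Bk k))" unfolding BU .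
  also have "\<dots> \<le> (\<Sum>k. emeasure \<rho> (Bk k))" by (intro suminf_le one) auto
  also have "\<dots> = emeasure \<rho> (\<Union>k. Bk k)"
    by (rule suminf_emeasure) (simp_all only: \<rho>_def sets_density sets_total_energy_measure rng Bd)
  also have "\<dots> = emeasure \<rho> B" unfolding BU ..
  also have "\<dots> = (\<integral>\<^sup>+x. ennreal (f x powr p) * indicator B x \<partial>\<Lambda>)"
    unfolding \<rho>_def using B by (subst emeasure_density) (auto cong: measurable_cong_sets)
  also have "\<dots> = (\<integral>\<^sup>+x. ennreal (indicator B x * f x powr p) \<partial>\<Lambda>)"
    by (intro nn_integral_cong) (auto simp: indicator_def)
  also have "\<dots> = ennreal (\<integral>x. indicator B x * f x powr p \<partial>\<Lambda>)"
    by (intro nn_integral_eq_integral integrable_powr_Lambda[OF fm f0 fC B]) auto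
  finally have "ennreal (measure (\<Gamma> (\<lambda>x. h (\<phi> x))) B) \<le> ennreal (\<integral>x. indicator B x * f x powr p \<partial>\<Lambda>)"
    using finite_measure.emeasure_eq_measure[OF finite_\<Gamma>[OF hF]] by simp
  then have "measure (\<Gamma> (\<lambda>x. h (\<phi> x))) B \<le> (\<integral>x. indicator B x * f x powr p \<partial>\<Lambda>)"
    by (subst (asm) ennreal_le_iff) (auto intro!: integral_nonneg_AE)
  then show ?thesis by (simp add: f_def)
qed

end

section \<open>Lattice infima and limits of gradient fields\<close>

text \<open>Strictness includes the value infinity, where the transform is 0, so it separates all
  extended densities while remaining integrable over finite measures.\<close>

lemma inverse_one_plus_ennreal_strict:
  fixes a b :: ennreal
  assumes "a < b"
  shows "inverse (1 + b) < inverse (1 + a)"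
proof -
  obtain r where r: "a = ennreal r" "0 \<le> r" using assms by (cases a) auto
  have ia: "inverse (1 + a) = ennreal (inverse (1 + r))"
    using r by (simp add: inverse_ennreal flip: ennreal_plus ennreal_1)
  show ?thesis
  proof (cases b)
    case (real s)
    have "inverse (1 + b) = ennreal (inverse (1 + s))"
      using real by (simp add: inverse_ennreal flip: ennreal_plus ennreal_1)
    then show ?thesis using ia assms r real by (simp add: ennreal_less_iff)
  next
    case top
    then show ?thesis using ia r by simp
  qed
qed

text \<open>The infimum over a countable subfamily that maximises the integral of the bounded, strictly decreasing
  transform \<open>1 / (1 + f)\<close> is already below every member of the family.\<close>

lemma lattice_inf_exists:
  fixes M :: "'a measure" and \<G> :: "('a \<Rightarrow> ennreal) set"
  assumes fin: "finite_measure M" and \<G>: "\<G> \<subseteq> borel_measurable M" "\<G> \<noteq> {}"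
  shows "\<exists>G. is_lattice_inf M \<G> G"
proof -
  define g :: "('a \<Rightarrow> ennreal) set \<Rightarrow> 'a \<Rightarrow> ennreal" where "g C x = (INF f\<in>C. f x)" for C x
  define I where "I C = (\<integral>\<^sup>+x. inverse (1 + g C x) \<partial>M)" for C
  define \<C> where "\<C> = {C. countable C \<and> C \<noteq> {} \<and> C \<subseteq> \<G>}"
  have gm: "g C \<in> borel_measurable M" if "C \<in> \<C>" for C
    using that \<G>(1) unfolding \<C>_def g_def by (intro borel_measurable_INF) auto
  have inv_mono: "inverse (1 + b) \<le> inverse (1 + a)" if "a \<le> b" for a b :: ennreal
    using that inverse_one_plus_ennreal_strict[of a b] by (cases "a = b") (auto simp: less_le)
  have "continuous_on UNIV (\<lambda>t::ennreal. inverse (1 + t))"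
    by (intro continuous_on_inverse_ennreal continuous_on_add_ennreal continuous_on_const continuous_on_id)
  then have invm: "(\<lambda>x. inverse (1 + f x)) \<in> borel_measurable M" if "f \<in> borel_measurable M" for f :: "'a \<Rightarrow> ennreal"
    by (intro measurable_compose[OF that borel_measurable_continuous_onI])
  have inv1: "inverse (1 + a) \<le> 1" for a :: ennreal using inv_mono[of 0 a] by simp
  have I_mono: "I C \<le> I C'" if "C \<subseteq> C'" for C C'
    unfolding I_def g_def using that by (intro nn_integral_mono inv_mono INF_superset_mono) auto
  have I_fin: "I C \<le> emeasure M (space M)" for C
  proof -
    have "I C \<le> (\<integral>\<^sup>+x. 1 \<partial>M)" unfolding I_def by (intro nn_integral_mono inv1)
    then show ?thesis by simp
  qed
  obtain f0 where f0: "f0 \<in> \<G>" using \<G>(2) by blast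
  have ne: "\<C> \<noteq> {}" using f0 by (auto simp: \<C>_def intro!: exI[of _ "{f0}"])
  obtain Cs where Cs: "range Cs \<subseteq> I ` \<C>" "(SUP C\<in>\<C>. I C) = (SUP i::nat. Cs i)"
    using ennreal_Sup_countable_SUP[of "I ` \<C>"] ne by auto
  then have "\<forall>i. \<exists>C\<in>\<C>. Cs i = I C" by blast
  then obtain D where D: "\<And>i. D i \<in> \<C>" "\<And>i. Cs i = I (D i)" by metis
  define U where "U = (\<Union>i. D i)"
  have U: "U \<in> \<C>" using D(1) unfolding U_def \<C>_def by fastforce
  have sup: "I C \<le> I U" if "C \<in> \<C>" for C
  proof -
    have "I C \<le> (SUP C\<in>\<C>. I C)" using that by (rule SUP_upper)
    also have "\<dots> \<le> I U" unfolding Cs(2) using D by (intro SUP_least) (auto intro!: I_mono simp: U_def)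
    finally show ?thesis .
  qed
  have "is_lattice_inf M \<G> (g U)"
    unfolding is_lattice_inf_def
  proof (intro conjI ballI impI)
    show "g U \<in> borel_measurable M" by (rule gm[OF U])
    fix f assume f: "f \<in> \<G>"
    let ?V = "insert f U"
    have V: "?V \<in> \<C>" using U f by (auto simp: \<C>_def)
    have gV: "g ?V x = min (f x) (g U x)" for x by (simp add: g_def inf_min)
    have le: "inverse (1 + g U x) \<le> inverse (1 + g ?V x)" for x by (rule inv_mono) (simp add: gV)
    \<comment> \<open>By maximality, adding \<open>f\<close> to the countable family cannot raise
      the integral. The two transforms therefore agree almost everywhere, and strictness makes the
      infima agree.\<close>
    have "(\<integral>\<^sup>+x. inverse (1 + g ?V x) - inverse (1 + g U x) \<partial>M) = I ?V - I U"
      unfolding I_def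
    proof (rule nn_integral_diff)
      show "(\<lambda>x. inverse (1 + g ?V x)) \<in> borel_measurable M" "(\<lambda>x. inverse (1 + g U x)) \<in> borel_measurable M"
        using invm[OF gm[OF U]] invm[OF gm[OF V]] by simp_all
      show "(\<integral>\<^sup>+x. inverse (1 + g U x) \<partial>M) \<noteq> \<infinity>"
        using I_fin[of U] finite_measure.emeasure_finite[OF fin] unfolding I_def
        by (metis infinity_ennreal_def neq_top_trans)
      show "AE x in M. inverse (1 + g U x) \<le> inverse (1 + g ?V x)" using le by simp
    qed
    also have "\<dots> = 0"
      using sup[OF V] I_fin[of ?V] finite_measure.emeasure_finite[OF fin, of "space M"]
      by (simp add: diff_eq_0_iff_ennreal less_top order_le_less_trans)
    finally have "AE x in M. inverse (1 + g ?V x) - inverse (1 + g U x) = 0"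
      using invm[OF gm[OF U]] invm[OF gm[OF V]] by (subst (asm) nn_integral_0_iff_AE) (auto intro: borel_measurable_minus_ennreal)
    then show "AE x in M. g U x \<le> f x"
    proof eventually_elim
      fix x assume z: "inverse (1 + g ?V x) - inverse (1 + g U x) = 0"
      show "g U x \<le> f x"
      proof (rule ccontr)
        assume "\<not> g U x \<le> f x"
        then have "g ?V x < g U x" by (simp add: gV not_le)
        then have "inverse (1 + g U x) < inverse (1 + g ?V x)" by (rule inverse_one_plus_ennreal_strict)
        then show False using z by (auto simp: diff_eq_0_iff_ennreal dest: leD)
      qed
    qed
  next
    fix H assume H: "H \<in> borel_measurable M" "\<forall>f\<in>\<G>. AE x in M. H x \<le> f x"
    have "countable U" using U by (simp add: \<C>_def)
    then have "AE x in M. \<forall>f\<in>U. H x \<le> f x"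
      using H(2) U by (subst AE_ball_countable) (auto simp: \<C>_def)
    then show "AE x in M. H x \<le> g U x" unfolding g_def by eventually_elim (auto intro: INF_greatest)
  qed
  then show ?thesis by blast
qed

section \<open>Strong limits of gradient fields\<close>

lemma norm_matrix_le:
  fixes A :: "real ^ 'n ^ 'n"
  assumes "\<And>i. norm (A $ i) \<le> 1"
  shows "norm A \<le> real CARD('n)" and "\<bar>trace A\<bar> \<le> real CARD('n)"
proof -
  have "norm A \<le> (\<Sum>i\<in>UNIV. norm (A $ i))" unfolding norm_vec_def by (rule L2_set_le_sum) simp
  also have "\<dots> \<le> (\<Sum>i\<in>(UNIV::'n set). 1)" by (intro sum_mono assms)
  finally show "norm A \<le> real CARD('n)" by simp
  have "\<bar>trace A\<bar> \<le> (\<Sum>i\<in>UNIV. \<bar>A $ i $ i\<bar>)" unfolding trace_def by (rule sum_abs)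
  also have "\<dots> \<le> (\<Sum>i\<in>(UNIV::'n set). 1)"
    by (intro sum_mono order_trans[OF component_le_norm_cart] assms)
  finally show "\<bar>trace A\<bar> \<le> real CARD('n)" by simp
qed

lemma continuous_trace: "continuous_on S G \<Longrightarrow> continuous_on S (\<lambda>x. trace (G x :: real ^ 'n ^ 'n))"
  unfolding trace_def by (intro continuous_intros)

lemma gradient_fields_mono: "d \<le> d' \<Longrightarrow> gradient_fields \<nu> c d \<subseteq> gradient_fields \<nu> c d'"
  unfolding gradient_fields_def by (auto intro: order_trans)

context
  fixes \<nu> :: "(real ^ 'n) measure"
  assumes fin: "finite_measure \<nu>" and sets_nu: "sets \<nu> = sets borel"
begin

lemma integrable_bounded_continuous:
  fixes f :: "real ^ 'n \<Rightarrow> real"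
  assumes "continuous_on UNIV f" "\<And>x. \<bar>f x\<bar> \<le> C"
  shows "integrable \<nu> f"
proof (rule finite_measure.integrable_const_bound[OF fin])
  show "AE x in \<nu>. norm (f x) \<le> C" using assms by simp
  show "f \<in> borel_measurable \<nu>"
    using borel_measurable_continuous_onI[OF assms(1)] measurable_cong_sets[OF sets_nu refl] by blast
qed

lemma gradient_fields_convex:
  assumes "(H, G) \<in> gradient_fields \<nu> c d" "(H', G') \<in> gradient_fields \<nu> c d"
  shows "(\<lambda>x. (1/2) *\<^sub>R (H x + H' x), \<lambda>x. (1/2) *\<^sub>R (G x + G' x)) \<in> gradient_fields \<nu> c d"
proof -
  note A = assms[unfolded gradient_fields_def, simplified]
  have h: "\<bar>((1/2) *\<^sub>R (H x + H' x)) $ i\<bar> \<le> d" for x i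
  proof -
    have "\<bar>H x $ i\<bar> \<le> d" "\<bar>H' x $ i\<bar> \<le> d" using A by auto
    then show ?thesis by (simp add: abs_le_iff)
  qed
  have dd: "((\<lambda>x. ((1/2) *\<^sub>R (H x + H' x)) $ i) has_derivative (\<lambda>v. ((1/2) *\<^sub>R (G x + G' x)) $ i \<bullet> v)) (at x)" for x i
  proof -
    have "((\<lambda>x. (1/2) * (H x $ i + H' x $ i)) has_derivative (\<lambda>v. (1/2) * (G x $ i \<bullet> v + G' x $ i \<bullet> v))) (at x)"
      using A by (intro has_derivative_mult_right has_derivative_add) auto
    then show ?thesis by (simp add: inner_add_left)
  qed
  have n: "norm (((1/2) *\<^sub>R (G x + G' x)) $ i) \<le> 1" for x i
  proof -
    have "norm (G x $ i) \<le> 1" "norm (G' x $ i) \<le> 1" using A by auto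
    then show ?thesis using norm_triangle_ineq[of "G x $ i" "G' x $ i"] by simp
  qed
  have tr: "integrable \<nu> (\<lambda>x. trace (G x))" "integrable \<nu> (\<lambda>x. trace (G' x))"
    using A by (intro integrable_bounded_continuous[of _ "real CARD('n)"] continuous_trace norm_matrix_le; auto)+
  have "(\<integral>x. trace ((1/2) *\<^sub>R (G x + G' x)) \<partial>\<nu>) = (\<integral>x. (1/2) * (trace (G x) + trace (G' x)) \<partial>\<nu>)"
    by (intro Bochner_Integration.integral_cong) (auto simp: trace_def sum.distrib sum_distrib_left sum_divide_distrib add_divide_distrib)
  also have "\<dots> = (1/2) * ((\<integral>x. trace (G x) \<partial>\<nu>) + (\<integral>x. trace (G' x) \<partial>\<nu>))"
    using tr by (simp add: Bochner_Integration.integral_add)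
  finally have "c \<le> (\<integral>x. trace ((1/2) *\<^sub>R (G x + G' x)) \<partial>\<nu>)" using A by simp
  moreover have "continuous_on UNIV (\<lambda>x. (1/2) *\<^sub>R (G x + G' x))" using A by (intro continuous_intros) auto
  moreover have "(1/2) *\<^sub>R (H 0 + H' 0) = 0" using A by simp
  ultimately show ?thesis using h dd n unfolding gradient_fields_def by blast
qed

text \<open>Almost minimisers of the \<open>L\<^sup>2\<close> norm over decreasing convex sets form a Cauchy sequence by the parallelogram law.\<close>

lemma gradient_fields_cauchy:
  assumes ne: "\<And>k::nat. gradient_fields \<nu> c (1 / real (Suc k)) \<noteq> {}"
  obtains H G where "\<And>k::nat. (H k, G k) \<in> gradient_fields \<nu> c (1 / real (Suc k))"
    "\<And>e. 0 < e \<Longrightarrow> \<exists>N. \<forall>k\<ge>N. \<forall>j\<ge>k. (\<integral>x. (norm (G j x - G k x))\<^sup>2 \<partial>\<nu>) \<le> e"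
proof -
  define S where "S k = gradient_fields \<nu> c (1 / real (Suc k))" for k
  define Q where "Q G = (\<integral>x. (norm (G x))\<^sup>2 \<partial>\<nu>)" for G :: "real ^ 'n \<Rightarrow> real ^ 'n ^ 'n"
  have int: "integrable \<nu> (\<lambda>x. (norm (G x))\<^sup>2)" and Qle: "Q G \<le> (real CARD('n))\<^sup>2 * measure \<nu> UNIV" if "(H, G) \<in> S k" for H G k
  proof -
    have b: "(norm (G x))\<^sup>2 \<le> (real CARD('n))\<^sup>2" for x
      using that unfolding S_def gradient_fields_def by (intro power_mono norm_matrix_le) auto
    show i: "integrable \<nu> (\<lambda>x. (norm (G x))\<^sup>2)"
      using that b unfolding S_def gradient_fields_def
      by (intro integrable_bounded_continuous[of _ "(real CARD('n))\<^sup>2"] continuous_intros) auto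
    have "Q G \<le> (\<integral>x. (real CARD('n))\<^sup>2 \<partial>\<nu>)" unfolding Q_def
      by (intro integral_mono i finite_measure.integrable_const[OF fin] b)
    then show "Q G \<le> (real CARD('n))\<^sup>2 * measure \<nu> UNIV"
      using sets_eq_imp_space_eq[OF sets_nu] by (simp add: mult.commute)
  qed
  have Q0: "0 \<le> Q G" for G by (simp add: Q_def)
  define I where "I k = Inf ((Q \<circ> snd) ` S k)" for k
  have bdd: "bdd_below ((Q \<circ> snd) ` S k)" for k by (rule bdd_belowI[of _ 0]) (use Q0 in auto)
  have neS: "S k \<noteq> {}" for k unfolding S_def by (rule ne)
  have Smono: "S j \<subseteq> S k" if "k \<le> j" for k j
    unfolding S_def using that by (intro gradient_fields_mono) (simp add: frac_le)
  have Ile: "I k \<le> Q G" if "(H, G) \<in> S k" for H G k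
    unfolding I_def using that by (intro cInf_lower bdd) force
  have "\<exists>K. K \<in> S k \<and> Q (snd K) < I k + 1 / real (Suc k)" for k
  proof -
    have "I k < I k + 1 / real (Suc k)" by simp
    then have "\<exists>q\<in>(Q \<circ> snd) ` S k. q < I k + 1 / real (Suc k)"
      unfolding I_def using cInf_less_iff[OF _ bdd, of k] neS[of k] by blast
    then obtain K where "K \<in> S k" "(Q \<circ> snd) K < I k + 1 / real (Suc k)" by blast
    then show ?thesis by (intro exI[of _ K]) simp
  qed
  then obtain K where K: "\<And>k. K k \<in> S k" "\<And>k. Q (snd (K k)) < I k + 1 / real (Suc k)" by metis
  define H where "H k = fst (K k)" for k
  define G where "G k = snd (K k)" for k
  have HG: "(H k, G k) \<in> S k" for k using K(1) by (simp add: H_def G_def)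
  have QG: "Q (G k) < I k + 1 / real (Suc k)" for k using K(2) by (simp add: G_def)
  have Imono: "incseq I"
  proof (rule incseq_SucI)
    fix k
    show "I k \<le> I (Suc k)" unfolding I_def[of "Suc k"]
      by (intro cInf_greatest) (use neS Smono[of k "Suc k"] Ile in \<open>force+\<close>)
  qed
  have "\<forall>k. I k \<le> (real CARD('n))\<^sup>2 * measure \<nu> UNIV" using order_trans[OF Ile[OF HG] Qle[OF HG]] by blast
  then obtain l where "I \<longlonglongrightarrow> l" by (rule incseq_convergent[OF Imono])
  then have "convergent I" by (rule convergentI)
  then have CI: "Cauchy I" by (rule convergent_Cauchy)
  \<comment> \<open>The midpoint of two fields in \<open>S k\<close> lies in \<open>S k\<close>, so
    its norm integral is at least \<open>I k\<close>. What remains tends to 0 because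
    \<open>I\<close> is increasing and bounded.\<close>
  have key: "(\<integral>x. (norm (G j x - G k x))\<^sup>2 \<partial>\<nu>) \<le> 2 * (I j - I k) + 4 / real (Suc k)" if kj: "k \<le> j" for j k
  proof -
    have j: "(H j, G j) \<in> S k" using HG Smono[OF kj] by blast
    have mid: "(\<lambda>x. (1/2) *\<^sub>R (H j x + H k x), \<lambda>x. (1/2) *\<^sub>R (G j x + G k x)) \<in> S k"
      unfolding S_def by (rule gradient_fields_convex[OF j[unfolded S_def] HG[of k, unfolded S_def]])
    have "(norm (G j x - G k x))\<^sup>2 = 2 * (norm (G j x))\<^sup>2 + 2 * (norm (G k x))\<^sup>2 - 4 * (norm ((1/2) *\<^sub>R (G j x + G k x)))\<^sup>2" for x
      unfolding power2_norm_eq_inner by (simp add: inner_diff_left inner_diff_right inner_add_left inner_add_right inner_commute field_simps)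
    then have "(\<integral>x. (norm (G j x - G k x))\<^sup>2 \<partial>\<nu>) = 2 * Q (G j) + 2 * Q (G k) - 4 * Q (\<lambda>x. (1/2) *\<^sub>R (G j x + G k x))"
      unfolding Q_def using int[OF HG[of j]] int[OF HG[of k]] int[OF mid] by simp
    also have "\<dots> \<le> 2 * (I j + 1 / real (Suc j)) + 2 * (I k + 1 / real (Suc k)) - 4 * I k"
      using QG[of j] QG[of k] Ile[OF mid] by argo
    also have "\<dots> \<le> 2 * (I j - I k) + 4 / real (Suc k)"
    proof -
      have "1 / real (Suc j) \<le> 1 / real (Suc k)" using kj by (simp add: frac_le)
      moreover have "4 / real (Suc k) = 2 * (1 / real (Suc k)) + 2 * (1 / real (Suc k))" by simp
      ultimately show ?thesis by argo
    qed
    finally show ?thesis .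
  qed
  show thesis
  proof (rule that[of H G])
    show "(H k, G k) \<in> gradient_fields \<nu> c (1 / real (Suc k))" for k using HG[of k] by (simp only: S_def)
    fix e :: real assume e: "0 < e"
    obtain N1 where N1: "\<And>m n. m \<ge> N1 \<Longrightarrow> n \<ge> N1 \<Longrightarrow> norm (I m - I n) < e / 4"
      using CauchyD[OF CI, of "e / 4"] e by auto
    obtain N2 :: nat where N2: "8 / e < real N2" using reals_Archimedean2 by blast
    show "\<exists>N. \<forall>k\<ge>N. \<forall>j\<ge>k. (\<integral>x. (norm (G j x - G k x))\<^sup>2 \<partial>\<nu>) \<le> e"
    proof (intro exI[of _ "max N1 N2"] allI impI)
      fix k j assume k: "max N1 N2 \<le> k" and j: "k \<le> j"
      have "norm (I j - I k) < e / 4" using N1[of j k] k j by simp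
      then have a: "I j - I k < e / 4" unfolding real_norm_def using abs_ge_self[of "I j - I k"] by linarith
      have "8 / e < real (Suc k)" using N2 k by linarith
      then have "4 / real (Suc k) \<le> e / 2" using e by (simp add: field_simps)
      then show "(\<integral>x. (norm (G j x - G k x))\<^sup>2 \<partial>\<nu>) \<le> e" using key[OF j] a by argo
    qed
  qed
qed

text \<open>A subsequence with rapidly decreasing squared distances has summable increments in the
  integral norm, hence converges almost everywhere. The row bounds dominate the traces, so the lower
  bound \<open>c\<close> survives in the limit.\<close>

lemma gradient_fields_limit:
  assumes ne: "\<And>k::nat. gradient_fields \<nu> c (1 / real (Suc k)) \<noteq> {}"
  obtains H G M where "\<And>k::nat. (H k, G k) \<in> gradient_fields \<nu> c (1 / real (Suc k))"
    "M \<in> borel_measurable borel" "AE x in \<nu>. (\<lambda>k. G k x) \<longlonglongrightarrow> M x" "c \<le> (\<integral>x. trace (M x) \<partial>\<nu>)"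
proof -
  obtain H0 G0 where HG0: "\<And>k::nat. (H0 k, G0 k) \<in> gradient_fields \<nu> c (1 / real (Suc k))"
    and cau: "\<And>e. 0 < e \<Longrightarrow> \<exists>N. \<forall>k\<ge>N. \<forall>j\<ge>k. (\<integral>x. (norm (G0 j x - G0 k x))\<^sup>2 \<partial>\<nu>) \<le> e"
    using gradient_fields_cauchy[OF ne] by blast
  have "\<forall>r::nat. \<exists>N. \<forall>k\<ge>N. \<forall>j\<ge>k. (\<integral>x. (norm (G0 j x - G0 k x))\<^sup>2 \<partial>\<nu>) \<le> (1/4) ^ r" by (intro allI cau) simp
  from choice[OF this] obtain N where N': "\<forall>r. \<forall>k\<ge>N r. \<forall>j\<ge>k. (\<integral>x. (norm (G0 j x - G0 k x))\<^sup>2 \<partial>\<nu>) \<le> (1/4) ^ r" ..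
  have N: "\<And>r k j. N r \<le> k \<Longrightarrow> k \<le> j \<Longrightarrow> (\<integral>x. (norm (G0 j x - G0 k x))\<^sup>2 \<partial>\<nu>) \<le> (1/4) ^ r" using N' by blast
  \<comment> \<open>The partial sums make \<open>s\<close> nondecreasing and at least
    \<open>N r\<close>; the summand \<open>r\<close> ensures \<open>r \<le> s r\<close>, so the
    field with index \<open>s r\<close> obeys the smallness required at index
    \<open>r\<close>.\<close>
  define s where "s r = r + (\<Sum>i\<le>r. N i)" for r
  have s: "s r \<le> s (Suc r)" "N r \<le> s r" "r \<le> s r" for r
    by (auto simp: s_def intro: trans_le_add2 member_le_sum)
  define H where "H r = H0 (s r)" for r
  define G where "G r = G0 (s r)" for r
  have HG: "(H r, G r) \<in> gradient_fields \<nu> c (1 / real (Suc r))" for r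
    unfolding H_def G_def using HG0[of "s r"] gradient_fields_mono[of "1 / real (Suc (s r))" "1 / real (Suc r)" \<nu> c] s(3)[of r]
    by (auto simp: frac_le)
  have contG: "continuous_on UNIV (G r)" for r using HG[of r] by (simp add: gradient_fields_def)
  have rows: "norm (G r x $ i) \<le> 1" for r x i using HG[of r] by (simp add: gradient_fields_def)
  have Gm: "G r \<in> borel_measurable \<nu>" for r
    using borel_measurable_continuous_onI[OF contG[of r]] measurable_cong_sets[OF sets_nu refl] by blast
  have nG: "norm (G (Suc r) x - G r x) \<le> 2 * real CARD('n)" for r x
    using norm_triangle_ineq4[of "G (Suc r) x" "G r x"] norm_matrix_le(1)[OF rows] by (smt (verit))
  define m where "m = measure \<nu> UNIV"
  have m: "0 \<le> m" by (simp add: m_def)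
  have space: "space \<nu> = UNIV" using sets_eq_imp_space_eq[OF sets_nu] by simp
  have L1: "(\<integral>\<^sup>+x. ennreal (norm (G (Suc r) x - G r x)) \<partial>\<nu>) \<le> ennreal ((m + 1) * (1/2) ^ r)" for r
  proof -
    have c: "continuous_on UNIV (\<lambda>x. norm (G (Suc r) x - G r x))" by (intro continuous_intros contG)
    have i1: "integrable \<nu> (\<lambda>x. norm (G (Suc r) x - G r x))"
      using nG by (intro integrable_bounded_continuous[OF c, of "2 * real CARD('n)"]) simp
    have i2: "integrable \<nu> (\<lambda>x. (norm (G (Suc r) x - G r x))\<^sup>2)"
    proof (rule integrable_bounded_continuous[of _ "(2 * real CARD('n))\<^sup>2"])
      show "continuous_on UNIV (\<lambda>x. (norm (G (Suc r) x - G r x))\<^sup>2)" by (intro continuous_intros contG)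
      show "\<bar>(norm (G (Suc r) x - G r x))\<^sup>2\<bar> \<le> (2 * real CARD('n))\<^sup>2" for x
        using power_mono[OF nG[of r x], of 2] by simp
    qed
    \<comment> \<open>In place of Cauchy-Schwarz:
      \<open>t \<le> (1/2) ^ r + 2 ^ r * t\<^sup>2\<close>, weighted so that a squared distance of
      at most \<open>(1/4) ^ r\<close> contributes \<open>(1/2) ^ r\<close>.\<close>
    have "(\<integral>x. norm (G (Suc r) x - G r x) \<partial>\<nu>) \<le> (\<integral>x. (1/2) ^ r + 2 ^ r * (norm (G (Suc r) x - G r x))\<^sup>2 \<partial>\<nu>)"
    proof (intro integral_mono i1 Bochner_Integration.integrable_add integrable_mult_right i2 finite_measure.integrable_const[OF fin])
      fix x
      let ?t = "norm (G (Suc r) x - G r x)"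
      have "0 \<le> (1 - 2 ^ r * ?t)\<^sup>2" by simp
      then have "2 * (2 ^ r * ?t) \<le> 1 + (2 ^ r * ?t)\<^sup>2" by (simp add: power2_diff)
      then have "2 ^ r * ?t \<le> 1 + (2 ^ r * ?t)\<^sup>2" using mult_nonneg_nonneg[of "2 ^ r" ?t] by (smt (verit) norm_ge_zero zero_le_power)
      then have "(1/2) ^ r * (2 ^ r * ?t) \<le> (1/2) ^ r * (1 + (2 ^ r * ?t)\<^sup>2)" by (intro mult_left_mono) auto
      moreover have "(1/2) ^ r * (2 ^ r * ?t) = ?t" by (simp add: power_divide)
      moreover have "(1/2) ^ r * (1 + (2 ^ r * ?t)\<^sup>2) = (1/2) ^ r + 2 ^ r * ?t\<^sup>2"
        by (simp add: power_divide power_mult_distrib field_simps power2_eq_square)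
      ultimately show "?t \<le> (1/2) ^ r + 2 ^ r * ?t\<^sup>2" by linarith
    qed
    also have "\<dots> = (1/2) ^ r * m + 2 ^ r * (\<integral>x. (norm (G (Suc r) x - G r x))\<^sup>2 \<partial>\<nu>)"
      using i2 finite_measure.integrable_const[OF fin, of "(1/2 :: real) ^ r"] by (simp add: m_def space)
    also have "\<dots> \<le> (1/2) ^ r * m + 2 ^ r * (1/4) ^ r"
      unfolding G_def using s by (intro add_left_mono mult_left_mono N) auto
    also have "2 ^ r * (1/4) ^ r = (1/2 :: real) ^ r" by (simp flip: power_mult_distrib)
    also have "(1/2) ^ r * m + (1/2) ^ r = (m + 1) * (1/2) ^ r" by (simp add: algebra_simps)
    finally show ?thesis by (subst nn_integral_eq_integral[OF i1]) (auto intro: ennreal_leI)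
  qed
  have "(\<integral>\<^sup>+x. (\<Sum>r. ennreal (norm (G (Suc r) x - G r x))) \<partial>\<nu>) = (\<Sum>r. \<integral>\<^sup>+x. ennreal (norm (G (Suc r) x - G r x)) \<partial>\<nu>)"
    using Gm by (intro nn_integral_suminf) measurable
  also have "\<dots> \<le> (\<Sum>r. ennreal ((m + 1) * (1/2) ^ r))" by (intro suminf_le L1) auto
  also have "\<dots> = ennreal (\<Sum>r. (m + 1) * (1/2) ^ r)" using m by (intro suminf_ennreal2) (auto intro!: summable_mult summable_geometric)
  also have "\<dots> < \<infinity>" by simp
  finally have "AE x in \<nu>. (\<Sum>r. ennreal (norm (G (Suc r) x - G r x))) \<noteq> \<infinity>"
    using Gm by (intro nn_integral_PInf_AE) auto
  then have conv: "AE x in \<nu>. convergent (\<lambda>r. G r x)"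
  proof eventually_elim
    fix x assume "(\<Sum>r. ennreal (norm (G (Suc r) x - G r x))) \<noteq> \<infinity>"
    then have "summable (\<lambda>r. norm (G (Suc r) x - G r x))" by (intro summable_suminf_not_top) auto
    then have "summable (\<lambda>r. G (Suc r) x - G r x)" by (rule summable_norm_cancel)
    then have "convergent (\<lambda>r. G r x - G 0 x)"
      unfolding summable_iff_convergent sum_lessThan_telescope[of "\<lambda>i. G i x"] .
    then show "convergent (\<lambda>r. G r x)" by (simp add: convergent_diff_const_right_iff)
  qed
  define M where "M x = lim (\<lambda>r. G r x)" for x
  have Mm: "M \<in> borel_measurable borel"
    unfolding M_def using contG by (intro borel_measurable_lim_metric borel_measurable_continuous_onI)
  have lim: "AE x in \<nu>. (\<lambda>r. G r x) \<longlonglongrightarrow> M x"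
    using conv by eventually_elim (simp add: M_def convergent_LIMSEQ_iff)
  have trm: "(\<lambda>x. trace (g x)) \<in> borel_measurable \<nu>" if "g \<in> borel_measurable \<nu>" for g :: "real ^ 'n \<Rightarrow> real ^ 'n ^ 'n"
    by (rule measurable_compose[OF that]) (intro borel_measurable_continuous_onI continuous_trace continuous_on_id)
  have "(\<lambda>r. \<integral>x. trace (G r x) \<partial>\<nu>) \<longlonglongrightarrow> (\<integral>x. trace (M x) \<partial>\<nu>)"
  proof (rule integral_dominated_convergence[where w = "\<lambda>_. real CARD('n)"])
    show "(\<lambda>x. trace (M x)) \<in> borel_measurable \<nu>"
      using Mm measurable_cong_sets[OF sets_nu refl] by (intro trm) blast
    show "(\<lambda>x. trace (G r x)) \<in> borel_measurable \<nu>" for r by (rule trm[OF Gm])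
    show "integrable \<nu> (\<lambda>_. real CARD('n))" by (rule finite_measure.integrable_const[OF fin])
    show "AE x in \<nu>. (\<lambda>r. trace (G r x)) \<longlonglongrightarrow> trace (M x)"
      using lim by eventually_elim (unfold trace_def, intro tendsto_intros, simp)
    show "AE x in \<nu>. norm (trace (G r x)) \<le> real CARD('n)" for r using norm_matrix_le(2)[OF rows] by simp
  qed
  moreover have "c \<le> (\<integral>x. trace (G r x) \<partial>\<nu>)" for r using HG[of r] by (simp add: gradient_fields_def)
  ultimately have "c \<le> (\<integral>x. trace (M x) \<partial>\<nu>)" by (intro LIMSEQ_le_const) auto
  then show thesis using that HG Mm lim by blast
qed

end

section \<open>Absolute continuity\<close>

context dirichlet_map
begin

lemma inner_mem: "(\<lambda>x. v \<bullet> \<phi> x) \<in> F"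
proof -
  have "(\<lambda>x. \<Sum>i\<in>UNIV. v $ i * \<phi> x $ i) \<in> F" by (rule sum_mem) (auto intro: scale_mem comp_mem)
  then show ?thesis by (simp add: inner_vec_def)
qed

text \<open>A linear function is Lipschitz, so its energy is dominated by a multiple of
  \<open>\<Lambda>\<close>. This is what makes \<open>RN_deriv\<close> a genuine density in
  \<open>emeasure_Gamma_inner\<close>.\<close>

lemma Gamma_inner_absolutely_continuous: "absolutely_continuous \<Lambda> (\<Gamma> (\<lambda>x. v \<bullet> \<phi> x))"
  unfolding absolutely_continuous_def
proof
  fix B assume "B \<in> null_sets \<Lambda>"
  then have B: "B \<in> sets borel" "emeasure \<Lambda> B = 0" by auto
  have m0: "measure \<Lambda> B = 0" using B(2) by (simp add: measure_def)
  have e: "energy_le (norm v * real CARD('n)) (\<lambda>x. v \<bullet> \<phi> x)"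
  proof (rule energy_le_lipschitz)
    show "(norm v)-lipschitz_on UNIV (\<lambda>z. v \<bullet> z)"
    proof (rule lipschitz_onI)
      show "dist (v \<bullet> x) (v \<bullet> y) \<le> norm v * dist x y" for x y
        using Cauchy_Schwarz_ineq2[of v "x - y"] by (simp add: dist_real_def dist_norm inner_diff_right)
    qed simp
  qed simp
  have "measure (\<Gamma> (\<lambda>x. v \<bullet> \<phi> x)) B \<le> 0" using energy_leD[OF e B(1)] m0 by simp
  then have "measure (\<Gamma> (\<lambda>x. v \<bullet> \<phi> x)) B = 0" by (simp add: antisym)
  then have "emeasure (\<Gamma> (\<lambda>x. v \<bullet> \<phi> x)) B = 0"
    using finite_measure.emeasure_eq_measure[OF finite_\<Gamma>[OF inner_mem]] by simp
  then show "B \<in> null_sets (\<Gamma> (\<lambda>x. v \<bullet> \<phi> x))" using B sets_\<Gamma>[OF inner_mem] by auto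
qed

lemma emeasure_Gamma_inner:
  assumes "B \<in> sets borel"
  shows "emeasure (\<Gamma> (\<lambda>x. v \<bullet> \<phi> x)) B = (\<integral>\<^sup>+x. RN_deriv \<Lambda> (\<Gamma> (\<lambda>x. v \<bullet> \<phi> x)) x * indicator B x \<partial>\<Lambda>)"
proof -
  interpret finite_measure \<Lambda> by (rule finite_Lambda)
  have "density \<Lambda> (RN_deriv \<Lambda> (\<Gamma> (\<lambda>x. v \<bullet> \<phi> x))) = \<Gamma> (\<lambda>x. v \<bullet> \<phi> x)"
    by (rule density_RN_deriv[OF Gamma_inner_absolutely_continuous]) (simp add: sets_\<Gamma>[OF inner_mem])
  then have "emeasure (\<Gamma> (\<lambda>x. v \<bullet> \<phi> x)) B = emeasure (density \<Lambda> (RN_deriv \<Lambda> (\<Gamma> (\<lambda>x. v \<bullet> \<phi> x)))) B" by simp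
  also have "\<dots> = (\<integral>\<^sup>+x. RN_deriv \<Lambda> (\<Gamma> (\<lambda>x. v \<bullet> \<phi> x)) x * indicator B x \<partial>\<Lambda>)"
    using assms by (intro emeasure_density) auto
  finally show ?thesis .
qed

lemma gam_inner_scale: "B \<in> sets borel \<Longrightarrow> gam (\<lambda>x. (c *\<^sub>R v) \<bullet> \<phi> x) B = \<bar>c\<bar> * gam (\<lambda>x. v \<bullet> \<phi> x) B"
  using gam_scale[OF inner_mem, of B c v] by simp

definition inf_density :: "'a \<Rightarrow> ennreal" where
  "inf_density = lattice_inf \<Lambda> ((\<lambda>v. RN_deriv \<Lambda> (\<Gamma> (\<lambda>y. \<Sum>i\<in>UNIV. v $ i * \<phi> y $ i))) ` sphere 0 1)"

text \<open>The infimum is introduced by \<open>SOME\<close>, so all its properties depend on the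
  existence shown in \<open>lattice_inf_exists\<close>.\<close>

lemma inf_density:
  "inf_density \<in> borel_measurable \<Lambda>"
  "norm v = 1 \<Longrightarrow> AE x in \<Lambda>. inf_density x \<le> RN_deriv \<Lambda> (\<Gamma> (\<lambda>x. v \<bullet> \<phi> x)) x"
proof -
  let ?G = "(\<lambda>v. RN_deriv \<Lambda> (\<Gamma> (\<lambda>y. \<Sum>i\<in>UNIV. v $ i * \<phi> y $ i))) ` sphere 0 1"
  have "\<exists>G. is_lattice_inf \<Lambda> ?G G"
    by (rule lattice_inf_exists[OF finite_Lambda]) auto
  then have is_inf: "is_lattice_inf \<Lambda> ?G inf_density"
    unfolding inf_density_def lattice_inf_def by (rule someI_ex)
  then show "inf_density \<in> borel_measurable \<Lambda>" by (simp add: is_lattice_inf_def)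
  assume "norm v = 1"
  then have "RN_deriv \<Lambda> (\<Gamma> (\<lambda>y. \<Sum>i\<in>UNIV. v $ i * \<phi> y $ i)) \<in> ?G" by (intro imageI) simp
  moreover have "(\<lambda>y. \<Sum>i\<in>UNIV. v $ i * \<phi> y $ i) = (\<lambda>x. v \<bullet> \<phi> x)" by (simp add: inner_vec_def)
  ultimately have "RN_deriv \<Lambda> (\<Gamma> (\<lambda>x. v \<bullet> \<phi> x)) \<in> ?G" by simp
  then show "AE x in \<Lambda>. inf_density x \<le> RN_deriv \<Lambda> (\<Gamma> (\<lambda>x. v \<bullet> \<phi> x)) x"
    using is_inf unfolding is_lattice_inf_def by blast
qed

text \<open>The infimum controls unit vectors; homogeneity of the energy measure restores the factor
  \<open>norm \<xi> powr p\<close>.\<close>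

lemma Gamma_inner_ge:
  assumes B: "B \<in> sets borel" and \<gamma>: "0 \<le> \<gamma>" "\<And>x. x \<in> B \<Longrightarrow> ennreal \<gamma> \<le> inf_density x"
  shows "norm \<xi> powr p * (\<gamma> * measure \<Lambda> B) \<le> measure (\<Gamma> (\<lambda>x. \<xi> \<bullet> \<phi> x)) B"
proof (cases "\<xi> = 0")
  case False
  define v where "v = (1 / norm \<xi>) *\<^sub>R \<xi>"
  have v: "norm v = 1" "\<xi> = norm \<xi> *\<^sub>R v" using False by (auto simp: v_def)
  have "ennreal (\<gamma> * measure \<Lambda> B) = (\<integral>\<^sup>+x. ennreal \<gamma> * indicator B x \<partial>\<Lambda>)"
    using B \<gamma>(1) finite_measure.emeasure_eq_measure[OF finite_Lambda] by (simp add: nn_integral_cmult_indicator ennreal_mult)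
  also have "\<dots> \<le> (\<integral>\<^sup>+x. RN_deriv \<Lambda> (\<Gamma> (\<lambda>x. v \<bullet> \<phi> x)) x * indicator B x \<partial>\<Lambda>)"
  proof (rule nn_integral_mono_AE)
    show "AE x in \<Lambda>. ennreal \<gamma> * indicator B x \<le> RN_deriv \<Lambda> (\<Gamma> (\<lambda>x. v \<bullet> \<phi> x)) x * indicator B x"
      using inf_density(2)[OF v(1)]
    proof eventually_elim
      fix x assume "inf_density x \<le> RN_deriv \<Lambda> (\<Gamma> (\<lambda>x. v \<bullet> \<phi> x)) x"
      then show "ennreal \<gamma> * indicator B x \<le> RN_deriv \<Lambda> (\<Gamma> (\<lambda>x. v \<bullet> \<phi> x)) x * indicator B x"
        using \<gamma>(2)[of x] by (auto simp: indicator_def intro: order_trans)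
    qed
  qed
  also have "\<dots> = ennreal (measure (\<Gamma> (\<lambda>x. v \<bullet> \<phi> x)) B)"
    using emeasure_Gamma_inner[OF B, of v] finite_measure.emeasure_eq_measure[OF finite_\<Gamma>[OF inner_mem]] by simp
  finally have le: "\<gamma> * measure \<Lambda> B \<le> measure (\<Gamma> (\<lambda>x. v \<bullet> \<phi> x)) B" by (simp add: ennreal_le_iff)
  have "gam (\<lambda>x. \<xi> \<bullet> \<phi> x) B = norm \<xi> * gam (\<lambda>x. v \<bullet> \<phi> x) B"
    using gam_inner_scale[OF B, of "norm \<xi>" v] v(2) by simp
  then have "measure (\<Gamma> (\<lambda>x. \<xi> \<bullet> \<phi> x)) B = norm \<xi> powr p * measure (\<Gamma> (\<lambda>x. v \<bullet> \<phi> x)) B"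
    by (metis gam_powr gam_nonneg norm_ge_zero powr_mult)
  then show ?thesis using le by (simp add: mult_left_mono)
qed simp

text \<open>The functions \<open>H k z $ i - \<xi> \<bullet> z\<close> tend to
  \<open>- \<xi> \<bullet> z\<close>, yet over \<open>B\<close> their gradients tend to vectors of
  norm at most \<open>\<eta>\<close>. Lower semicontinuity bounds the energy of the limit by the
  limit of the chain rule bounds. Of \<open>3 * \<eta>\<close>, one part is due to
  \<open>near\<close> and two are the loss in \<open>chain_rule_bound\<close>.\<close>

lemma Gamma_inner_le:
  assumes HG: "\<And>k::nat. (H k, G k) \<in> gradient_fields \<nu> c (1 / real (Suc k))"
    and M: "M \<in> borel_measurable borel" and B: "B \<in> sets borel" and \<eta>: "0 < \<eta>"
    and lim: "AE x in \<Lambda>. x \<in> B \<longrightarrow> (\<lambda>k. G k (\<phi> x)) \<longlonglongrightarrow> M (\<phi> x)"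
    and near: "\<And>x. x \<in> B \<Longrightarrow> norm (M (\<phi> x) $ i - \<xi>) \<le> \<eta>"
  shows "measure (\<Gamma> (\<lambda>x. \<xi> \<bullet> \<phi> x)) B \<le> (real CARD('n) * (3 * \<eta>)) powr p * measure \<Lambda> B"
proof -
  define h where "h k z = H k z $ i - \<xi> \<bullet> z" for k z
  define g where "g k z = G k z $ i - \<xi>" for k z
  have HGD: "H k 0 = 0" "\<bar>H k z $ i\<bar> \<le> 1 / real (Suc k)" "((\<lambda>z. H k z $ i) has_derivative (\<lambda>v. G k z $ i \<bullet> v)) (at z)"
    "continuous_on UNIV (G k)" "norm (G k z $ i) \<le> 1" for k z
    using HG[of k] unfolding gradient_fields_def by auto
  have der: "(h k has_derivative (\<lambda>v. g k z \<bullet> v)) (at z)" for k z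
  proof -
    have "((\<lambda>z. H k z $ i - \<xi> \<bullet> z) has_derivative (\<lambda>v. G k z $ i \<bullet> v - \<xi> \<bullet> v)) (at z)"
      by (intro has_derivative_diff HGD(3) has_derivative_inner_right has_derivative_ident)
    then show ?thesis by (simp add: h_def[abs_def] g_def inner_diff_left)
  qed
  have contg: "continuous_on UNIV (g k)" for k unfolding g_def by (intro continuous_intros HGD(4))
  have ng: "norm (g k z) \<le> 1 + norm \<xi>" for k z
    unfolding g_def using norm_triangle_ineq4[of "G k z $ i" \<xi>] HGD(5)[of k z] by linarith
  have h0: "h k 0 = 0" for k using HGD(1) by (simp add: h_def)
  have liph: "(1 + norm \<xi>)-lipschitz_on UNIV (h k)" for k
    by (rule lipschitz_on_gradient) (use der ng in auto)
  have hE: "energy_le ((1 + norm \<xi>) * real CARD('n)) (\<lambda>x. h k (\<phi> x))" for k by (rule energy_le_lipschitz[OF liph h0])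
  then have hF: "(\<lambda>x. h k (\<phi> x)) \<in> F" for k by (simp add: energy_le_def)
  let ?f = "\<lambda>x. (- \<xi>) \<bullet> \<phi> x"
  have fF: "?f \<in> F" by (rule inner_mem)
  have lipH: "1-lipschitz_on UNIV (\<lambda>z. H k z $ i)" for k
    by (rule lipschitz_on_gradient) (use HGD in auto)
  have limp: "(\<lambda>k. lpint (\<lambda>x. h k (\<phi> x) - ?f x)) \<longlonglongrightarrow> 0"
  proof (rule lpint_dominated[OF F_Lp[OF l1_mem], of _ _ 1])
    show "(\<lambda>x. h k (\<phi> x)) \<in> borel_measurable (completion \<mu>)" for k by (rule Lp_meas[OF F_Lp[OF hF]])
    show "?f \<in> borel_measurable (completion \<mu>)" by (rule Lp_meas[OF F_Lp[OF fF]])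
    fix x
    \<comment> \<open>Uniform smallness of \<open>H k\<close> alone gives no convergence in the
      \<open>p\<close>-norm if \<open>\<mu>\<close> is infinite. The components of
      \<open>H k\<close> are also 1-Lipschitz and vanish at 0, which provides a dominating
      function.\<close>
    show "\<bar>h k (\<phi> x) - ?f x\<bar> \<le> 1 * \<bar>l1 (\<phi> x)\<bar>" for k
    proof -
      have "\<bar>H k (\<phi> x) $ i - H k 0 $ i\<bar> \<le> 1 * norm (\<phi> x - 0)"
        using lipschitz_onD[OF lipH, of "\<phi> x" 0 k] by (simp add: dist_real_def dist_norm)
      then have "\<bar>H k (\<phi> x) $ i\<bar> \<le> norm (\<phi> x)" using HGD(1) by simp
      also have "\<dots> \<le> \<bar>l1 (\<phi> x)\<bar>" using norm_le_l1[of "\<phi> x"] by linarith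
      finally show ?thesis by (simp add: h_def)
    qed
    have "(\<lambda>k. H k (\<phi> x) $ i) \<longlonglongrightarrow> 0"
    proof (rule Lim_null_comparison)
      show "\<forall>\<^sub>F k in sequentially. norm (H k (\<phi> x) $ i) \<le> inverse (real (Suc k))"
        using HGD(2) by (intro always_eventually) (simp add: divide_inverse del: of_nat_Suc)
    qed (rule LIMSEQ_inverse_real_of_nat)
    then have "(\<lambda>k. H k (\<phi> x) $ i - \<xi> \<bullet> \<phi> x) \<longlonglongrightarrow> 0 - \<xi> \<bullet> \<phi> x" by (intro tendsto_intros)
    then show "(\<lambda>k. h k (\<phi> x)) \<longlonglongrightarrow> ?f x" by (simp add: h_def)
  qed
  let ?w = "\<lambda>y. real CARD('n) * (norm y + 2 * \<eta>)"
  let ?C = "(real CARD('n) * ((1 + norm \<xi>) + 2 * \<eta>)) powr p"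
  have bnd: "measure (\<Gamma> (\<lambda>x. h k (\<phi> x))) B \<le> (\<integral>x. indicator B x * ?w (g k (\<phi> x)) powr p \<partial>\<Lambda>)" for k
    by (rule chain_rule_bound[OF der contg ng h0 \<eta> B])
  have gm: "(\<lambda>x. g k (\<phi> x)) \<in> borel_measurable borel" for k
    using measurable_compose[OF phi_borel borel_measurable_continuous_onI[OF contg]] .
  have Mi: "(\<lambda>x. M (\<phi> x) $ i - \<xi>) \<in> borel_measurable borel"
  proof -
    have "(\<lambda>A::real^'n^'n. A $ i - \<xi>) \<in> borel_measurable borel"
      by (intro borel_measurable_continuous_onI continuous_intros)
    from measurable_compose[OF measurable_compose[OF phi_borel M] this] show ?thesis .
  qed
  have wm: "(\<lambda>x. indicator B x * ?w (u x) powr p) \<in> borel_measurable \<Lambda>" if "u \<in> borel_measurable borel" for u :: "'a \<Rightarrow> real ^ 'n"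
    using that B by (simp cong: measurable_cong_sets)
  have conv: "(\<lambda>k. \<integral>x. indicator B x * ?w (g k (\<phi> x)) powr p \<partial>\<Lambda>) \<longlonglongrightarrow> (\<integral>x. indicator B x * ?w (M (\<phi> x) $ i - \<xi>) powr p \<partial>\<Lambda>)"
  proof (rule integral_dominated_convergence[where w = "\<lambda>_. ?C"])
    show "(\<lambda>x. indicator B x * ?w (M (\<phi> x) $ i - \<xi>) powr p) \<in> borel_measurable \<Lambda>" by (rule wm[OF Mi])
    show "(\<lambda>x. indicator B x * ?w (g k (\<phi> x)) powr p) \<in> borel_measurable \<Lambda>" for k by (rule wm[OF gm])
    show "integrable \<Lambda> (\<lambda>_. ?C)" by (rule finite_measure.integrable_const[OF finite_Lambda])
    show "AE x in \<Lambda>. (\<lambda>k. indicator B x * ?w (g k (\<phi> x)) powr p) \<longlonglongrightarrow> indicator B x * ?w (M (\<phi> x) $ i - \<xi>) powr p"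
      using lim
    proof eventually_elim
      fix x assume x: "x \<in> B \<longrightarrow> (\<lambda>k. G k (\<phi> x)) \<longlonglongrightarrow> M (\<phi> x)"
      show "(\<lambda>k. indicator B x * ?w (g k (\<phi> x)) powr p) \<longlonglongrightarrow> indicator B x * ?w (M (\<phi> x) $ i - \<xi>) powr p"
      proof (cases "x \<in> B")
        case True
        then have "(\<lambda>k. g k (\<phi> x)) \<longlonglongrightarrow> M (\<phi> x) $ i - \<xi>" using x unfolding g_def by (intro tendsto_intros) auto
        then show ?thesis using \<eta> by (intro tendsto_intros) (auto simp: add_nonneg_eq_0_iff)
      qed simp
    qed
    show "AE x in \<Lambda>. norm (indicator B x * ?w (g k (\<phi> x)) powr p) \<le> ?C" for k
    proof (intro AE_I2)
      fix x
      have "?w (g k (\<phi> x)) powr p \<le> ?C"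
        using ng[of k "\<phi> x"] \<eta> p_gt_1 by (intro powr_mono2 mult_left_mono) auto
      then show "norm (indicator B x * ?w (g k (\<phi> x)) powr p) \<le> ?C" by (simp add: indicator_def)
    qed
  qed
  have "measure (\<Gamma> ?f) B \<le> (\<integral>x. indicator B x * ?w (M (\<phi> x) $ i - \<xi>) powr p \<partial>\<Lambda>)"
    by (rule Gamma_limit_le[OF fF hF limp energy_le_gam_UNIV[OF hE] B bnd conv])
  also have "\<dots> \<le> (\<integral>x. (real CARD('n) * (3 * \<eta>)) powr p * indicator B x \<partial>\<Lambda>)"
  proof (rule integral_mono_AE')
    show "integrable \<Lambda> (\<lambda>x. (real CARD('n) * (3 * \<eta>)) powr p * indicator B x)"
      using B finite_measure.emeasure_finite[OF finite_Lambda] by (intro integrable_mult_right integrable_real_indicator) (auto simp: less_top)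
    show "AE x in \<Lambda>. indicator B x * ?w (M (\<phi> x) $ i - \<xi>) powr p \<le> (real CARD('n) * (3 * \<eta>)) powr p * indicator B x"
    proof (intro AE_I2)
      fix x
      show "indicator B x * ?w (M (\<phi> x) $ i - \<xi>) powr p \<le> (real CARD('n) * (3 * \<eta>)) powr p * indicator B x"
      proof (cases "x \<in> B")
        case True
        have "?w (M (\<phi> x) $ i - \<xi>) \<le> real CARD('n) * (3 * \<eta>)" using near[OF True] by (intro mult_left_mono) auto
        then have "?w (M (\<phi> x) $ i - \<xi>) powr p \<le> (real CARD('n) * (3 * \<eta>)) powr p"
          using \<eta> p_gt_1 by (intro powr_mono2) auto
        then show ?thesis using True by simp
      qed simp
    qed
  qed (auto simp: indicator_def)
  also have "\<dots> = (real CARD('n) * (3 * \<eta>)) powr p * measure \<Lambda> B" using B by simp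
  finally have "measure (\<Gamma> ?f) B \<le> (real CARD('n) * (3 * \<eta>)) powr p * measure \<Lambda> B" .
  moreover have "gam (\<lambda>x. \<xi> \<bullet> \<phi> x) B \<le> gam ?f B" using gam_inner_scale[OF B, of "-1" \<xi>] by simp
  then have "measure (\<Gamma> (\<lambda>x. \<xi> \<bullet> \<phi> x)) B \<le> measure (\<Gamma> ?f) B" by (rule gam_le_imp)
  ultimately show ?thesis by linarith
qed

text \<open>Where the infimum density is at least \<open>\<gamma> a\<close> and row \<open>i\<close>
  of \<open>M\<close> is close to a \<open>\<xi>\<close> away from 0, \<open>Gamma_inner_ge\<close>
  and \<open>Gamma_inner_le\<close> contradict each other unless the set is null. Countably many
  choices of \<open>a\<close>, \<open>b\<close>, \<open>i\<close> and \<open>\<xi>\<close> exhaust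
  the points where \<open>M\<close> is not 0.\<close>

lemma limit_field_vanishes:
  assumes HG: "\<And>k::nat. (H k, G k) \<in> gradient_fields \<nu> c (1 / real (Suc k))"
    and M: "M \<in> borel_measurable borel" and A: "A \<in> sets borel"
    and lim: "AE x in \<Lambda>. x \<in> A \<longrightarrow> (\<lambda>k. G k (\<phi> x)) \<longlonglongrightarrow> M (\<phi> x)"
    and indep: "AE x in \<Lambda>. x \<in> A \<longrightarrow> 0 < inf_density x"
  shows "AE x in \<Lambda>. x \<in> A \<longrightarrow> M (\<phi> x) = 0"
proof -
  have dm: "inf_density \<in> borel_measurable borel"
    using inf_density(1) measurable_cong_sets[OF sets_total_energy_measure refl] by blast
  define \<gamma> where "\<gamma> a = 1 / real (Suc a)" for a :: nat
  have \<gamma>: "0 < \<gamma> a" for a by (simp add: \<gamma>_def)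
  define N' where "N' = real CARD('n)"
  have N': "0 < N'" by (simp add: N'_def)
  have ex: "\<exists>\<eta>>0. \<eta> \<le> \<gamma> b \<and> (N' * (3 * \<eta>)) powr p < \<gamma> b powr p * \<gamma> a" for a b
  proof -
    define r where "r = (\<gamma> b powr p * \<gamma> a) powr (1 / p)"
    have r: "0 < r" using \<gamma>[of a] \<gamma>[of b] by (simp add: r_def)
    have rp: "r powr p = \<gamma> b powr p * \<gamma> a" using \<gamma>[of a] p_gt_1 by (simp add: r_def powr_powr)
    \<comment> \<open>The divisor \<open>6 * N'\<close> keeps \<open>N' * (3 * \<eta>)\<close> at or
      below \<open>r / 2\<close>, so that the needed inequality is strict. The cap
      \<open>\<gamma> b\<close> ensures that \<open>\<xi>\<close> within \<open>\<eta>\<close> of a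
      row of norm at least \<open>2 * \<gamma> b\<close> has norm at least
      \<open>\<gamma> b\<close>.\<close>
    define \<eta> where "\<eta> = min (\<gamma> b) (r / (6 * N'))"
    have \<eta>: "0 < \<eta>" using \<gamma>[of b] r N' by (simp add: \<eta>_def)
    have "\<eta> \<le> r / (6 * N')" by (simp add: \<eta>_def)
    then have "\<eta> * (6 * N') \<le> r" using N' by (simp add: pos_le_divide_eq)
    then have "N' * (3 * \<eta>) < r" using r by (simp add: mult_ac)
    then have "(N' * (3 * \<eta>)) powr p < r powr p" using N' \<eta> p_gt_1 by (intro powr_less_mono2) auto
    then show ?thesis using \<eta> unfolding rp by (intro exI[of _ \<eta>]) (simp add: \<eta>_def)
  qed
  have "\<exists>\<eta>. \<forall>a b. 0 < \<eta> a b \<and> \<eta> a b \<le> \<gamma> b \<and> (N' * (3 * \<eta> a b)) powr p < \<gamma> b powr p * \<gamma> a"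
    by (intro choice allI ex)
  then obtain \<eta> where \<eta>: "\<And>a b. 0 < \<eta> a b" "\<And>a b. \<eta> a b \<le> \<gamma> b" "\<And>a b. (N' * (3 * \<eta> a b)) powr p < \<gamma> b powr p * \<gamma> a" by blast
  have Mi: "(\<lambda>x. norm (M (\<phi> x) $ i - \<xi>)) \<in> borel_measurable borel" for i \<xi>
  proof -
    have "(\<lambda>A::real^'n^'n. norm (A $ i - \<xi>)) \<in> borel_measurable borel"
      by (intro borel_measurable_continuous_onI continuous_intros)
    from measurable_compose[OF measurable_compose[OF phi_borel M] this] show ?thesis .
  qed
  have null: "AE x in \<Lambda>. \<not> (x \<in> A \<and> ennreal (\<gamma> a) \<le> inf_density x \<and> norm (M (\<phi> x) $ i - \<xi>) \<le> \<eta> a b)"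
    if \<xi>: "\<gamma> b \<le> norm \<xi>" for a b i \<xi>
  proof -
    define B where "B = A \<inter> {x \<in> space borel. ennreal (\<gamma> a) \<le> inf_density x} \<inter> {x \<in> space borel. norm (M (\<phi> x) $ i - \<xi>) \<le> \<eta> a b}"
    have B: "B \<in> sets borel" unfolding B_def using A dm Mi[of i \<xi>] by measurable
    have "norm \<xi> powr p * (\<gamma> a * measure \<Lambda> B) \<le> measure (\<Gamma> (\<lambda>x. \<xi> \<bullet> \<phi> x)) B"
      by (rule Gamma_inner_ge[OF B]) (use \<gamma>[of a] in \<open>auto simp: B_def\<close>)
    also have "\<dots> \<le> (N' * (3 * \<eta> a b)) powr p * measure \<Lambda> B"
      unfolding N'_def
    proof (rule Gamma_inner_le[OF HG M B \<eta>(1)])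
      show "AE x in \<Lambda>. x \<in> B \<longrightarrow> (\<lambda>k. G k (\<phi> x)) \<longlonglongrightarrow> M (\<phi> x)"
        using lim by eventually_elim (simp add: B_def)
      show "\<And>x. x \<in> B \<Longrightarrow> norm (M (\<phi> x) $ i - \<xi>) \<le> \<eta> a b" by (simp add: B_def)
    qed
    finally have 1: "norm \<xi> powr p * (\<gamma> a * measure \<Lambda> B) \<le> (N' * (3 * \<eta> a b)) powr p * measure \<Lambda> B" .
    have "\<gamma> b powr p * (\<gamma> a * measure \<Lambda> B) \<le> norm \<xi> powr p * (\<gamma> a * measure \<Lambda> B)"
      using \<xi> \<gamma>[of b] \<gamma>[of a] p_gt_1 by (intro mult_right_mono powr_mono2) auto
    with 1 have 2: "(\<gamma> b powr p * \<gamma> a) * measure \<Lambda> B \<le> (N' * (3 * \<eta> a b)) powr p * measure \<Lambda> B"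
      by (simp add: mult.assoc)
    have "measure \<Lambda> B = 0"
    proof (rule ccontr)
      assume "measure \<Lambda> B \<noteq> 0"
      then have "0 < measure \<Lambda> B" using measure_nonneg[of \<Lambda> B] by linarith
      then have "\<gamma> b powr p * \<gamma> a \<le> (N' * (3 * \<eta> a b)) powr p" using 2 by (rule mult_right_le_imp_le[rotated])
      then show False using \<eta>(3)[of a b] by linarith
    qed
    then have "B \<in> null_sets \<Lambda>"
      using B finite_measure.emeasure_eq_measure[OF finite_Lambda] by auto
    then have "AE x in \<Lambda>. x \<notin> B" by (rule AE_not_in)
    then show ?thesis by eventually_elim (simp add: B_def)
  qed
  obtain D :: "(real ^ 'n) set" where D: "countable D" "\<And>X. open X \<Longrightarrow> X \<noteq> {} \<Longrightarrow> \<exists>d\<in>D. d \<in> X"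
    using countable_dense_setE by blast
  define R where "R \<xi> a b i x \<longleftrightarrow> (\<gamma> b \<le> norm \<xi> \<longrightarrow>
      \<not> (x \<in> A \<and> ennreal (\<gamma> a) \<le> inf_density x \<and> norm (M (\<phi> x) $ i - \<xi>) \<le> \<eta> a b))" for \<xi> a b i x
  have R: "AE x in \<Lambda>. R \<xi> a b i x" for \<xi> a b i
    using null[of b \<xi> a i] by (cases "\<gamma> b \<le> norm \<xi>") (simp_all add: R_def)
  have "AE x in \<Lambda>. \<forall>\<xi>\<in>D. \<forall>a b i. R \<xi> a b i x"
    using R by (subst AE_ball_countable[OF D(1)]) (simp add: AE_all_countable)
  with indep show ?thesis
  proof eventually_elim
    fix x assume pos: "x \<in> A \<longrightarrow> 0 < inf_density x" and x: "\<forall>\<xi>\<in>D. \<forall>a b i. R \<xi> a b i x"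
    show "x \<in> A \<longrightarrow> M (\<phi> x) = 0"
    proof (rule impI, rule vec_eq_iff[THEN iffD2], rule allI, rule ccontr)
      fix i assume xA: "x \<in> A" and "M (\<phi> x) $ i \<noteq> 0 $ i"
      then have n0: "0 < norm (M (\<phi> x) $ i)" by simp
      obtain a where a: "ennreal (\<gamma> a) \<le> inf_density x"
      proof -
        obtain e :: real where e: "0 < e" "ennreal e \<le> inf_density x"
        proof (cases "inf_density x")
          case (real r)
          then show ?thesis using that[of r] pos xA by auto
        next
          case top
          then show ?thesis using that[of 1] by simp
        qed
        obtain a where "\<gamma> a < e" unfolding \<gamma>_def using nat_approx_posE[OF e(1)] by blast
        then have "ennreal (\<gamma> a) \<le> ennreal e" by (intro ennreal_leI) simp
        then show ?thesis using that e(2) order_trans by blast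
      qed
      obtain b where "\<gamma> b < norm (M (\<phi> x) $ i) / 2"
        unfolding \<gamma>_def using nat_approx_posE[of "norm (M (\<phi> x) $ i) / 2"] n0 by auto
      then have b: "2 * \<gamma> b \<le> norm (M (\<phi> x) $ i)" by simp
      obtain \<xi> where \<xi>: "\<xi> \<in> D" "\<xi> \<in> ball (M (\<phi> x) $ i) (\<eta> a b)"
        using D(2)[of "ball (M (\<phi> x) $ i) (\<eta> a b)"] \<eta>(1)[of a b] by auto
      have d: "norm (M (\<phi> x) $ i - \<xi>) \<le> \<eta> a b" using \<xi>(2) by (simp add: dist_norm)
      have "norm (M (\<phi> x) $ i) - norm \<xi> \<le> norm (M (\<phi> x) $ i - \<xi>)" by (rule norm_triangle_ineq2)
      then have "\<gamma> b \<le> norm \<xi>" using d b \<eta>(2)[of a b] by linarith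
      then show False using x \<xi>(1) xA a d unfolding R_def by blast
    qed
  qed
qed

theorem preimage_compact_null:
  assumes A: "A \<in> sets borel" and indep: "AE x in \<Lambda>. x \<in> A \<longrightarrow> 0 < inf_density x"
    and K: "compact K" "negligible K"
  shows "measure \<Lambda> (A \<inter> \<phi> -` K) = 0"
proof (rule ccontr)
  let ?A = "A \<inter> \<phi> -` K"
  assume nz: "measure \<Lambda> ?A \<noteq> 0"
  have Kb: "K \<in> sets borel" by (rule borel_compact[OF K(1)])
  have A' [measurable]: "?A \<in> sets borel" using A vimage_borel[OF Kb] by (rule sets.Int)
  have phiL: "\<phi> \<in> measurable (density \<Lambda> (indicator ?A)) borel"
    using phi_borel by (simp cong: measurable_cong_sets)
  have phiL' [measurable]: "\<phi> \<in> borel_measurable \<Lambda>" using phi_borel by (simp cong: measurable_cong_sets)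
  define \<nu> where "\<nu> = distr (density \<Lambda> (indicator ?A)) borel \<phi>"
  have sets_nu: "sets \<nu> = sets borel" by (simp add: \<nu>_def)
  have em: "emeasure \<nu> B = emeasure \<Lambda> (?A \<inter> \<phi> -` B)" if B: "B \<in> sets borel" for B
    unfolding \<nu>_def using A' vimage_borel[OF B] B
    by (subst emeasure_distr[OF phiL]) (auto simp: emeasure_restricted)
  have fin: "finite_measure \<nu>"
    using em[of UNIV] finite_measure.emeasure_finite[OF finite_Lambda] by (intro finite_measureI) (simp add: \<nu>_def)
  have mU: "measure \<nu> UNIV = measure \<Lambda> ?A" using em[of UNIV] by (simp add: measure_def)
  have indm: "indicator ?A \<in> borel_measurable \<Lambda>" using A' by (intro borel_measurable_indicator) simp
  \<comment> \<open>Statements valid almost everywhere for the pushforward pull back to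
    \<open>\<Lambda>\<close> on \<open>?A\<close>; this brings the convergence of the derivatives
    from Euclidean space to the Dirichlet space.\<close>
  have AE_nu: "AE x in \<Lambda>. x \<in> ?A \<longrightarrow> P (\<phi> x)" if "AE z in \<nu>. P z" for P
  proof -
    have "AE x in density \<Lambda> (indicator ?A). P (\<phi> x)" by (rule AE_distrD[OF phiL that[unfolded \<nu>_def]])
    then have "AE x in \<Lambda>. 0 < (indicator ?A x :: ennreal) \<longrightarrow> P (\<phi> x)" unfolding AE_density[OF indm] .
    then show ?thesis by eventually_elim (auto simp: indicator_def)
  qed
  have conc: "AE z in \<nu>. z \<in> K"
  proof (rule AE_I[of _ _ "- K"])
    have "?A \<inter> \<phi> -` (- K) = {}" by auto
    then show "emeasure \<nu> (- K) = 0" using em[of "- K"] Kb by simp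
    show "- K \<in> sets \<nu>" using Kb by (simp add: sets_nu)
  qed auto
  define c where "c = measure \<nu> UNIV / 2"
  have c: "0 < c" using nz mU unfolding c_def by (simp add: less_le)
  have ne: "gradient_fields \<nu> c (1 / real (Suc k)) \<noteq> {}" for k
  proof -
    have pos: "0 < 1 / real (Suc k)" by simp
    show ?thesis unfolding c_def by (rule smooth_field_with_large_divergence[OF fin sets_nu K conc pos])
  qed
  obtain H G M where HG: "\<And>k::nat. (H k, G k) \<in> gradient_fields \<nu> c (1 / real (Suc k))"
    and M: "M \<in> borel_measurable borel" "AE z in \<nu>. (\<lambda>k. G k z) \<longlonglongrightarrow> M z" "c \<le> (\<integral>z. trace (M z) \<partial>\<nu>)"
    using gradient_fields_limit[OF fin sets_nu ne] by blast
  have "AE x in \<Lambda>. x \<in> ?A \<longrightarrow> M (\<phi> x) = 0"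
  proof (rule limit_field_vanishes[OF HG M(1) A'])
    show "AE x in \<Lambda>. x \<in> ?A \<longrightarrow> (\<lambda>k. G k (\<phi> x)) \<longlonglongrightarrow> M (\<phi> x)" by (rule AE_nu[OF M(2)])
    show "AE x in \<Lambda>. x \<in> ?A \<longrightarrow> 0 < inf_density x" using indep by eventually_elim auto
  qed
  then have "AE x in density \<Lambda> (indicator ?A). M (\<phi> x) = 0"
    unfolding AE_density[OF indm] by eventually_elim (auto simp: indicator_def)
  moreover have "{z \<in> space borel. M z = 0} \<in> sets borel" using M(1) by measurable
  ultimately have "AE z in \<nu>. M z = 0" unfolding \<nu>_def by (subst AE_distr_iff[OF phiL]) auto
  then have "AE z in \<nu>. trace (M z) = 0" by eventually_elim (simp add: trace_def)
  moreover have "(\<lambda>z. trace (M z)) \<in> borel_measurable \<nu>"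
    using measurable_compose[OF M(1) borel_measurable_continuous_onI[OF continuous_trace[OF continuous_on_id]]]
      measurable_cong_sets[OF sets_nu refl] by blast
  ultimately have "(\<integral>z. trace (M z) \<partial>\<nu>) = (\<integral>z. 0 \<partial>\<nu>)" by (intro Bochner_Integration.integral_cong_AE) auto
  then show False using M(3) c by simp
qed

end

context dirichlet_map
begin

text \<open>A finite Borel measure on Euclidean space is inner regular, so compact null sets
  suffice.\<close>

lemma preimage_null:
  assumes A: "A \<in> sets borel" and indep: "AE x in \<Lambda>. x \<in> A \<longrightarrow> 0 < inf_density x"
    and Z: "Z \<in> null_sets lborel"
  shows "emeasure \<Lambda> (A \<inter> \<phi> -` Z) = 0"
proof -
  have Zb: "Z \<in> sets borel" using Z by auto
  have phiL: "\<phi> \<in> measurable (density \<Lambda> (indicator A)) borel"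
    using phi_borel by (simp cong: measurable_cong_sets)
  define \<nu> where "\<nu> = distr (density \<Lambda> (indicator A)) borel \<phi>"
  have sets_nu: "sets \<nu> = sets borel" by (simp add: \<nu>_def)
  have em: "emeasure \<nu> B = emeasure \<Lambda> (A \<inter> \<phi> -` B)" if B: "B \<in> sets borel" for B
    unfolding \<nu>_def using A vimage_borel[OF B] B
    by (subst emeasure_distr[OF phiL]) (auto simp: emeasure_restricted)
  have fin: "emeasure \<nu> (space \<nu>) \<noteq> \<infinity>"
    using em[of UNIV] finite_measure.emeasure_finite[OF finite_Lambda] by (simp add: \<nu>_def)
  have "emeasure \<nu> Z = (SUP K \<in> {K. K \<subseteq> Z \<and> compact K}. emeasure \<nu> K)"
    by (rule inner_regular[OF sets_nu fin Zb])
  also have "\<dots> = 0"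
  proof (rule antisym[OF SUP_least zero_le])
    fix K assume "K \<in> {K. K \<subseteq> Z \<and> compact K}"
    then have K: "K \<subseteq> Z" "compact K" by auto
    have "negligible Z" using Z by (simp add: negligible_iff_null_sets null_sets_completionI)
    then have "negligible K" using K(1) by (rule negligible_subset)
    then have "measure \<Lambda> (A \<inter> \<phi> -` K) = 0" by (rule preimage_compact_null[OF A indep K(2)])
    then have "emeasure \<Lambda> (A \<inter> \<phi> -` K) = 0"
      using finite_measure.emeasure_eq_measure[OF finite_Lambda] by simp
    then show "emeasure \<nu> K \<le> 0" using em[OF borel_compact[OF K(2)]] by simp
  qed
  finally show ?thesis using em[OF Zb] by simp
qed

end

theorem theorem2p64:
  fixes p :: real
    and \<mu> :: "'a::metric_space measure"
    and E :: "('a \<Rightarrow> real) \<Rightarrow> real"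
    and F :: "('a \<Rightarrow> real) set"
    and \<Gamma> :: "('a \<Rightarrow> real) \<Rightarrow> 'a measure"
    and \<phi> :: "'a \<Rightarrow> real ^ 'n"
    and A :: "'a set"
  assumes "1 < p"
    and "regular_local_p_dirichlet_space p \<mu> E F \<Gamma>"
    and "\<And>i. (\<lambda>x. \<phi> x $ i) \<in> F"
    and "\<And>i. quasicontinuous p \<mu> E F (\<lambda>x. \<phi> x $ i)"
    and "A \<in> sets borel"
    and "p_independent \<Gamma> \<phi> A"
  shows "\<phi> \<in> borel_measurable (completion (density (total_energy_measure \<Gamma> \<phi>) (indicator A))) \<and>
         absolutely_continuous lborel (push_forward (density (total_energy_measure \<Gamma> \<phi>) (indicator A)) \<phi>)"
proof -
  interpret regular_local_p_dirichlet_space p \<mu> E F \<Gamma> by (rule assms(2))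
  interpret p_dirichlet p \<mu> E F \<Gamma> by unfold_locales (rule assms(1))
  obtain Os ps where nest: "dirichlet_nest p \<mu> E F \<Gamma> Os ps"
    and cont: "\<And>j i. continuous_on (- Os j) (\<lambda>x. \<phi> x $ i)"
    using nest_exists[OF assms(4)] by blast
  interpret dirichlet_nest p \<mu> E F \<Gamma> Os ps by (rule nest)
  \<comment> \<open>A Borel representative: \<open>\<phi>\<close> is continuous on each closed set
    \<open>- Os j\<close>, these sets exhaust the complement of \<open>N\<close>, and on
    \<open>N\<close> the uncontrolled values become 0. Membership in \<open>F\<close> and the energy
    measures depend only on classes modulo \<open>\<mu>\<close>-null sets.\<close>
  define \<phi>' where "\<phi>' x = (if x \<in> N then 0 else \<phi> x)" for x
  have AE_eq: "AE x in completion \<mu>. \<phi> x = \<phi>' x" using AE_not_N by eventually_elim (simp add: \<phi>'_def)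
  have cont': "continuous_on (- Os j) \<phi>'" for j
  proof -
    have "continuous_on (- Os j) (\<lambda>x. \<chi> i. \<phi> x $ i)" by (intro continuous_on_vec_lambda cont)
    then have "continuous_on (- Os j) \<phi>" by simp
    then show ?thesis
      by (rule continuous_on_cong[THEN iffD1, rotated 2]) (auto simp: \<phi>'_def N_def)
  qed
  have borel': "\<phi>' \<in> borel_measurable borel"
  proof (rule measurable_piecewise_restrict[of "insert N (range (\<lambda>j. - Os j))"])
    fix \<Omega> assume "\<Omega> \<in> insert N (range (\<lambda>j. - Os j))"
    then consider "\<Omega> = N" | j where "\<Omega> = - Os j" by auto
    then show "\<phi>' \<in> measurable (restrict_space borel \<Omega>) borel"
    proof cases
      case 1
      have "(\<lambda>_. 0) \<in> measurable (restrict_space borel N) borel" by simp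
      then show ?thesis unfolding 1
        by (rule measurable_cong[THEN iffD1, rotated]) (simp add: space_restrict_space \<phi>'_def)
    next
      case 2
      show ?thesis unfolding 2 by (rule borel_measurable_continuous_on_restrict[OF cont'])
    qed
    show "\<Omega> \<inter> space borel \<in> sets borel"
      using \<open>\<Omega> \<in> insert N (range (\<lambda>j. - Os j))\<close> open_Os N_borel by auto
  qed (auto simp: N_def)
  have comp_AE: "AE x in completion \<mu>. \<phi> x $ i = \<phi>' x $ i" for i using AE_eq by eventually_elim simp
  have memF: "(\<lambda>x. \<phi>' x $ i) \<in> F" for i by (rule saturated[OF assms(3) comp_AE])
  have "dirichlet_map p \<mu> E F \<Gamma> Os ps \<phi>'"
  proof (intro dirichlet_map.intro nest dirichlet_map_axioms.intro memF borel')
    show "qc (\<lambda>x. \<phi>' x $ i)" for i unfolding qc_def by (intro allI continuous_intros cont')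
  qed
  then interpret dirichlet_map p \<mu> E F \<Gamma> Os ps \<phi>' .
  have Gamma_eq: "\<Gamma> (\<lambda>x. \<phi>' x $ i) = \<Gamma> (\<lambda>x. \<phi> x $ i)" for i
    by (rule \<Gamma>_cong[OF assms(3) memF comp_AE, symmetric])
  have Lambda_eq: "total_energy_measure \<Gamma> \<phi> = \<Lambda>"
    by (simp add: total_energy_measure_def Gamma_eq)
  have Gamma_sum: "\<Gamma> (\<lambda>y. \<Sum>i\<in>UNIV. v $ i * \<phi> y $ i) = \<Gamma> (\<lambda>y. \<Sum>i\<in>UNIV. v $ i * \<phi>' y $ i)" for v
  proof (rule \<Gamma>_cong)
    show "(\<lambda>y. \<Sum>i\<in>UNIV. v $ i * \<phi> y $ i) \<in> F" "(\<lambda>y. \<Sum>i\<in>UNIV. v $ i * \<phi>' y $ i) \<in> F"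
      by (rule sum_mem; simp add: scale_mem assms(3) memF)+
    show "AE x in completion \<mu>. (\<Sum>i\<in>UNIV. v $ i * \<phi> x $ i) = (\<Sum>i\<in>UNIV. v $ i * \<phi>' x $ i)"
      using AE_eq by eventually_elim simp
  qed
  have indep: "AE x in \<Lambda>. x \<in> A \<longrightarrow> 0 < inf_density x"
    using assms(6) unfolding p_independent_def Lambda_eq Gamma_sum inf_density_def .
  let ?M = "density \<Lambda> (indicator A)"
  have em: "emeasure ?M B = emeasure \<Lambda> (A \<inter> B)" if "B \<in> sets borel" for B
    using that assms(5) by (simp add: emeasure_restricted)
  \<comment> \<open>\<open>\<phi>\<close> and \<open>\<phi>'\<close> differ only on
    \<open>N\<close>. Since \<open>\<Lambda>\<close> does not charge \<open>N\<close>, measurability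
    for the completion and nullity of preimages pass from \<open>\<phi>'\<close> to
    \<open>\<phi>\<close>.\<close>
  have "measure \<Lambda> N = 0"
    using Gamma_N[OF memF] by (simp add: measure_Lambda gam_eq_0_iff)
  then have "emeasure \<Lambda> N = 0" using finite_measure.emeasure_eq_measure[OF finite_Lambda] by simp
  moreover have "emeasure \<Lambda> (A \<inter> N) \<le> emeasure \<Lambda> N" by (rule emeasure_mono) auto
  ultimately have N_null: "N \<in> null_sets (completion ?M)"
    using em[OF N_borel] by (intro null_sets_completionI null_setsI) auto
  have meas: "\<phi> \<in> borel_measurable (completion ?M)"
  proof (rule borel_measurableI)
    fix S :: "(real ^ 'n) set" assume S: "open S"
    have "\<phi>' -` S \<in> sets ?M" using S vimage_borel[of S] by simp
    then have 1: "\<phi>' -` S - N \<in> sets (completion ?M)" by (intro sets_completionI_sets) simp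
    have 2: "\<phi> -` S \<inter> N \<in> sets (completion ?M)"
      using null_sets_completion_subset[of "\<phi> -` S \<inter> N" N ?M] N_null by auto
    have "\<phi> -` S \<inter> space (completion ?M) = (\<phi>' -` S - N) \<union> (\<phi> -` S \<inter> N)" by (auto simp: \<phi>'_def)
    also have "\<dots> \<in> sets (completion ?M)" using 1 2 by (rule sets.Un)
    finally show "\<phi> -` S \<inter> space (completion ?M) \<in> sets (completion ?M)" .
  qed
  have "absolutely_continuous lborel (push_forward ?M \<phi>)"
    unfolding absolutely_continuous_def
  proof
    fix Z :: "(real ^ 'n) set" assume Z: "Z \<in> null_sets lborel"
    have Zb: "Z \<in> sets borel" using Z by auto
    have "emeasure ?M (\<phi>' -` Z) = 0" using em[OF vimage_borel[OF Zb]] preimage_null[OF assms(5) indep Z] by simp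
    then have "\<phi>' -` Z \<in> null_sets (completion ?M)"
      using vimage_borel[OF Zb] by (intro null_sets_completionI null_setsI) auto
    then have "\<phi>' -` Z \<union> N \<in> null_sets (completion ?M)" using N_null by (rule null_sets.Un)
    moreover have "\<phi> -` Z \<subseteq> \<phi>' -` Z \<union> N" by (auto simp: \<phi>'_def)
    ultimately have "\<phi> -` Z \<in> null_sets (completion ?M)" by (rule null_sets_completion_subset[rotated])
    then have "emeasure (push_forward ?M \<phi>) Z = 0"
      unfolding push_forward_def using Zb by (subst emeasure_distr[OF meas]) auto
    then show "Z \<in> null_sets (push_forward ?M \<phi>)" using Zb by (intro null_setsI) (auto simp: push_forward_def)
  qed
  then show ?thesis using meas unfolding Lambda_eq by blast
qed

end
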